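(* Let $E$ be a finite directed graph without sinks and sources in which every loop has an exit, and assume that the center of $\mathcal F_E$ is trivial. For each $v\in E^0$ select exactly one edge $e_v$ with $r(e_v)=v$ and let $T=\sum_{v\in E^0}S_{e_v}$ (an isometry). For an automorphism $\alpha\in\mathrm{Aut}(C^*(E))$ the following conditions are equivalent: (1) $\alpha\gamma_z=\gamma_z\alpha$ for each $z\in U(1)$; (2) for each $e\in E^1$ there is a $w\in\mathcal F_E$ such that $\alpha(S_e)=wT$; (3) $\alpha(\mathcal F_E)=\mathcal F_E$.
   Context: A directed graph $E=(E^0,E^1,r,s)$ has vertex set $E^0$, edge set $E^1$, and range and source maps $r,s:E^1\to E^0$; it is finite if $E^0$ and $E^1$ are finite. $C^*(E)$ is the universal $C^*$-algebra generated by mutually orthogonal projections $P_v$ ($v\in E^0$) and partial isometries $S_e$ ($e\in E^1$) with $S_e^*S_e=P_{r(e)}$, $S_e^*S_f=0$ for $e\ne f$, $S_eS_e^*\le P_{s(e)}$, and $P_v=\sum_{s(e)=v}S_eS_e^*$ whenever $v$ emits finitely many and at least one edge. A path of length $k\ge1$ is $\mu=(\mu_1,\ldots,\mu_k)$ with $\mu_j\in E^1$ and $r(\mu_j)=s(\mu_{j+1})$; put $s(\mu)=s(\mu_1)$, $r(\mu)=r(\mu_k)$. A sink is a vertex emitting no edges; a source is a vertex receiving no edges. A loop is a path $\mu$ of length at least $1$ with $s(\mu)=r(\mu)$; it has an exit if some $s(\mu_j)$ emits at least two distinct edges. The gauge action $\gamma:U(1)\to\mathrm{Aut}(C^*(E))$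 is given by $\gamma_z(S_e)=zS_e$, $\gamma_z(P_v)=P_v$; its fixed-point algebra is $\mathcal F_E$ (the core AF-subalgebra). A center is trivial if it equals $\mathbb C1$. *)

theory Defs
  imports
    "HOL-Analysis.Analysis"
    "HOL-Algebra.Module"
    "Graph_Theory.Digraph"
    "Graph_Theory.Arc_Walk"
begin

section \<open>C*-algebras\<close>

text \<open>
  C*-algebras occur in two forms. The algebra under study is a type of class \<open>cstar_algebra\<close>.
  The universal property of a graph C*-algebra, however, quantifies over C*-algebras inside a
  formula; there they are records with an explicit carrier, satisfying \<open>cstar_struct\<close>.
  The record \<open>cstar_of\<close> presents a type of class \<open>cstar_algebra\<close> in the second form, so that
  homomorphisms and Cuntz-Krieger families are defined only once, for records.
  No unit is required, and the zero algebra is allowed.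
\<close>

class cstar_algebra = real_normed_algebra + banach +
  fixes scaleC :: "complex \<Rightarrow> 'a \<Rightarrow> 'a"  (infixr \<open>*\<^sub>C\<close> 75)
    and star :: "'a \<Rightarrow> 'a"
  assumes scaleC_add_right: "c *\<^sub>C (x + y) = c *\<^sub>C x + c *\<^sub>C y"
    and scaleC_add_left: "(c + d) *\<^sub>C x = c *\<^sub>C x + d *\<^sub>C x"
    and scaleC_scaleC: "c *\<^sub>C d *\<^sub>C x = (c * d) *\<^sub>C x"
    and scaleC_of_real: "complex_of_real r *\<^sub>C x = r *\<^sub>R x"
    and mult_scaleC_left: "(c *\<^sub>C x) * y = c *\<^sub>C (x * y)"
    and mult_scaleC_right: "x * (c *\<^sub>C y) = c *\<^sub>C (x * y)"
    and norm_scaleC: "norm (c *\<^sub>C x) = cmod c * norm x"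
    and star_add: "star (x + y) = star x + star y"
    and star_scaleC: "star (c *\<^sub>C x) = cnj c *\<^sub>C star x"
    and star_mult: "star (x * y) = star y * star x"
    and star_star: "star (star x) = x"
    and cstar_identity: "norm (star x * x) = (norm x)\<^sup>2"

definition complex_ring :: "complex ring" where
  "complex_ring = \<lparr>carrier = UNIV, mult = (*), one = 1, zero = 0, add = (+)\<rparr>"

text \<open>The field \<open>one\<close> inherited from the ring record is not used and not constrained.\<close>

record 'a cstar_rec = "(complex, 'a) module" +
  adj :: "'a \<Rightarrow> 'a"
  nrm :: "'a \<Rightarrow> real"

locale cstar_struct = Module.module complex_ring B for B (structure) +
  assumes mult_closed: "\<lbrakk>x \<in> carrier B; y \<in> carrier B\<rbrakk> \<Longrightarrow> x \<otimes> y \<in> carrier B"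
    and mult_assoc: "\<lbrakk>x \<in> carrier B; y \<in> carrier B; z \<in> carrier B\<rbrakk>
          \<Longrightarrow> (x \<otimes> y) \<otimes> z = x \<otimes> (y \<otimes> z)"
    and mult_add_left: "\<lbrakk>x \<in> carrier B; y \<in> carrier B; z \<in> carrier B\<rbrakk>
          \<Longrightarrow> (x \<oplus> y) \<otimes> z = x \<otimes> z \<oplus> y \<otimes> z"
    and mult_add_right: "\<lbrakk>x \<in> carrier B; y \<in> carrier B; z \<in> carrier B\<rbrakk>
          \<Longrightarrow> z \<otimes> (x \<oplus> y) = z \<otimes> x \<oplus> z \<otimes> y"
    and mult_smult_left: "\<lbrakk>x \<in> carrier B; y \<in> carrier B\<rbrakk>
          \<Longrightarrow> (c \<odot>\<^bsub>B\<^esub> x) \<otimes> y = c \<odot>\<^bsub>B\<^esub> (x \<otimes> y)"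
    and mult_smult_right: "\<lbrakk>x \<in> carrier B; y \<in> carrier B\<rbrakk>
          \<Longrightarrow> x \<otimes> (c \<odot>\<^bsub>B\<^esub> y) = c \<odot>\<^bsub>B\<^esub> (x \<otimes> y)"
    and adj_closed: "x \<in> carrier B \<Longrightarrow> adj B x \<in> carrier B"
    and adj_add: "\<lbrakk>x \<in> carrier B; y \<in> carrier B\<rbrakk> \<Longrightarrow> adj B (x \<oplus> y) = adj B x \<oplus> adj B y"
    and adj_smult: "x \<in> carrier B \<Longrightarrow> adj B (c \<odot>\<^bsub>B\<^esub> x) = cnj c \<odot>\<^bsub>B\<^esub> adj B x"
    and adj_mult: "\<lbrakk>x \<in> carrier B; y \<in> carrier B\<rbrakk> \<Longrightarrow> adj B (x \<otimes> y) = adj B y \<otimes> adj B x"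
    and adj_adj: "x \<in> carrier B \<Longrightarrow> adj B (adj B x) = x"
    and nrm_nonneg: "x \<in> carrier B \<Longrightarrow> 0 \<le> nrm B x"
    and nrm_zero_iff: "x \<in> carrier B \<Longrightarrow> nrm B x = 0 \<longleftrightarrow> x = \<zero>"
    and nrm_triangle: "\<lbrakk>x \<in> carrier B; y \<in> carrier B\<rbrakk> \<Longrightarrow> nrm B (x \<oplus> y) \<le> nrm B x + nrm B y"
    and nrm_smult: "x \<in> carrier B \<Longrightarrow> nrm B (c \<odot>\<^bsub>B\<^esub> x) = cmod c * nrm B x"
    and nrm_mult: "\<lbrakk>x \<in> carrier B; y \<in> carrier B\<rbrakk> \<Longrightarrow> nrm B (x \<otimes> y) \<le> nrm B x * nrm B y"
    and nrm_cstar: "x \<in> carrier B \<Longrightarrow> nrm B (adj B x \<otimes> x) = (nrm B x)\<^sup>2"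
    and complete: "Metric_space.mcomplete (carrier B) (\<lambda>x y. nrm B (x \<ominus> y))"

definition cstar_of :: "'a::cstar_algebra cstar_rec" where
  "cstar_of = \<lparr>carrier = UNIV, mult = (*), one = undefined, zero = 0, add = (+),
     smult = (*\<^sub>C), adj = star, nrm = norm\<rparr>"

lemma cstar_of_simps [simp]:
  "carrier cstar_of = UNIV" "mult cstar_of = (*)" "zero cstar_of = 0" "add cstar_of = (+)"
  "smult cstar_of = (*\<^sub>C)" "adj cstar_of = star" "nrm cstar_of = norm"
  by (simp_all add: cstar_of_def)

lemma abelian_group_cstar_of: "abelian_group (cstar_of :: 'a::cstar_algebra cstar_rec)"
  by (rule abelian_groupI) (auto simp: algebra_simps intro: exI[of _ "- x" for x])

lemma minus_cstar_of [simp]: "a_minus cstar_of x y = (x - y :: 'a::cstar_algebra)"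
proof -
  interpret A: abelian_group "cstar_of :: 'a cstar_rec"
    by (rule abelian_group_cstar_of)
  have "a_inv cstar_of y = - y"
    by (rule A.minus_equality[symmetric, THEN sym]) auto
  then show ?thesis
    by (simp add: a_minus_def)
qed

lemma finsum_cstar_of:
  "finite I \<Longrightarrow> finsum cstar_of f I = (\<Sum>i\<in>I. f i :: 'a::cstar_algebra)"
proof (induction I rule: finite_induct)
  interpret A: abelian_group "cstar_of :: 'a cstar_rec"
    by (rule abelian_group_cstar_of)
  case empty
  show ?case by (simp add: A.finsum_empty)
next
  interpret A: abelian_group "cstar_of :: 'a cstar_rec"
    by (rule abelian_group_cstar_of)
  case (insert i I)
  then show ?case by (simp add: A.finsum_insert)
qed

lemma cstar_struct_cstar_of: "cstar_struct (cstar_of :: 'a::cstar_algebra cstar_rec)"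
proof -
  have "cring complex_ring"
    by (unfold_locales)
      (auto simp: complex_ring_def algebra_simps Units_def intro: exI[of _ "- x" for x])
  moreover have "1 *\<^sub>C x = x" for x :: 'a
    using scaleC_of_real[of 1 x] by simp
  ultimately have mod: "Module.module complex_ring (cstar_of :: 'a cstar_rec)"
    by (intro Module.moduleI abelian_group_cstar_of)
      (auto simp: complex_ring_def scaleC_add_left scaleC_add_right scaleC_scaleC)
  have metric: "(\<lambda>x y. norm (x - y :: 'a)) = dist"
    by (simp add: dist_norm fun_eq_iff)
  have "Metric_space.mcomplete (UNIV :: 'a set) dist"
    using complete_UNIV[where 'a = 'a] by simp
  then show ?thesis
    by (intro cstar_struct.intro mod cstar_struct_axioms.intro)
      (auto simp: mult.assoc distrib_right distrib_left mult_scaleC_left mult_scaleC_right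
        star_add star_scaleC star_mult star_star norm_triangle_ineq norm_scaleC
        norm_mult_ineq cstar_identity metric)
qed

definition star_hom :: "'a cstar_rec \<Rightarrow> 'b cstar_rec \<Rightarrow> ('a \<Rightarrow> 'b) \<Rightarrow> bool" where
  "star_hom A B \<phi> \<longleftrightarrow>
     \<phi> \<in> carrier A \<rightarrow> carrier B \<and>
     (\<forall>x\<in>carrier A. \<forall>y\<in>carrier A. \<phi> (x \<oplus>\<^bsub>A\<^esub> y) = \<phi> x \<oplus>\<^bsub>B\<^esub> \<phi> y) \<and>
     (\<forall>x\<in>carrier A. \<forall>y\<in>carrier A. \<phi> (x \<otimes>\<^bsub>A\<^esub> y) = \<phi> x \<otimes>\<^bsub>B\<^esub> \<phi> y) \<and>
     (\<forall>c. \<forall>x\<in>carrier A. \<phi> (c \<odot>\<^bsub>A\<^esub> x) = c \<odot>\<^bsub>B\<^esub> \<phi> x) \<and>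
     (\<forall>x\<in>carrier A. \<phi> (adj A x) = adj B (\<phi> x))"

definition cstar_aut :: "('a::cstar_algebra \<Rightarrow> 'a) set" where
  "cstar_aut = {\<alpha>. star_hom cstar_of cstar_of \<alpha> \<and> bij \<alpha>}"

definition is_projection :: "'a cstar_rec \<Rightarrow> 'a \<Rightarrow> bool" where
  "is_projection B p \<longleftrightarrow> p \<in> carrier B \<and> p \<otimes>\<^bsub>B\<^esub> p = p \<and> adj B p = p"

definition is_partial_isometry :: "'a cstar_rec \<Rightarrow> 'a \<Rightarrow> bool" where
  "is_partial_isometry B s \<longleftrightarrow> s \<in> carrier B \<and> s \<otimes>\<^bsub>B\<^esub> adj B s \<otimes>\<^bsub>B\<^esub> s = s"

text \<open>The order of a C*-algebra: the positive elements are those of the form \<open>z\<^sup>* z\<close>.\<close>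

definition cstar_le :: "'a cstar_rec \<Rightarrow> 'a \<Rightarrow> 'a \<Rightarrow> bool" where
  "cstar_le B x y \<longleftrightarrow> (\<exists>z\<in>carrier B. y \<ominus>\<^bsub>B\<^esub> x = adj B z \<otimes>\<^bsub>B\<^esub> z)"

section \<open>Graph C*-algebras\<close>

text \<open>The source and the range of an edge \<open>e\<close> are \<open>tail E e\<close> and \<open>head E e\<close>.\<close>

definition is_sink :: "('v, 'e) pre_digraph \<Rightarrow> 'v \<Rightarrow> bool" where
  "is_sink E v \<longleftrightarrow> v \<in> verts E \<and> out_arcs E v = {}"

definition is_source :: "('v, 'e) pre_digraph \<Rightarrow> 'v \<Rightarrow> bool" where
  "is_source E v \<longleftrightarrow> v \<in> verts E \<and> in_arcs E v = {}"

text \<open>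
  Paths are arc walks (lists of edges), and the loops of the literature on graph C*-algebras, that
  is, paths of length at least 1 from a vertex to itself, are those with \<open>wf_digraph.closed_w\<close>.
\<close>

definition has_exit :: "('v, 'e) pre_digraph \<Rightarrow> 'e list \<Rightarrow> bool" where
  "has_exit E p \<longleftrightarrow>
     (\<exists>e\<in>set p. \<exists>f\<in>out_arcs E (tail E e). \<exists>g\<in>out_arcs E (tail E e). f \<noteq> g)"

definition ck_family ::
  "('v, 'e) pre_digraph \<Rightarrow> 'a cstar_rec \<Rightarrow> ('v \<Rightarrow> 'a) \<Rightarrow> ('e \<Rightarrow> 'a) \<Rightarrow> bool" where
  "ck_family E B P S \<longleftrightarrow>
     (\<forall>v\<in>verts E. is_projection B (P v)) \<and>
     (\<forall>v\<in>verts E. \<forall>w\<in>verts E. v \<noteq> w \<longrightarrow> P v \<otimes>\<^bsub>B\<^esub> P w = \<zero>\<^bsub>B\<^esub>) \<and>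
     (\<forall>e\<in>arcs E. is_partial_isometry B (S e)) \<and>
     (\<forall>e\<in>arcs E. adj B (S e) \<otimes>\<^bsub>B\<^esub> S e = P (head E e)) \<and>
     (\<forall>e\<in>arcs E. \<forall>f\<in>arcs E. e \<noteq> f \<longrightarrow> adj B (S e) \<otimes>\<^bsub>B\<^esub> S f = \<zero>\<^bsub>B\<^esub>) \<and>
     (\<forall>e\<in>arcs E. cstar_le B (S e \<otimes>\<^bsub>B\<^esub> adj B (S e)) (P (tail E e))) \<and>
     (\<forall>v\<in>verts E. finite (out_arcs E v) \<and> out_arcs E v \<noteq> {} \<longrightarrow>
        P v = (\<Oplus>\<^bsub>B\<^esub>e\<in>out_arcs E v. S e \<otimes>\<^bsub>B\<^esub> adj B (S e)))"

definition closed_star_subalgebra :: "'a::cstar_algebra set \<Rightarrow> bool" where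
  "closed_star_subalgebra D \<longleftrightarrow>
     closed D \<and> 0 \<in> D \<and> (\<forall>x\<in>D. \<forall>y\<in>D. x + y \<in> D) \<and> (\<forall>x\<in>D. \<forall>y\<in>D. x * y \<in> D) \<and>
     (\<forall>c. \<forall>x\<in>D. c *\<^sub>C x \<in> D) \<and> (\<forall>x\<in>D. star x \<in> D)"

text \<open>
  The type \<open>'a\<close> together with \<open>P\<close> and \<open>S\<close> is the universal C*-algebra generated by a
  Cuntz-Krieger family of \<open>E\<close>. As one cannot quantify over types, the C*-algebras against which
  universality is required have their carriers in the fixed type \<open>nat \<Rightarrow> nat \<Rightarrow> complex\<close>. For a
  countable graph, in particular a finite one, nothing is lost: the C*-subalgebra generated by a
  Cuntz-Krieger family is then separable, so it has at most continuum many elements, and an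
  isomorphic copy of it lives on a subset of that type (for example as matrices of operators on
  the sequence space of square-summable sequences). The homomorphism is unique because \<open>P\<close> and
  \<open>S\<close> generate.
\<close>

definition is_graph_cstar ::
  "('v, 'e) pre_digraph \<Rightarrow> ('v \<Rightarrow> 'a::cstar_algebra) \<Rightarrow> ('e \<Rightarrow> 'a) \<Rightarrow> bool" where
  "is_graph_cstar E P S \<longleftrightarrow>
     ck_family E cstar_of P S \<and>
     (\<forall>D. closed_star_subalgebra D \<and> P ` verts E \<subseteq> D \<and> S ` arcs E \<subseteq> D \<longrightarrow> D = UNIV) \<and>
     (\<forall>(B :: (nat \<Rightarrow> nat \<Rightarrow> complex) cstar_rec) Q R.
        cstar_struct B \<and> ck_family E B Q R \<longrightarrow>
        (\<exists>\<phi>. star_hom cstar_of B \<phi> \<and>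
             (\<forall>v\<in>verts E. \<phi> (P v) = Q v) \<and> (\<forall>e\<in>arcs E. \<phi> (S e) = R e)))"

text \<open>
  For a countable graph with \<open>is_graph_cstar E P S\<close>, and \<open>cmod z = 1\<close>, there is exactly one such automorphism.
\<close>

definition gauge_action ::
  "('v, 'e) pre_digraph \<Rightarrow> ('v \<Rightarrow> 'a::cstar_algebra) \<Rightarrow> ('e \<Rightarrow> 'a) \<Rightarrow> complex \<Rightarrow> 'a \<Rightarrow> 'a" where
  "gauge_action E P S z = (THE \<gamma>. \<gamma> \<in> cstar_aut \<and>
     (\<forall>e\<in>arcs E. \<gamma> (S e) = z *\<^sub>C S e) \<and> (\<forall>v\<in>verts E. \<gamma> (P v) = P v))"

definition core_subalgebra ::
  "('v, 'e) pre_digraph \<Rightarrow> ('v \<Rightarrow> 'a::cstar_algebra) \<Rightarrow> ('e \<Rightarrow> 'a) \<Rightarrow> 'a set" where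
  "core_subalgebra E P S = {x. \<forall>z. cmod z = 1 \<longrightarrow> gauge_action E P S z x = x}"

definition center_of :: "'a::cstar_algebra set \<Rightarrow> 'a set" where
  "center_of F = {x\<in>F. \<forall>y\<in>F. x * y = y * x}"

text \<open>The center is \<open>\<complex>1\<close>, where \<open>u\<close> is the identity \<open>1\<close> of the ambient algebra.\<close>

definition has_trivial_center :: "'a::cstar_algebra set \<Rightarrow> bool" where
  "has_trivial_center F \<longleftrightarrow>
     (\<exists>u. (\<forall>x. u * x = x \<and> x * u = x) \<and> center_of F = range (\<lambda>c. c *\<^sub>C u))"

end

theory Submission
  imports Defs
begin

text \<open>
  All three conditions say that every \<open>\<alpha> (S e)\<close> is homogeneous of degree 1, that is, that the gauge
  automorphism of parameter \<open>z\<close> multiplies it by \<open>z\<close>. For (1) this holds because the \<open>S e\<close> generate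
  the algebra (\<open>commutes_with_gauge_iff\<close>), and for (2) because \<open>T\<^sup>* T = 1\<close>, so that \<open>w = \<alpha> (S e) T\<^sup>*\<close> is
  the required element of the core (\<open>factors_through_T_iff\<close>). An automorphism that commutes with the
  gauge action clearly preserves its fixed points. The substance lies in the implication from (3).

  Let \<open>\<alpha>\<close> map the core onto itself and put \<open>y = \<alpha> T\<close>. Since \<open>S e = (S e T\<^sup>*) T\<close>, where \<open>S e T\<^sup>*\<close> lies in
  the core, it is enough to show that \<open>y\<close> has degree 1. The argument rests on two facts.

  First, the core is finite: its isometries are unitary (\<open>core_finite\<close>), because it is the closure of an
  increasing union of finite-dimensional algebras. In contrast, \<open>T\<close> is a proper isometry
  (\<open>T_not_right_invertible\<close>): otherwise the graph would have as many edges as vertices, so that each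
  vertex would emit exactly one edge and no loop could have an exit. Here the projections \<open>P v\<close> must be
  nonzero, and this follows from the universal property: partial shifts on a sequence space form a
  Cuntz-Krieger family with nonzero projections (\<open>exists_faithful_ck_family\<close>).

  Secondly, only scalars commute with the core (\<open>commutes_with_core_scalar\<close>). The Fourier coefficients
  of such an element commute with the core as well. If \<open>r\<close> is one of them, of degree \<open>k > 0\<close>, then \<open>r r\<^sup>*\<close>
  is in the center of the core, hence a scalar; thus \<open>T\<^sup>k r\<^sup>*\<close> is a multiple of an isometry of the core,
  hence of a unitary, and if \<open>r \<noteq> 0\<close> then \<open>T\<close> is unitary, a contradiction. So only the coefficient of
  degree 0 is left, and by convergence of the Fejer means the element lies in the core, and there in
  the center.

  Now conjugation by \<open>y\<close> maps the core into itself. A nonzero Fourier coefficient \<open>q\<close> of \<open>y\<close> intertwines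
  the core with its image in the same manner as \<open>y\<close> does, so \<open>q\<^sup>* y\<close> commutes with the core and is a
  scalar; therefore \<open>y\<close> is a multiple of \<open>q\<close>, which is homogeneous of some degree \<open>n\<close>. If \<open>n\<close> were at most
  0, then \<open>y T\<^sup>-\<^sup>n\<close> would be an isometry of the core, and \<open>T\<close> would again be unitary. Likewise, the preimage
  of \<open>T\<close> under \<open>\<alpha>\<close> has a degree \<open>m > 0\<close>. As \<open>\<alpha>\<close> multiplies degrees by \<open>n\<close> and its inverse multiplies them
  by \<open>m\<close>, we have \<open>n m = 1\<close> and \<open>n = 1\<close>.

  The gauge automorphisms themselves are obtained from the universal property. Their continuity, like
  that of all homomorphisms here, follows from an elementary argument with unitaries
  (\<open>star_hom_contractive\<close>).
\<close>

section \<open>Elementary facts about C*-algebras\<close>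

interpretation cvec: vector_space "scaleC :: complex \<Rightarrow> 'a \<Rightarrow> 'a::cstar_algebra"
proof
  fix x :: 'a
  show "1 *\<^sub>C x = x"
    using scaleC_of_real[of 1 x] by simp
qed (simp_all add: scaleC_add_left scaleC_add_right scaleC_scaleC)

abbreviation cspan :: "'a::cstar_algebra set \<Rightarrow> 'a set" where
  "cspan \<equiv> cvec.span"

lemma scaleC_scaleR: "c *\<^sub>C (r *\<^sub>R x) = r *\<^sub>R (c *\<^sub>C x)" for x :: "'a::cstar_algebra"
  by (simp only: scaleC_scaleC mult.commute flip: scaleC_of_real)

lemma star_zero [simp]: "star 0 = (0 :: 'a::cstar_algebra)"
  using star_add[of 0 0] by simp

lemma star_minus: "star (- x) = - star x" for x :: "'a::cstar_algebra"
  using star_add[of x "- x"] by (simp add: eq_neg_iff_add_eq_0 add.commute)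

lemma star_diff: "star (x - y) = star x - star y" for x :: "'a::cstar_algebra"
  using star_add[of x "- y"] by (simp add: star_minus)

lemma star_scaleR: "star (r *\<^sub>R x) = r *\<^sub>R star x" for x :: "'a::cstar_algebra"
  using star_scaleC[of "complex_of_real r" x] by (simp add: scaleC_of_real)

lemma star_sum: "star (\<Sum>i\<in>I. f i) = (\<Sum>i\<in>I. star (f i) :: 'a::cstar_algebra)"
  by (induction I rule: infinite_finite_induct) (simp_all add: star_add)

lemma norm_star: "norm (star x) = norm x" for x :: "'a::cstar_algebra"
proof -
  have le: "norm y \<le> norm (star y)" for y :: 'a
  proof (cases "y = 0")
    case False
    have "(norm y)\<^sup>2 \<le> norm (star y) * norm y"
      using norm_mult_ineq[of "star y" y] by (simp add: cstar_identity)
    with False show ?thesis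
      by (simp add: power2_eq_square)
  qed simp
  from le[of x] le[of "star x"] show ?thesis
    by (simp add: star_star)
qed

lemma star_mult_self_eq_0_iff: "star x * x = 0 \<longleftrightarrow> x = 0" for x :: "'a::cstar_algebra"
  using cstar_identity[of x] by auto

lemma bounded_linear_star: "bounded_linear (star :: 'a \<Rightarrow> 'a::cstar_algebra)"
  by (rule bounded_linear_intro[where K = 1]) (simp_all add: star_add star_scaleR norm_star)

lemma bounded_linear_scaleC: "bounded_linear (\<lambda>x :: 'a::cstar_algebra. c *\<^sub>C x)"
  by (rule bounded_linear_intro[where K = "cmod c"])
    (simp_all add: scaleC_add_right scaleC_scaleR norm_scaleC mult.commute)

lemma bounded_bilinear_scaleC: "bounded_bilinear (\<lambda>c (x :: 'a::cstar_algebra). c *\<^sub>C x)"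
proof
  show "\<exists>K. \<forall>c (x :: 'a). norm (c *\<^sub>C x) \<le> norm c * norm x * K"
    by (rule exI[of _ 1]) (simp add: norm_scaleC)
next
  fix r and c :: complex and x :: 'a
  show "(r *\<^sub>R c) *\<^sub>C x = r *\<^sub>R (c *\<^sub>C x)"
    by (simp only: scaleR_conv_of_real scaleC_scaleC flip: scaleC_of_real)
qed (simp_all add: scaleC_add_left scaleC_add_right scaleC_scaleR)

lemmas continuous_on_star [continuous_intros] =
  bounded_linear.continuous_on[OF bounded_linear_star]

lemmas continuous_on_scaleC [continuous_intros] =
  bounded_bilinear.continuous_on[OF bounded_bilinear_scaleC]

lemma closed_star_subalgebraD:
  assumes "closed_star_subalgebra D"
  shows "closed D" "0 \<in> D" "\<And>x y. x \<in> D \<Longrightarrow> y \<in> D \<Longrightarrow> x + y \<in> D"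
    "\<And>x y. x \<in> D \<Longrightarrow> y \<in> D \<Longrightarrow> x * y \<in> D" "\<And>c x. x \<in> D \<Longrightarrow> c *\<^sub>C x \<in> D"
    "\<And>x. x \<in> D \<Longrightarrow> star x \<in> D"
  using assms by (auto simp: closed_star_subalgebra_def)

lemma star_hom_cstar_of_iff:
  "star_hom cstar_of cstar_of \<phi> \<longleftrightarrow>
     (\<forall>x y. \<phi> (x + y) = \<phi> x + \<phi> y) \<and> (\<forall>x y. \<phi> (x * y) = \<phi> x * \<phi> y) \<and>
     (\<forall>c x. \<phi> (c *\<^sub>C x) = c *\<^sub>C \<phi> x) \<and> (\<forall>x. \<phi> (star x) = star (\<phi> x))"
  by (simp add: star_hom_def Pi_def)

lemma star_hom_simps:
  fixes \<phi> :: "'a::cstar_algebra \<Rightarrow> 'b::cstar_algebra"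
  assumes "star_hom cstar_of cstar_of \<phi>"
  shows "\<phi> (x + y) = \<phi> x + \<phi> y" "\<phi> (x * y) = \<phi> x * \<phi> y" "\<phi> (c *\<^sub>C x) = c *\<^sub>C \<phi> x"
    "\<phi> (star x) = star (\<phi> x)" "\<phi> (r *\<^sub>R x) = r *\<^sub>R \<phi> x" "\<phi> 0 = 0" "\<phi> (- x) = - \<phi> x"
    "\<phi> (x - y) = \<phi> x - \<phi> y" "\<phi> (sum f I) = (\<Sum>i\<in>I. \<phi> (f i))"
proof -
  note h = assms[unfolded star_hom_cstar_of_iff]
  show add: "\<phi> (x + y) = \<phi> x + \<phi> y" for x y
    using h by simp
  show "\<phi> (x * y) = \<phi> x * \<phi> y" and C: "\<phi> (c *\<^sub>C x) = c *\<^sub>C \<phi> x" "\<phi> (star x) = star (\<phi> x)" for c x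
    using h by simp_all
  show "\<phi> (r *\<^sub>R x) = r *\<^sub>R \<phi> x"
    using C(1)[of "complex_of_real r" x] by (simp add: scaleC_of_real)
  show zero: "\<phi> 0 = 0"
    using add[of 0 0] by simp
  show minus: "\<phi> (- x) = - \<phi> x" for x
    using add[of x "- x"] zero by (simp add: eq_neg_iff_add_eq_0 add.commute)
  show "\<phi> (x - y) = \<phi> x - \<phi> y"
    using add[of x "- y"] minus by simp
  show "\<phi> (sum f I) = (\<Sum>i\<in>I. \<phi> (f i))"
    by (induction I rule: infinite_finite_induct) (simp_all add: zero add)
qed

lemma star_hom_comp:
  assumes "star_hom cstar_of cstar_of \<phi>" "star_hom cstar_of cstar_of \<psi>"
  shows "star_hom cstar_of cstar_of (\<psi> \<circ> \<phi>)"
  using assms by (simp add: star_hom_cstar_of_iff)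

lemma cstar_aut_inverse:
  assumes "\<alpha> \<in> cstar_aut"
  shows "inv_into UNIV \<alpha> \<in> cstar_aut"
proof -
  from assms have h: "star_hom cstar_of cstar_of \<alpha>" and bij: "bij \<alpha>"
    by (auto simp: cstar_aut_def)
  have a: "\<alpha> (inv_into UNIV \<alpha> x) = x" "inv_into UNIV \<alpha> (\<alpha> x) = x" for x
    using bij by (simp_all add: bij_is_surj surj_f_inv_f bij_is_inj)
  have "inv_into UNIV \<alpha> (x + y) = inv_into UNIV \<alpha> x + inv_into UNIV \<alpha> y" "inv_into UNIV \<alpha> (x * y) = inv_into UNIV \<alpha> x * inv_into UNIV \<alpha> y"
    "inv_into UNIV \<alpha> (c *\<^sub>C x) = c *\<^sub>C inv_into UNIV \<alpha> x" "inv_into UNIV \<alpha> (star x) = star (inv_into UNIV \<alpha> x)" for x y c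
    by (rule inv_f_eq[OF bij_is_inj[OF bij]]; simp add: star_hom_simps[OF h] a)+
  then show ?thesis
    using bij by (simp add: cstar_aut_def star_hom_cstar_of_iff bij_imp_bij_inv)
qed

subsection \<open>Homomorphisms on unital C*-algebras are contractive\<close>

locale cstar_unit =
  fixes u :: "'a::cstar_algebra"
  assumes unit_left [simp]: "u * x = x" and unit_right [simp]: "x * u = x"
begin

lemma star_unit [simp]: "star u = u"
  by (metis star_mult star_star unit_left unit_right)

text \<open>
  The square root of \<open>u - h\<^sup>2\<close> is \<open>u - g\<close>, where \<open>g\<close> is a fixed point of \<open>g \<mapsto> (h\<^sup>2 + g\<^sup>2) / 2\<close>. This map
  is a contraction of the ball of radius \<open>\<parallel>h\<^sup>2\<parallel> < 1\<close>, and it preserves the closed set of self-adjoint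
  elements that commute with \<open>h\<close>.
\<close>

lemma exists_sqrt_unit_minus_square:
  assumes h: "star h = h" and norm_h: "norm h < 1"
  obtains c where "star c = c" "c * h = h * c" "c * c = u - h * h"
proof -
  define \<rho> where "\<rho> = norm (h * h)"
  define s where "s = {g. norm g \<le> \<rho> \<and> star g = g \<and> g * h = h * g}"
  define f where "f g = (1/2) *\<^sub>R (h * h + g * g)" for g
  have "\<rho> \<le> norm h * norm h"
    by (simp add: \<rho>_def norm_mult_ineq)
  also have "\<dots> < 1"
    using norm_h mult_strict_mono'[of "norm h" 1 "norm h" 1] by simp
  finally have \<rho>: "0 \<le> \<rho>" "\<rho> < 1"
    by (simp_all add: \<rho>_def)
  have "closed s"
    unfolding s_def by (intro closed_Collect_conj closed_Collect_le closed_Collect_eq continuous_intros)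
  then have "complete s"
    by (simp add: complete_eq_closed)
  moreover have "s \<noteq> {}"
    using \<rho> by (auto simp: s_def intro!: exI[of _ 0])
  moreover have "f ` s \<subseteq> s"
  proof (rule image_subsetI)
    fix g assume "g \<in> s"
    then have g: "norm g \<le> \<rho>" "star g = g" "g * h = h * g"
      by (simp_all add: s_def)
    have "norm (g * g) \<le> \<rho> * \<rho>"
      using norm_mult_ineq[of g g] mult_mono[OF g(1) g(1)] \<rho> by simp
    also have "\<dots> \<le> \<rho>"
      using \<rho> by (simp add: mult_left_le)
    finally have "norm (f g) \<le> \<rho>"
      using norm_triangle_ineq[of "h * h" "g * g"] by (simp add: f_def flip: \<rho>_def)
    moreover have "star (f g) = f g"
      by (simp add: f_def star_scaleR star_add star_mult h g)
    moreover have "f g * h = h * f g"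
    proof -
      have "g * g * h = h * (g * g)"
        by (metis g(3) mult.assoc)
      then show ?thesis
        by (simp add: f_def distrib_left distrib_right mult.assoc)
    qed
    ultimately show "f g \<in> s"
      by (simp add: s_def)
  qed
  moreover have "dist (f x) (f y) \<le> \<rho> * dist x y" if "x \<in> s" "y \<in> s" for x y
  proof -
    have xy: "norm x \<le> \<rho>" "norm y \<le> \<rho>"
      using that by (simp_all add: s_def)
    have "f x - f y = (1/2) *\<^sub>R (x * (x - y) + (x - y) * y)"
      by (simp add: f_def algebra_simps)
    then have "dist (f x) (f y) = (1/2) * norm (x * (x - y) + (x - y) * y)"
      by (simp add: dist_norm)
    also have "\<dots> \<le> (1/2) * (norm x * norm (x - y) + norm (x - y) * norm y)"
      using norm_triangle_ineq[of "x * (x - y)" "(x - y) * y"] norm_mult_ineq[of x "x - y"]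
        norm_mult_ineq[of "x - y" y] by simp
    also have "\<dots> \<le> (1/2) * (\<rho> * norm (x - y) + norm (x - y) * \<rho>)"
      using xy by (intro mult_left_mono add_mono mult_right_mono) auto
    finally show ?thesis
      by (simp add: dist_norm)
  qed
  ultimately have "\<exists>!x\<in>s. f x = x"
    using \<rho> by (intro Banach_fix) auto
  then obtain g where g: "g \<in> s" "f g = g"
    by auto
  then have "2 *\<^sub>R f g = 2 *\<^sub>R g"
    by simp
  then have "h * h + g * g = g + g"
    by (simp add: f_def scaleR_2)
  show thesis
  proof
    show "star (u - g) = u - g" "(u - g) * h = h * (u - g)"
      using g by (simp_all add: s_def star_diff left_diff_distrib right_diff_distrib)
    show "(u - g) * (u - g) = u - h * h"
      using \<open>h * h + g * g = g + g\<close>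
      by (simp add: left_diff_distrib right_diff_distrib algebra_simps)
  qed
qed

text \<open>
  The element \<open>h\<close> is the real part of the unitary \<open>v = h + \<i> \<surd>(u - h\<^sup>2)\<close>. The image of \<open>v\<close> satisfies
  \<open>(\<phi> v)\<^sup>* \<phi> v = \<phi> u\<close>, a projection, so its norm is at most 1.
\<close>

lemma star_hom_self_adjoint_le_1:
  fixes \<phi> :: "'a \<Rightarrow> 'b::cstar_algebra"
  assumes \<phi>: "star_hom cstar_of cstar_of \<phi>" and h: "star h = h" and norm_h: "norm h < 1"
  shows "norm (\<phi> h) \<le> 1"
proof -
  obtain c where c: "star c = c" "c * h = h * c" "c * c = u - h * h"
    using exists_sqrt_unit_minus_square[OF h norm_h] .
  define v where "v = h + \<i> *\<^sub>C c"
  have "norm (\<phi> u) = (norm (\<phi> u))\<^sup>2"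
    using cstar_identity[of "\<phi> u"] by (simp flip: star_hom_simps(2,4)[OF \<phi>])
  then have "norm (\<phi> u) = 0 \<or> norm (\<phi> u) = 1"
    by (simp add: power2_eq_square)
  then have norm_u: "norm (\<phi> u) \<le> 1"
    by auto
  have "star v * v = u"
    by (simp add: v_def star_add star_scaleC h c distrib_left left_diff_distrib mult_scaleC_left
        mult_scaleC_right cvec.scale_right_diff_distrib)
  then have "(norm (\<phi> v))\<^sup>2 = norm (\<phi> u)"
    by (simp flip: cstar_identity star_hom_simps(2,4)[OF \<phi>])
  then have norm_v: "norm (\<phi> v) \<le> 1"
    using norm_u abs_square_le_1[of "norm (\<phi> v)"] by simp
  have "h = (1/2) *\<^sub>R (v + star v)"
    by (simp add: v_def star_add star_scaleC h c flip: scaleR_2)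
  then have "\<phi> h = (1/2) *\<^sub>R (\<phi> v + star (\<phi> v))"
    by (simp flip: star_hom_simps(1,4,5)[OF \<phi>])
  then show ?thesis
    using norm_triangle_ineq[of "\<phi> v" "star (\<phi> v)"] norm_v by (simp add: norm_star)
qed

text \<open>
  By the C*-identity it suffices to treat the self-adjoint element \<open>x\<^sup>* x\<close>, which can be scaled to
  norm less than 1.
\<close>

lemma star_hom_contractive:
  fixes \<phi> :: "'a \<Rightarrow> 'b::cstar_algebra"
  assumes \<phi>: "star_hom cstar_of cstar_of \<phi>"
  shows "norm (\<phi> x) \<le> norm x"
proof -
  define h where "h = star x * x"
  have h: "star h = h"
    by (simp add: h_def star_mult star_star)
  have "norm (\<phi> h) \<le> r" if "norm h < r" for r
  proof -
    have r: "r > 0"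
      using that norm_ge_zero[of h] by linarith
    have "norm (\<phi> ((1 / r) *\<^sub>R h)) \<le> 1"
      by (rule star_hom_self_adjoint_le_1[OF \<phi>]) (use that r h in \<open>simp_all add: star_scaleR\<close>)
    then show ?thesis
      using r by (simp add: star_hom_simps[OF \<phi>] field_simps)
  qed
  then have "norm (\<phi> h) \<le> norm h"
    by (rule dense_ge)
  then have "(norm (\<phi> x))\<^sup>2 \<le> (norm x)\<^sup>2"
    by (simp add: h_def star_hom_simps[OF \<phi>] cstar_identity)
  then show ?thesis
    by simp
qed

lemma star_hom_bounded_linear:
  fixes \<phi> :: "'a \<Rightarrow> 'b::cstar_algebra"
  assumes \<phi>: "star_hom cstar_of cstar_of \<phi>"
  shows "bounded_linear \<phi>"
  by (rule bounded_linear_intro[where K = 1])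
    (simp_all add: star_hom_simps[OF \<phi>] star_hom_contractive[OF \<phi>])

lemma closed_star_subalgebra_equalizer:
  fixes \<phi> \<psi> :: "'a \<Rightarrow> 'b::cstar_algebra"
  assumes \<phi>: "star_hom cstar_of cstar_of \<phi>" and \<psi>: "star_hom cstar_of cstar_of \<psi>"
  shows "closed_star_subalgebra {x. \<phi> x = \<psi> x}"
proof -
  have "closed {x. \<phi> x = \<psi> x}"
    by (intro closed_Collect_eq linear_continuous_on star_hom_bounded_linear assms)
  then show ?thesis
    by (simp add: closed_star_subalgebra_def star_hom_simps[OF \<phi>] star_hom_simps[OF \<psi>])
qed

end

section \<open>Universality for further C*-algebras\<close>

text \<open>
  Transport of structure along \<open>j\<close>, as a record of the kind that the universal property quantifies over.
\<close>

definition push_cstar :: "('a::cstar_algebra \<Rightarrow> 'c) \<Rightarrow> 'c cstar_rec" where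
  "push_cstar j = (let i = inv_into UNIV j in
     \<lparr>carrier = range j, mult = (\<lambda>x y. j (i x * i y)), one = undefined, zero = j 0,
      add = (\<lambda>x y. j (i x + i y)), smult = (\<lambda>c x. j (c *\<^sub>C i x)), adj = (\<lambda>x. j (star (i x))),
      nrm = (\<lambda>x. norm (i x))\<rparr>)"

context
  fixes j :: "'a::cstar_algebra \<Rightarrow> 'c"
  assumes inj: "inj j"
begin

lemma push_cstar_simps:
  "carrier (push_cstar j) = range j" "zero (push_cstar j) = j 0"
  "mult (push_cstar j) (j x) (j y) = j (x * y)" "add (push_cstar j) (j x) (j y) = j (x + y)"
  "smult (push_cstar j) c (j x) = j (c *\<^sub>C x)" "adj (push_cstar j) (j x) = j (star x)"
  "nrm (push_cstar j) (j x) = norm x"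
  by (simp_all add: push_cstar_def Let_def inj)

lemma abelian_group_push_cstar: "abelian_group (push_cstar j)"
proof (rule abelian_groupI)
  fix x assume "x \<in> carrier (push_cstar j)"
  then obtain a where "x = j a"
    by (auto simp: push_cstar_simps)
  then show "\<exists>y\<in>carrier (push_cstar j). y \<oplus>\<^bsub>push_cstar j\<^esub> x = \<zero>\<^bsub>push_cstar j\<^esub>"
    by (intro bexI[of _ "j (- a)"]) (auto simp: push_cstar_simps)
qed (auto simp: push_cstar_simps algebra_simps)

text \<open>
  This holds outside the carrier, too, because the operations are extended to the whole type by
  means of \<open>inv_into\<close>; hence the distance is a metric in the sense of \<open>Metric_space\<close>.
\<close>

lemma minus_push_cstar:
  "a_minus (push_cstar j) x y = j (inv_into UNIV j x - inv_into UNIV j y)"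
proof -
  have "a_inv (push_cstar j) y = j (- inv_into UNIV j y)"
    unfolding a_inv_def m_inv_def
  proof (rule the_equality, goal_cases)
    case 1
    show ?case
      by (simp add: push_cstar_def Let_def inj)
  next
    case (2 z)
    then obtain a where "z = j a" "inv_into UNIV j y + a = 0"
      by (auto simp: push_cstar_def Let_def inj inj_eq[OF inj])
    then show ?case
      by (simp add: add_eq_0_iff)
  qed
  then show ?thesis
    by (simp add: a_minus_def push_cstar_def Let_def inj)
qed

lemma finsum_push_cstar: "finite I \<Longrightarrow> finsum (push_cstar j) (\<lambda>i. j (f i)) I = j (\<Sum>i\<in>I. f i)"
proof (induction I rule: finite_induct)
  interpret A: abelian_group "push_cstar j"
    by (rule abelian_group_push_cstar)
  case empty
  show ?case by (simp add: push_cstar_simps)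
next
  interpret A: abelian_group "push_cstar j"
    by (rule abelian_group_push_cstar)
  case (insert i I)
  then show ?case by (subst A.finsum_insert) (auto simp: push_cstar_simps)
qed

lemma cstar_struct_push_cstar: "cstar_struct (push_cstar j)"
proof -
  let ?d = "\<lambda>x y. dist (inv_into UNIV j x) (inv_into UNIV j y)"
  interpret A: cstar_struct "cstar_of :: 'a cstar_rec"
    by (rule cstar_struct_cstar_of)
  have mod: "Module.module complex_ring (push_cstar j)"
    by (intro Module.moduleI abelian_group_push_cstar A.R.is_cring)
      (auto simp: push_cstar_simps complex_ring_def scaleC_add_left scaleC_add_right scaleC_scaleC)
  interpret M: Metric_space "range j" ?d
    by unfold_locales
      (auto simp: inj inj_eq[OF inj] dist_commute dist_triangle)
  have "M.mcomplete"
    unfolding M.mcomplete_def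
  proof (intro allI impI)
    fix \<sigma> assume \<sigma>: "M.MCauchy \<sigma>"
    define \<tau> where "\<tau> n = inv_into UNIV j (\<sigma> n)" for n
    have ran: "\<sigma> n \<in> range j" for n
      using \<sigma> by (auto simp: M.MCauchy_def)
    have "Cauchy \<tau>"
    proof (rule metric_CauchyI)
      fix e :: real assume "0 < e"
      with \<sigma> have "\<exists>N. \<forall>n n'. N \<le> n \<longrightarrow> N \<le> n' \<longrightarrow> dist (\<tau> n) (\<tau> n') < e"
        unfolding M.MCauchy_def \<tau>_def by simp
      then show "\<exists>N. \<forall>n\<ge>N. \<forall>n'\<ge>N. dist (\<tau> n) (\<tau> n') < e"
        by auto
    qed
    then obtain a where "\<tau> \<longlonglongrightarrow> a"
      using Cauchy_convergent unfolding convergent_def by blast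
    then have "limitin M.mtopology \<sigma> (j a) sequentially"
      using ran by (simp add: M.limit_metric_sequentially inj lim_sequentially \<tau>_def)
    then show "\<exists>x. limitin M.mtopology \<sigma> x sequentially" ..
  qed
  moreover have "(\<lambda>x y. nrm (push_cstar j) (a_minus (push_cstar j) x y)) = ?d"
    by (simp add: minus_push_cstar push_cstar_simps dist_norm fun_eq_iff)
  ultimately show ?thesis
    by (intro cstar_struct.intro mod cstar_struct_axioms.intro)
      (auto simp: push_cstar_simps mult.assoc distrib_right distrib_left mult_scaleC_left
        mult_scaleC_right star_add star_scaleC star_mult star_star norm_triangle_ineq norm_scaleC
        norm_mult_ineq cstar_identity inj_eq[OF inj])
qed

lemma ck_family_push_cstar:
  assumes "fin_digraph E" and ck: "ck_family E cstar_of Q R"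
  shows "ck_family E (push_cstar j) (j \<circ> Q) (j \<circ> R)"
proof -
  interpret fin_digraph E by fact
  have "finite (out_arcs E v)" for v
    by (simp add: out_arcs_def)
  then show ?thesis
    using ck
    by (auto simp: ck_family_def is_projection_def is_partial_isometry_def cstar_le_def
        push_cstar_simps minus_push_cstar inj inj_eq[OF inj] finsum_push_cstar finsum_cstar_of)
qed

end

text \<open>
  The family is pushed forward along \<open>j\<close> into the type that the universal property quantifies over,
  and the homomorphism obtained there has its values in \<open>range j\<close>, so it factors through \<open>j\<close>.
\<close>

lemma is_graph_cstar_universal:
  fixes S :: "'e \<Rightarrow> 'a::cstar_algebra" and R :: "'e \<Rightarrow> 'b::cstar_algebra"
    and j :: "'b \<Rightarrow> nat \<Rightarrow> nat \<Rightarrow> complex"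
  assumes E: "fin_digraph E" and univ: "is_graph_cstar E P S"
    and ck: "ck_family E cstar_of Q R" and inj: "inj j"
  obtains \<phi> where "star_hom cstar_of cstar_of \<phi>" "\<And>v. v \<in> verts E \<Longrightarrow> \<phi> (P v) = Q v"
    "\<And>e. e \<in> arcs E \<Longrightarrow> \<phi> (S e) = R e"
proof -
  have "\<exists>\<psi>. star_hom cstar_of (push_cstar j) \<psi> \<and> (\<forall>v\<in>verts E. \<psi> (P v) = (j \<circ> Q) v) \<and>
      (\<forall>e\<in>arcs E. \<psi> (S e) = (j \<circ> R) e)"
    using univ cstar_struct_push_cstar[OF inj] ck_family_push_cstar[OF inj E ck]
    unfolding is_graph_cstar_def by blast
  then obtain \<psi> where hom: "star_hom cstar_of (push_cstar j) \<psi>"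
    and \<psi>: "\<And>v. v \<in> verts E \<Longrightarrow> \<psi> (P v) = j (Q v)" "\<And>e. e \<in> arcs E \<Longrightarrow> \<psi> (S e) = j (R e)"
    by auto
  have "\<forall>x. \<exists>y. \<psi> x = j y"
    using hom by (auto simp: star_hom_def push_cstar_simps[OF inj] Pi_iff image_iff)
  then obtain \<phi> where \<phi>: "\<And>x. \<psi> x = j (\<phi> x)"
    by metis
  show thesis
  proof
    show "star_hom cstar_of cstar_of \<phi>"
      using hom
      by (simp add: star_hom_def push_cstar_simps[OF inj] \<phi> inj_eq[OF inj])
  qed (use \<psi> in \<open>simp_all add: \<phi> inj_eq[OF inj]\<close>)
qed

text \<open>
  An element is determined by a sequence of approximations. The \<open>n\<close>-th row of its matrix lists the
  coefficients of a linear combination of the \<open>g i\<close> at distance less than \<open>1 / (n + 1)\<close>.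
\<close>

lemma inj_into_matrices:
  fixes g :: "nat \<Rightarrow> 'a::cstar_algebra"
  assumes dense: "closure (cspan (range g)) = UNIV"
  shows "\<exists>j :: 'a \<Rightarrow> nat \<Rightarrow> nat \<Rightarrow> complex. inj j"
proof -
  define comb where "comb c = (\<Sum>i | c i \<noteq> 0. c i *\<^sub>C g i)" for c
  have comb: "\<exists>c. x = comb c" if "x \<in> cspan (range g)" for x
  proof -
    from that obtain t r where t: "finite t" "t \<subseteq> range g" and x: "x = (\<Sum>a\<in>t. r a *\<^sub>C a)"
      by (auto simp: cvec.span_explicit)
    from t(2) obtain I where I: "inj_on g I" "t = g ` I"
      by (metis subset_image_inj)
    define c where "c i = (if i \<in> I then r (g i) else 0)" for i
    have "finite I"
      using t(1) I finite_imageD by auto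
    then have "comb c = (\<Sum>i\<in>I. c i *\<^sub>C g i)"
      unfolding comb_def by (intro sum.mono_neutral_left) (auto simp: c_def)
    also have "\<dots> = x"
      using I by (simp add: x sum.reindex c_def)
    finally show ?thesis
      by auto
  qed
  have "\<exists>c. norm (x - comb c) < 1 / Suc n" for x and n :: nat
  proof -
    have "x \<in> closure (cspan (range g))"
      using dense by simp
    then obtain y where "y \<in> cspan (range g)" "dist y x < 1 / Suc n"
      unfolding closure_approachable by (meson of_nat_0_less_iff zero_less_Suc zero_less_divide_1_iff)
    then show ?thesis
      using comb by (metis dist_commute dist_norm)
  qed
  then obtain j where j: "\<And>x n. norm (x - comb (j x n)) < 1 / Suc n"
    by metis
  have "inj j"
  proof (rule injI)
    fix x y assume eq: "j x = j y"
    have "(\<lambda>n. comb (j x n)) \<longlonglongrightarrow> x" for x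
      by (rule LIM_zero_cancel, rule LIMSEQ_norm_0) (use j[of x] in \<open>simp add: norm_minus_commute\<close>)
    from this[of x] this[of y] show "x = y"
      by (simp add: eq LIMSEQ_unique)
  qed
  then show ?thesis by blast
qed

section \<open>The C*-algebra of bounded operators on a sequence space\<close>

subsection \<open>Square-summable families\<close>

typedef 'i ell2 = "{f :: 'i \<Rightarrow> complex. (\<lambda>i. (cmod (f i))\<^sup>2) summable_on UNIV}"
  morphisms coord Abs_ell2
  by (rule exI[of _ "\<lambda>_. 0"]) simp

setup_lifting type_definition_ell2

lemma coord_summable: "(\<lambda>i. (cmod (coord x i))\<^sup>2) summable_on A"
  by (rule summable_on_subset_banach[of _ UNIV]) (use coord[of x] in auto)

lemma ell2_eqI: "(\<And>i. coord x i = coord y i) \<Longrightarrow> x = y"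
  by (simp add: coord_inject[symmetric] fun_eq_iff)

lemma square_summable_add:
  fixes f g :: "'i \<Rightarrow> complex"
  assumes "(\<lambda>i. (cmod (f i))\<^sup>2) summable_on A" "(\<lambda>i. (cmod (g i))\<^sup>2) summable_on A"
  shows "(\<lambda>i. (cmod (f i + g i))\<^sup>2) summable_on A"
proof (rule summable_on_comparison_test)
  show "(\<lambda>i. 2 * (cmod (f i))\<^sup>2 + 2 * (cmod (g i))\<^sup>2) summable_on A"
    by (intro summable_on_add summable_on_cmult_right assms)
  show "(cmod (f i + g i))\<^sup>2 \<le> 2 * (cmod (f i))\<^sup>2 + 2 * (cmod (g i))\<^sup>2" for i
    using power_mono[OF norm_triangle_ineq norm_ge_zero, of "f i" "g i" 2]
      sum_squares_bound[of "cmod (f i)" "cmod (g i)"]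
    by (simp add: power2_sum)
qed simp

lemma square_summable_mult:
  fixes f :: "'i \<Rightarrow> complex"
  assumes "(\<lambda>i. (cmod (f i))\<^sup>2) summable_on A"
  shows "(\<lambda>i. (cmod (c * f i))\<^sup>2) summable_on A"
  using summable_on_cmult_right[OF assms, of "(cmod c)\<^sup>2"] by (simp add: norm_mult power_mult_distrib)

lift_definition cscale :: "complex \<Rightarrow> 'i ell2 \<Rightarrow> 'i ell2" is "\<lambda>c f i. c * f i"
  by (simp add: square_summable_mult)

instantiation ell2 :: (type) real_vector
begin

lift_definition zero_ell2 :: "'a ell2" is "\<lambda>_. 0" by simp
lift_definition plus_ell2 :: "'a ell2 \<Rightarrow> 'a ell2 \<Rightarrow> 'a ell2" is "\<lambda>f g i. f i + g i"
  by (simp add: square_summable_add)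
lift_definition uminus_ell2 :: "'a ell2 \<Rightarrow> 'a ell2" is "\<lambda>f i. - f i" by simp
lift_definition minus_ell2 :: "'a ell2 \<Rightarrow> 'a ell2 \<Rightarrow> 'a ell2" is "\<lambda>f g i. f i - g i"
proof -
  fix f g :: "'a \<Rightarrow> complex"
  assume "(\<lambda>i. (cmod (f i))\<^sup>2) summable_on UNIV" "(\<lambda>i. (cmod (g i))\<^sup>2) summable_on UNIV"
  then show "(\<lambda>i. (cmod (f i - g i))\<^sup>2) summable_on UNIV"
    using square_summable_add[of f UNIV "\<lambda>i. - g i"] by simp
qed
lift_definition scaleR_ell2 :: "real \<Rightarrow> 'a ell2 \<Rightarrow> 'a ell2" is "\<lambda>r f i. complex_of_real r * f i"
  by (simp add: square_summable_mult)

instance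
  by standard (transfer; simp add: fun_eq_iff algebra_simps)+

end

lemma coord_simps [simp]:
  "coord 0 i = 0" "coord (x + y) i = coord x i + coord y i" "coord (- x) i = - coord x i"
  "coord (x - y) i = coord x i - coord y i" "coord (r *\<^sub>R x) i = r *\<^sub>R coord x i"
  "coord (cscale c x) i = c * coord x i"
  by (simp_all add: zero_ell2.rep_eq plus_ell2.rep_eq uminus_ell2.rep_eq minus_ell2.rep_eq
      scaleR_ell2.rep_eq cscale.rep_eq scaleR_conv_of_real)

lemma coord_inner_summable: "(\<lambda>i. coord x i \<bullet> coord y i) summable_on A"
proof -
  let ?b = "\<lambda>i. (cmod (coord x i))\<^sup>2 + (cmod (coord y i))\<^sup>2"
  have "\<bar>coord x i \<bullet> coord y i\<bar> \<le> ?b i" for i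
    using Cauchy_Schwarz_ineq2[of "coord x i" "coord y i"]
      sum_squares_bound[of "cmod (coord x i)" "cmod (coord y i)"]
      mult_nonneg_nonneg[OF norm_ge_zero norm_ge_zero, of "coord x i" "coord y i"]
    by linarith
  then have "(\<lambda>i. norm (coord x i \<bullet> coord y i)) summable_on A"
    by (intro summable_on_comparison_test[OF summable_on_add[OF coord_summable coord_summable]])
      auto
  then show ?thesis
    by (rule abs_summable_summable)
qed

instantiation ell2 :: (type) real_inner
begin

definition inner_ell2 :: "'a ell2 \<Rightarrow> 'a ell2 \<Rightarrow> real" where
  "inner_ell2 x y = (\<Sum>\<^sub>\<infinity>i. coord x i \<bullet> coord y i)"
definition norm_ell2 :: "'a ell2 \<Rightarrow> real" where
  "norm_ell2 x = sqrt (inner x x)"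
definition sgn_ell2 :: "'a ell2 \<Rightarrow> 'a ell2" where
  "sgn_ell2 x = x /\<^sub>R norm x"
definition dist_ell2 :: "'a ell2 \<Rightarrow> 'a ell2 \<Rightarrow> real" where
  "dist_ell2 x y = norm (x - y)"
definition uniformity_ell2 :: "('a ell2 \<times> 'a ell2) filter" where
  "uniformity_ell2 = (INF e\<in>{0<..}. principal {(x, y). dist x y < e})"
definition open_ell2 :: "'a ell2 set \<Rightarrow> bool" where
  "open_ell2 U \<longleftrightarrow> (\<forall>x\<in>U. \<forall>\<^sub>F (x', y) in uniformity. x' = x \<longrightarrow> y \<in> U)"

instance
proof
  fix x y z :: "'a ell2" and r :: real
  show "inner (x + y) z = inner x z + inner y z"
    by (simp add: inner_ell2_def inner_add_left infsum_add coord_inner_summable)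
  show "inner (r *\<^sub>R x) y = r * inner x y"
    by (simp add: inner_ell2_def infsum_cmult_right')
  show "inner x y = inner y x"
    by (simp add: inner_ell2_def inner_commute)
  show nonneg: "0 \<le> inner x x"
    by (simp add: inner_ell2_def infsum_nonneg)
  show "inner x x = 0 \<longleftrightarrow> x = 0"
  proof
    assume "inner x x = 0"
    then have "coord x i \<bullet> coord x i = 0" for i
      by (intro nonneg_infsum_le_0D[OF _ coord_inner_summable[of x x UNIV]])
        (auto simp: inner_ell2_def)
    then show "x = 0"
      by (intro ell2_eqI) simp
  qed (simp add: inner_ell2_def)
qed (simp_all add: norm_ell2_def sgn_ell2_def dist_ell2_def uniformity_ell2_def open_ell2_def)

end

lemma norm_ell2_square: "(norm x)\<^sup>2 = (\<Sum>\<^sub>\<infinity>i. (cmod (coord x i))\<^sup>2)" for x :: "'i ell2"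
  by (simp add: power2_norm_eq_inner inner_ell2_def)

lemma sum_le_norm_ell2_square:
  "finite A \<Longrightarrow> (\<Sum>i\<in>A. (cmod (coord x i))\<^sup>2) \<le> (norm x)\<^sup>2" for x :: "'i ell2"
  unfolding norm_ell2_square by (rule finite_sum_le_infsum[OF coord_summable]) auto

lemma coord_le_norm: "cmod (coord x i) \<le> norm x" for x :: "'i ell2"
  using sum_le_norm_ell2_square[of "{i}" x] by (simp add: power2_le_iff_abs_le)

lemma norm_cscale: "norm (cscale c x) = cmod c * norm x" for x :: "'i ell2"
proof -
  have "(norm (cscale c x))\<^sup>2 = (cmod c * norm x)\<^sup>2"
    by (simp add: norm_ell2_square power_mult_distrib norm_mult infsum_cmult_right')
  then show ?thesis
    by (simp add: power2_eq_iff_nonneg)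
qed

lemma norm_ell2_le:
  fixes x :: "'i ell2"
  assumes "\<And>A. finite A \<Longrightarrow> (\<Sum>i\<in>A. (cmod (coord x i))\<^sup>2) \<le> b\<^sup>2" "0 \<le> b"
  shows "norm x \<le> b"
proof (rule power2_le_imp_le)
  show "(norm x)\<^sup>2 \<le> b\<^sup>2"
    unfolding norm_ell2_square by (intro infsum_le_finite_sums coord_summable assms)
qed fact

text \<open>
  A Cauchy sequence converges coordinatewise. Its distance to the limit is estimated on finite sets of
  coordinates first, uniformly in the set.
\<close>

instance ell2 :: (type) complete_space
proof
  fix X :: "nat \<Rightarrow> 'a ell2"
  assume X: "Cauchy X"
  have "Cauchy (\<lambda>n. coord (X n) i)" for i
  proof (rule CauchyI)
    fix e :: real assume "0 < e"
    then obtain M where M: "\<And>m n. m \<ge> M \<Longrightarrow> n \<ge> M \<Longrightarrow> norm (X m - X n) < e"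
      using CauchyD[OF X] by blast
    have "cmod (coord (X m) i - coord (X n) i) \<le> norm (X m - X n)" for m n
      using coord_le_norm[of "X m - X n" i] by simp
    then show "\<exists>M. \<forall>m\<ge>M. \<forall>n\<ge>M. cmod (coord (X m) i - coord (X n) i) < e"
      using M order_le_less_trans by blast
  qed
  then obtain f where f: "(\<lambda>n. coord (X n) i) \<longlonglongrightarrow> f i" for i
    unfolding Cauchy_convergent_iff convergent_def by metis
  have bound: "(\<Sum>i\<in>A. (cmod (f i - coord (X m) i))\<^sup>2) \<le> e\<^sup>2"
    if "finite A" and N: "\<And>n. n \<ge> N \<Longrightarrow> norm (X n - X m) \<le> e" for A N m e
  proof (rule LIMSEQ_le_const2)
    show "(\<lambda>n. \<Sum>i\<in>A. (cmod (coord (X n) i - coord (X m) i))\<^sup>2)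
        \<longlonglongrightarrow> (\<Sum>i\<in>A. (cmod (f i - coord (X m) i))\<^sup>2)"
      by (intro tendsto_intros f)
    have "(\<Sum>i\<in>A. (cmod (coord (X n) i - coord (X m) i))\<^sup>2) \<le> e\<^sup>2" if "n \<ge> N" for n
    proof -
      have "(\<Sum>i\<in>A. (cmod (coord (X n) i - coord (X m) i))\<^sup>2) \<le> (norm (X n - X m))\<^sup>2"
        using sum_le_norm_ell2_square[OF \<open>finite A\<close>, of "X n - X m"] by simp
      also have "\<dots> \<le> e\<^sup>2"
        using N[OF that] by (rule power_mono) simp
      finally show ?thesis .
    qed
    then show "\<exists>N. \<forall>n\<ge>N. (\<Sum>i\<in>A. (cmod (coord (X n) i - coord (X m) i))\<^sup>2) \<le> e\<^sup>2"
      by blast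
  qed
  have summable: "(\<lambda>i. (cmod (f i))\<^sup>2) summable_on UNIV"
  proof -
    obtain N where N: "\<And>n. n \<ge> N \<Longrightarrow> norm (X n - X N) \<le> 1"
      using CauchyD[OF X zero_less_one] by (auto intro: less_imp_le)
    have "(\<lambda>i. (cmod (f i - coord (X N) i))\<^sup>2) summable_on UNIV"
      using bound[OF _ N] by (intro nonneg_bdd_above_summable_on) (auto intro!: bdd_aboveI)
    from square_summable_add[OF this coord_summable[of "X N"]] show ?thesis
      by simp
  qed
  define x where "x = Abs_ell2 f"
  have x: "coord x = f"
    using summable by (simp add: x_def Abs_ell2_inverse)
  have "X \<longlonglongrightarrow> x"
  proof (rule LIMSEQ_I)
    fix e :: real assume e: "0 < e"
    then obtain N where N: "\<And>m n. m \<ge> N \<Longrightarrow> n \<ge> N \<Longrightarrow> norm (X n - X m) < e / 2"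
      using CauchyD[OF X, of "e / 2"] by auto
    have "norm (x - X m) \<le> e / 2" if "m \<ge> N" for m
      by (rule norm_ell2_le) (use e bound[of _ N m "e / 2"] N[OF that] in
        \<open>auto simp: x less_imp_le\<close>)
    then have "norm (X m - x) < e" if "m \<ge> N" for m
      using order_le_less_trans[of "norm (x - X m)" "e / 2" e] that e by (simp add: norm_minus_commute)
    then show "\<exists>N. \<forall>n\<ge>N. norm (X n - x) < e"
      by blast
  qed
  then show "convergent X"
    by (auto simp: convergent_def)
qed

instance ell2 :: (type) banach ..

lift_definition single :: "'i \<Rightarrow> complex \<Rightarrow> 'i ell2" is "\<lambda>i c k. if k = i then c else 0"
proof -
  fix i :: 'i and c :: complex
  have "(\<lambda>k. (cmod (if k = i then c else 0))\<^sup>2) summable_on UNIV \<longleftrightarrow>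
    (\<lambda>k. (cmod c)\<^sup>2) summable_on {i}"
    by (rule summable_on_cong_neutral) auto
  then show "(\<lambda>k. (cmod (if k = i then c else 0))\<^sup>2) summable_on UNIV"
    by simp
qed

lemma inner_single: "single i c \<bullet> x = c \<bullet> coord x i"
proof -
  have "single i c \<bullet> x = (\<Sum>\<^sub>\<infinity>k\<in>{i}. coord (single i c) k \<bullet> coord x k)"
    unfolding inner_ell2_def by (rule infsum_cong_neutral) (auto simp: single.rep_eq)
  then show ?thesis
    by (simp add: single.rep_eq)
qed

subsection \<open>Operators that possess an adjoint\<close>

text \<open>
  Use \<open>a (b y) \<bullet> y = b y \<bullet> b y\<close> and the Cauchy-Schwarz inequality.
\<close>

lemma norm_adjoint_le:
  fixes a b :: "'h::real_inner \<Rightarrow>\<^sub>L 'h"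
  assumes "\<And>x y. a x \<bullet> y = x \<bullet> b y"
  shows "norm b \<le> norm a"
proof (rule norm_blinfun_bound)
  fix y
  have "(norm (b y))\<^sup>2 = a (b y) \<bullet> y"
    by (simp add: assms power2_norm_eq_inner)
  also have "\<dots> \<le> norm a * norm (b y) * norm y"
    using order_trans[OF norm_cauchy_schwarz mult_right_mono[OF norm_blinfun norm_ge_zero]] .
  finally show "norm (b y) \<le> norm a * norm y"
    by (cases "b y = 0") (simp_all add: power2_eq_square)
qed simp

lemma norm_adjoint:
  fixes a b :: "'h::real_inner \<Rightarrow>\<^sub>L 'h"
  assumes "\<And>x y. a x \<bullet> y = x \<bullet> b y"
  shows "norm b = norm a"
  using norm_adjoint_le[of a b] norm_adjoint_le[of b a] assms
  by (metis inner_commute order_antisym)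

lemma norm_adjoint_compose:
  fixes a b :: "'h::real_inner \<Rightarrow>\<^sub>L 'h"
  assumes "\<And>x y. a x \<bullet> y = x \<bullet> b y"
  shows "norm (b o\<^sub>L a) = (norm a)\<^sup>2"
proof (rule order_antisym)
  show "norm (b o\<^sub>L a) \<le> (norm a)\<^sup>2"
    using norm_blinfun_compose[of b a] norm_adjoint[OF assms] by (simp add: power2_eq_square)
  have "norm a \<le> sqrt (norm (b o\<^sub>L a))"
  proof (rule norm_blinfun_bound)
    fix x
    have "(norm (a x))\<^sup>2 = x \<bullet> (b o\<^sub>L a) x"
      by (simp add: assms power2_norm_eq_inner)
    also have "\<dots> \<le> norm (b o\<^sub>L a) * (norm x)\<^sup>2"
      using order_trans[OF norm_cauchy_schwarz mult_left_mono[OF norm_blinfun norm_ge_zero],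
          of x "b o\<^sub>L a" x]
      by (simp add: power2_eq_square mult_ac)
    also have "\<dots> = (sqrt (norm (b o\<^sub>L a)) * norm x)\<^sup>2"
      by (simp add: power_mult_distrib)
    finally show "norm (a x) \<le> sqrt (norm (b o\<^sub>L a)) * norm x"
      by (rule power2_le_imp_le) simp
  qed simp
  then show "(norm a)\<^sup>2 \<le> norm (b o\<^sub>L a)"
    using power_mono[of "norm a" _ 2] by fastforce
qed

text \<open>
  An operator is represented together with its adjoint, which makes the involution a mere swap. The
  maps \<open>cscale c\<close> express complex linearity, as the space carries the real vector space structure. For
  complex linear operators, adjointness for the real inner product amounts to adjointness for the
  complex one.
\<close>

typedef 'i ell2_op = "{(a :: 'i ell2 \<Rightarrow>\<^sub>L 'i ell2, b :: 'i ell2 \<Rightarrow>\<^sub>L 'i ell2). (\<forall>x y. a x \<bullet> y = x \<bullet> b y) \<and>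
    (\<forall>c x. a (cscale c x) = cscale c (a x)) \<and> (\<forall>c x. b (cscale c x) = cscale c (b x))}"
  by (rule exI[of _ "(0, 0)"]) (auto intro: ell2_eqI)

(* Operators are to be lifted as they are, not unfolded to functions on families of numbers. *)
lifting_forget ell2.lifting
lifting_forget blinfun.lifting
setup_lifting type_definition_ell2_op

lift_definition op_fun :: "'i ell2_op \<Rightarrow> 'i ell2 \<Rightarrow>\<^sub>L 'i ell2" is fst .

lift_definition op_adj :: "'i ell2_op \<Rightarrow> 'i ell2 \<Rightarrow>\<^sub>L 'i ell2" is snd .

lemma op_adj: "op_fun x v \<bullet> w = v \<bullet> op_adj x w"
  by transfer auto

text \<open>
  The second component of the pair is determined by the first one, because adjoints are unique.
\<close>

lemma op_fun_eqI:
  assumes "op_fun x = op_fun y"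
  shows "x = y"
proof -
  have "v \<bullet> (op_adj x w - op_adj y w) = 0" for v w
    using op_adj[of x v w] op_adj[of y v w] by (simp add: assms inner_diff_right)
  then have "op_adj x w - op_adj y w = 0" for w
    by (metis inner_eq_zero_iff)
  then have "op_adj x = op_adj y"
    by (intro blinfun_eqI) simp
  with assms show ?thesis
    by (simp add: op_fun.rep_eq op_adj.rep_eq prod_eq_iff flip: Rep_ell2_op_inject)
qed

lemma cscale_inner: "cscale c x \<bullet> y = x \<bullet> cscale (cnj c) y" for x :: "'i ell2"
  by (simp add: inner_ell2_def inner_complex_def algebra_simps)

lemma cscale_simps:
  "cscale c (x + y) = cscale c x + cscale c y" "cscale (c + d) x = cscale c x + cscale d x"
  "cscale c (cscale d x) = cscale (c * d) x" "cscale c (r *\<^sub>R x) = r *\<^sub>R cscale c x"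
  "cscale (complex_of_real r) x = r *\<^sub>R x" "cscale c (- x) = - cscale c x"
  "cscale c (x - y) = cscale c x - cscale c y" for x :: "'i ell2"
  by (rule ell2_eqI, simp add: algebra_simps scaleR_conv_of_real)+

definition cscale_op :: "complex \<Rightarrow> 'i ell2 \<Rightarrow>\<^sub>L 'i ell2" where
  "cscale_op c = Blinfun (cscale c)"

lemma cscale_op_apply: "cscale_op c x = cscale c x" for x :: "'i ell2"
proof -
  have "bounded_linear (cscale c :: 'i ell2 \<Rightarrow> 'i ell2)"
    by (rule bounded_linear_intro[where K = "cmod c"])
      (auto simp: cscale_simps norm_cscale mult.commute)
  then show ?thesis
    by (simp add: cscale_op_def bounded_linear_Blinfun_apply)
qed

lemma norm_cscale_op_compose: "norm (cscale_op c o\<^sub>L a) = cmod c * norm a"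
proof (rule order_antisym)
  show "norm (cscale_op c o\<^sub>L a) \<le> cmod c * norm a"
    using norm_blinfun[of a]
    by (intro norm_blinfun_bound)
      (auto simp: cscale_op_apply norm_cscale mult.assoc intro!: mult_left_mono)
  have "norm a \<le> norm (cscale_op c o\<^sub>L a) / cmod c" if "c \<noteq> 0"
    using norm_blinfun[of "cscale_op c o\<^sub>L a"] that
    by (intro norm_blinfun_bound) (auto simp: cscale_op_apply norm_cscale field_simps)
  then show "cmod c * norm a \<le> norm (cscale_op c o\<^sub>L a)"
    by (cases "c = 0") (auto simp: field_simps)
qed

instantiation ell2_op :: (type) real_algebra
begin

lift_definition zero_ell2_op :: "'a ell2_op" is "(0, 0)"
  by (auto intro: ell2_eqI)
lift_definition plus_ell2_op :: "'a ell2_op \<Rightarrow> 'a ell2_op \<Rightarrow> 'a ell2_op"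
  is "\<lambda>(a, b) (c, d). (a + c, b + d)"
  by (auto simp: blinfun.add_left inner_add_left inner_add_right cscale_simps)
lift_definition uminus_ell2_op :: "'a ell2_op \<Rightarrow> 'a ell2_op" is "\<lambda>(a, b). (- a, - b)"
  by (auto simp: blinfun.minus_left cscale_simps)
lift_definition minus_ell2_op :: "'a ell2_op \<Rightarrow> 'a ell2_op \<Rightarrow> 'a ell2_op"
  is "\<lambda>(a, b) (c, d). (a - c, b - d)"
  by (auto simp: blinfun.diff_left inner_diff_left inner_diff_right cscale_simps)
lift_definition scaleR_ell2_op :: "real \<Rightarrow> 'a ell2_op \<Rightarrow> 'a ell2_op"
  is "\<lambda>r (a, b). (r *\<^sub>R a, r *\<^sub>R b)"
  by (auto simp: blinfun.scaleR_left cscale_simps)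
lift_definition times_ell2_op :: "'a ell2_op \<Rightarrow> 'a ell2_op \<Rightarrow> 'a ell2_op"
  is "\<lambda>(a, b) (c, d). (a o\<^sub>L c, d o\<^sub>L b)"
  by auto

lemma op_fun_simps:
  "op_fun 0 = 0" "op_fun (x + y) = op_fun x + op_fun y" "op_fun (- x) = - op_fun x"
  "op_fun (x - y) = op_fun x - op_fun y" "op_fun (r *\<^sub>R x) = r *\<^sub>R op_fun x"
  "op_fun (x * y) = op_fun x o\<^sub>L op_fun y"
  by (transfer; simp (no_asm) add: case_prod_unfold)+

instance
  by standard
    (rule op_fun_eqI, auto simp: op_fun_simps algebra_simps blinfun.add_left blinfun.add_right
      blinfun.scaleR_left blinfun.scaleR_right intro!: blinfun_eqI)+

end

instantiation ell2_op :: (type) real_normed_algebra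
begin

definition norm_ell2_op :: "'a ell2_op \<Rightarrow> real" where
  "norm_ell2_op x = norm (op_fun x)"
definition sgn_ell2_op :: "'a ell2_op \<Rightarrow> 'a ell2_op" where
  "sgn_ell2_op x = x /\<^sub>R norm x"
definition dist_ell2_op :: "'a ell2_op \<Rightarrow> 'a ell2_op \<Rightarrow> real" where
  "dist_ell2_op x y = norm (x - y)"
definition uniformity_ell2_op :: "('a ell2_op \<times> 'a ell2_op) filter" where
  "uniformity_ell2_op = (INF e\<in>{0<..}. principal {(x, y). dist x y < e})"
definition open_ell2_op :: "'a ell2_op set \<Rightarrow> bool" where
  "open_ell2_op U \<longleftrightarrow> (\<forall>x\<in>U. \<forall>\<^sub>F (x', y) in uniformity. x' = x \<longrightarrow> y \<in> U)"

instance
proof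
  fix x y :: "'a ell2_op" and r :: real
  show "norm (x + y) \<le> norm x + norm y"
    by (simp add: norm_ell2_op_def op_fun_simps norm_triangle_ineq)
  show "norm (x * y) \<le> norm x * norm y"
    by (simp add: norm_ell2_op_def op_fun_simps norm_blinfun_compose)
  show "norm (r *\<^sub>R x) = \<bar>r\<bar> * norm x"
    by (simp add: norm_ell2_op_def op_fun_simps)
  show "norm x = 0 \<longleftrightarrow> x = 0"
    unfolding norm_ell2_op_def by (metis norm_eq_zero op_fun_eqI op_fun_simps(1))
qed (simp_all add: sgn_ell2_op_def dist_ell2_op_def uniformity_ell2_op_def open_ell2_op_def)

end

instantiation ell2_op :: (type) cstar_algebra
begin

lift_definition star_ell2_op :: "'a ell2_op \<Rightarrow> 'a ell2_op" is "\<lambda>(a, b). (b, a)"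
  by (clarsimp, metis inner_commute)
lift_definition scaleC_ell2_op :: "complex \<Rightarrow> 'a ell2_op \<Rightarrow> 'a ell2_op"
  is "\<lambda>c (a, b). (cscale_op c o\<^sub>L a, cscale_op (cnj c) o\<^sub>L b)"
  by (auto simp: cscale_op_apply cscale_simps cscale_inner mult.commute)

lemma op_fun_star: "op_fun (star x) = op_adj x"
  by transfer (simp (no_asm) add: case_prod_unfold)

lemma op_fun_scaleC: "op_fun (c *\<^sub>C x) = cscale_op c o\<^sub>L op_fun x"
  by transfer (simp (no_asm) add: case_prod_unfold)

lemma op_fun_cscale: "op_fun x (cscale c v) = cscale c (op_fun x v)"
  by transfer auto

lemma adjoint_pair: "op_fun x v \<bullet> w = v \<bullet> op_fun (star x) w"
  by (simp add: op_fun_star op_adj)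

lemma norm_star_ell2_op: "norm (star x) = norm x" for x :: "'a ell2_op"
  unfolding norm_ell2_op_def by (rule norm_adjoint) (rule adjoint_pair)

instance
proof
  fix X :: "nat \<Rightarrow> 'a ell2_op"
  assume X: "Cauchy X"
  have cauchy: "Cauchy (\<lambda>n. op_fun (X n))" and cauchy': "Cauchy (\<lambda>n. op_fun (star (X n)))"
  proof -
    have "norm (op_fun (X m) - op_fun (X n)) = norm (X m - X n)"
      and "norm (op_fun (star (X m)) - op_fun (star (X n))) = norm (X m - X n)" for m n
    proof -
      show "norm (op_fun (X m) - op_fun (X n)) = norm (X m - X n)"
        by (simp add: norm_ell2_op_def op_fun_simps)
      have "star (X m) - star (X n) = star (X m - X n)"
        by transfer (simp (no_asm) add: case_prod_unfold)
      then show "norm (op_fun (star (X m)) - op_fun (star (X n))) = norm (X m - X n)"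
        by (metis norm_ell2_op_def norm_star_ell2_op op_fun_simps(4))
    qed
    then show "Cauchy (\<lambda>n. op_fun (X n))" "Cauchy (\<lambda>n. op_fun (star (X n)))"
      using X by (simp_all add: Cauchy_def dist_norm)
  qed
  obtain a b where a: "(\<lambda>n. op_fun (X n)) \<longlonglongrightarrow> a" and b: "(\<lambda>n. op_fun (star (X n))) \<longlonglongrightarrow> b"
    using Cauchy_convergent[OF cauchy] Cauchy_convergent[OF cauchy'] by (auto simp: convergent_def)
  have av: "(\<lambda>n. op_fun (X n) v) \<longlonglongrightarrow> a v" and bv: "(\<lambda>n. op_fun (star (X n)) v) \<longlonglongrightarrow> b v" for v
    using a b by (auto intro!: tendsto_intros)
  have cscale_lim: "(\<lambda>n. cscale c (f n)) \<longlonglongrightarrow> cscale c l"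
    if "f \<longlonglongrightarrow> l" for c and f :: "nat \<Rightarrow> 'a ell2" and l
    using bounded_linear.tendsto[OF blinfun.bounded_linear_right that, of "cscale_op c"]
    by (simp add: cscale_op_apply)
  have "a v \<bullet> w = v \<bullet> b w" for v w
  proof (rule LIMSEQ_unique)
    show "(\<lambda>n. op_fun (X n) v \<bullet> w) \<longlonglongrightarrow> a v \<bullet> w"
      by (intro tendsto_intros av)
    show "(\<lambda>n. op_fun (X n) v \<bullet> w) \<longlonglongrightarrow> v \<bullet> b w"
      unfolding adjoint_pair by (intro tendsto_intros bv)
  qed
  moreover have "a (cscale c v) = cscale c (a v)" for c v
    by (rule LIMSEQ_unique[OF av]) (simp add: op_fun_cscale cscale_lim[OF av])
  moreover have "b (cscale c v) = cscale c (b v)" for c v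
    by (rule LIMSEQ_unique[OF bv]) (simp add: op_fun_cscale cscale_lim[OF bv])
  ultimately obtain x where x: "op_fun x = a"
    using op_fun.abs_eq[of "(a, b)"] by (auto simp: eq_onp_def)
  have "norm (X n - x) = norm (op_fun (X n) - a)" for n
    by (simp add: norm_ell2_op_def op_fun_simps x)
  with a have "X \<longlonglongrightarrow> x"
    by (simp add: tendsto_iff dist_norm)
  then show "convergent X"
    by (auto simp: convergent_def)
next
  fix x y :: "'a ell2_op" and c d :: complex and r :: real
  show "c *\<^sub>C (x + y) = c *\<^sub>C x + c *\<^sub>C y" "(c + d) *\<^sub>C x = c *\<^sub>C x + d *\<^sub>C x"
    "c *\<^sub>C d *\<^sub>C x = (c * d) *\<^sub>C x" "complex_of_real r *\<^sub>C x = r *\<^sub>R x"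
    "(c *\<^sub>C x) * y = c *\<^sub>C (x * y)" "x * (c *\<^sub>C y) = c *\<^sub>C (x * y)"
    by (rule op_fun_eqI, rule blinfun_eqI, simp add: op_fun_simps op_fun_scaleC op_fun_cscale
        cscale_op_apply cscale_simps blinfun.add_left blinfun.add_right blinfun.scaleR_left)+
  show "star (x + y) = star x + star y" "star (c *\<^sub>C x) = cnj c *\<^sub>C star x"
    "star (x * y) = star y * star x" "star (star x) = x"
    by (transfer; simp (no_asm) add: case_prod_unfold)+
  show "norm (c *\<^sub>C x) = cmod c * norm x"
    by (simp add: norm_ell2_op_def op_fun_scaleC norm_cscale_op_compose)
  show "norm (star x * x) = (norm x)\<^sup>2"
    unfolding norm_ell2_op_def op_fun_simps by (rule norm_adjoint_compose) (rule adjoint_pair)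
qed

end

text \<open>
  By linearity the matrix determines the values of the operator at the vectors \<open>single k c\<close>, and hence
  the coordinates of all values of the adjoint, which are inner products with these values.
\<close>

lemma inj_matrix: "inj (\<lambda>(x :: 'i ell2_op) i k. coord (op_fun x (single k 1)) i)"
proof (rule injI)
  fix x y :: "'i ell2_op"
  assume "(\<lambda>i k. coord (op_fun x (single k 1)) i) = (\<lambda>i k. coord (op_fun y (single k 1)) i)"
  then have eq: "op_fun x (single k 1) = op_fun y (single k 1)" for k
    by (intro ell2_eqI) meson
  have single: "single k c = cscale c (single k 1)" for k :: 'i and c
    by (rule ell2_eqI) (simp add: single.rep_eq)
  have "op_fun x (single k c) = op_fun y (single k c)" for k c
    by (simp add: single[of k c] eq op_fun_cscale)
  then have "op_fun (x - y) (single k c) = 0" for k c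
    by (simp add: op_fun_simps blinfun.diff_left)
  then have "c \<bullet> coord (op_fun (star (x - y)) v) k = 0" for v k c
    using adjoint_pair[of "x - y" "single k c" v] by (simp add: inner_single)
  then have "coord (op_fun (star (x - y)) v) k = 0" for v k
    by (metis inner_eq_zero_iff)
  then have "op_fun (star (x - y)) = 0"
    by (intro blinfun_eqI ell2_eqI) simp
  then show "x = y"
    by (metis op_fun_eqI op_fun_simps(1) star_star star_zero right_minus_eq)
qed

section \<open>A faithful family of partial shifts\<close>

lemma ell2_op_eqI: "(\<And>x i. coord (op_fun a x) i = coord (op_fun b x) i) \<Longrightarrow> a = b"
  by (intro op_fun_eqI blinfun_eqI ell2_eqI)

text \<open>
  An injective reindexing only omits terms of the series for the norm; this makes the operators below
  contractive.
\<close>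

lemma square_summable_pull:
  fixes \<tau> :: "'i \<Rightarrow> 'i"
  assumes "inj_on \<tau> R"
  shows "(\<lambda>i. (cmod (if i \<in> R then coord x (\<tau> i) else 0))\<^sup>2) summable_on UNIV"
    and "(\<Sum>\<^sub>\<infinity>i. (cmod (if i \<in> R then coord x (\<tau> i) else 0))\<^sup>2) \<le> (norm x)\<^sup>2"
proof -
  let ?f = "\<lambda>i. (cmod (if i \<in> R then coord x (\<tau> i) else 0))\<^sup>2"
  have R: "(\<lambda>i. (cmod (coord x (\<tau> i)))\<^sup>2) summable_on R"
    using coord_summable[of x "\<tau> ` R"] summable_on_reindex[OF assms, of "\<lambda>i. (cmod (coord x i))\<^sup>2"]
    by (simp add: o_def)
  have "?f summable_on UNIV \<longleftrightarrow> (\<lambda>i. (cmod (coord x (\<tau> i)))\<^sup>2) summable_on R"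
    by (rule summable_on_cong_neutral) auto
  with R show "?f summable_on UNIV"
    by simp
  have "infsum ?f UNIV = (\<Sum>\<^sub>\<infinity>i\<in>R. (cmod (coord x (\<tau> i)))\<^sup>2)"
    by (rule infsum_cong_neutral) auto
  also have "\<dots> = (\<Sum>\<^sub>\<infinity>i\<in>\<tau> ` R. (cmod (coord x i))\<^sup>2)"
    using infsum_reindex[OF assms, of "\<lambda>i. (cmod (coord x i))\<^sup>2"] by (simp add: o_def)
  also have "\<dots> \<le> (norm x)\<^sup>2"
    unfolding norm_ell2_square by (rule infsum_mono_neutral) (auto simp: coord_summable)
  finally show "infsum ?f UNIV \<le> (norm x)\<^sup>2" .
qed

definition pull :: "'i set \<Rightarrow> ('i \<Rightarrow> 'i) \<Rightarrow> 'i ell2 \<Rightarrow>\<^sub>L 'i ell2" where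
  "pull R \<tau> = Blinfun (\<lambda>x. Abs_ell2 (\<lambda>i. if i \<in> R then coord x (\<tau> i) else 0))"

lemma coord_pull:
  assumes "inj_on \<tau> R"
  shows "coord (pull R \<tau> x) i = (if i \<in> R then coord x (\<tau> i) else 0)"
proof -
  define T where "T x = Abs_ell2 (\<lambda>i. if i \<in> R then coord x (\<tau> i) else 0)" for x
  have T: "coord (T x) i = (if i \<in> R then coord x (\<tau> i) else 0)" for x i
    using square_summable_pull(1)[OF assms, of x] by (simp add: T_def Abs_ell2_inverse)
  have "norm (T x) \<le> norm x" for x
    by (rule power2_le_imp_le)
      (use square_summable_pull(2)[OF assms, of x] in \<open>simp_all only: norm_ell2_square T norm_ge_zero\<close>)
  then have "bounded_linear T"
    by (intro bounded_linear_intro[where K = 1] ell2_eqI) (simp_all add: T)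
  moreover have "pull R \<tau> = Blinfun T"
    by (simp add: pull_def T_def[abs_def])
  ultimately show ?thesis
    by (simp add: bounded_linear_Blinfun_apply T)
qed

lemma pull_adjoint:
  assumes \<sigma>: "inj_on \<sigma> D"
  shows "pull (\<sigma> ` D) (inv_into D \<sigma>) x \<bullet> y = x \<bullet> pull D \<sigma> y"
proof -
  have "pull (\<sigma> ` D) (inv_into D \<sigma>) x \<bullet> y
      = (\<Sum>\<^sub>\<infinity>i\<in>\<sigma> ` D. coord x (inv_into D \<sigma> i) \<bullet> coord y i)"
    unfolding inner_ell2_def
    by (rule infsum_cong_neutral) (simp_all add: coord_pull[OF inj_on_inv_into[OF order_refl]])
  also have "\<dots> = (\<Sum>\<^sub>\<infinity>i\<in>D. coord x i \<bullet> coord y (\<sigma> i))"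
    unfolding infsum_reindex[OF \<sigma>] by (rule infsum_cong) (simp add: \<sigma>)
  also have "\<dots> = x \<bullet> pull D \<sigma> y"
    unfolding inner_ell2_def by (rule infsum_cong_neutral) (simp_all add: coord_pull[OF \<sigma>])
  finally show ?thesis .
qed

text \<open>The partial isometry that maps \<open>single i c\<close> to \<open>single (\<sigma> i) c\<close> if \<open>i \<in> D\<close>, and to 0 otherwise.\<close>

definition partial_shift :: "'i set \<Rightarrow> ('i \<Rightarrow> 'i) \<Rightarrow> 'i ell2_op" where
  "partial_shift D \<sigma> = Abs_ell2_op (pull (\<sigma> ` D) (inv_into D \<sigma>), pull D \<sigma>)"

lemma coord_partial_shift:
  assumes \<sigma>: "inj_on \<sigma> D"
  shows "coord (op_fun (partial_shift D \<sigma>) x) i = (if i \<in> \<sigma> ` D then coord x (inv_into D \<sigma> i) else 0)"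
    and "coord (op_fun (star (partial_shift D \<sigma>)) x) i = (if i \<in> D then coord x (\<sigma> i) else 0)"
proof -
  have inv: "inj_on (inv_into D \<sigma>) (\<sigma> ` D)"
    by (rule inj_on_inv_into) simp
  have "pull R \<tau> (cscale c x) = cscale c (pull R \<tau> x)" if "inj_on \<tau> R" for R c x and \<tau> :: "'a \<Rightarrow> 'a"
    using that by (intro ell2_eqI) (simp add: coord_pull)
  with \<sigma> inv have "Rep_ell2_op (partial_shift D \<sigma>) = (pull (\<sigma> ` D) (inv_into D \<sigma>), pull D \<sigma>)"
    unfolding partial_shift_def by (intro Abs_ell2_op_inverse) (auto simp: pull_adjoint)
  then have "op_fun (partial_shift D \<sigma>) = pull (\<sigma> ` D) (inv_into D \<sigma>)"
    "op_fun (star (partial_shift D \<sigma>)) = pull D \<sigma>"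
    unfolding op_fun_star by (simp_all add: op_fun.rep_eq op_adj.rep_eq)
  then show "coord (op_fun (partial_shift D \<sigma>) x) i = (if i \<in> \<sigma> ` D then coord x (inv_into D \<sigma> i) else 0)"
    "coord (op_fun (star (partial_shift D \<sigma>)) x) i = (if i \<in> D then coord x (\<sigma> i) else 0)"
    by (simp_all only: coord_pull[OF \<sigma>] coord_pull[OF inv])
qed

text \<open>
  This follows from the C*-identity, as \<open>(s - s p)\<^sup>* (s - s p)\<close> expands to 0.
\<close>

lemma partial_isometryI:
  fixes s p :: "'a::cstar_algebra"
  assumes "star s * s = p" "p * p = p"
  shows "s * p = s"
proof -
  have p: "star p = p"
    using assms(1) by (metis star_mult star_star)
  have "star (s - s * p) * (s - s * p) = star s * s - star s * s * p - p * (star s * s) + p * (star s * s) * p"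
    by (simp add: star_diff star_mult p algebra_simps)
  also have "\<dots> = 0"
    by (simp add: assms)
  finally show ?thesis
    by (simp only: star_mult_self_eq_0_iff) simp
qed

lemma sum_partial_isometries:
  fixes S :: "'e \<Rightarrow> 'a::cstar_algebra"
  assumes A: "finite A" and iso: "\<And>e. e \<in> A \<Longrightarrow> S e * star (S e) * S e = S e"
    and orth: "\<And>e f. e \<in> A \<Longrightarrow> f \<in> A \<Longrightarrow> e \<noteq> f \<Longrightarrow> star (S e) * S f = 0"
  shows "star (\<Sum>e\<in>A. S e * star (S e)) * (\<Sum>e\<in>A. S e * star (S e)) = (\<Sum>e\<in>A. S e * star (S e))"
proof -
  have "S e * star (S e) * (S f * star (S f)) = (if e = f then S e * star (S e) else 0)"
    if "e \<in> A" "f \<in> A" for e f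
    using iso[OF that(1)] orth[OF that] by (metis mult.assoc mult_zero_left mult_zero_right)
  then show ?thesis
    using A by (simp add: star_sum star_mult star_star sum_product sum.delta')
qed

text \<open>
  The remaining relations are consequences: the \<open>R e\<close> are partial isometries since their squares
  \<open>(R e)\<^sup>* R e\<close> are projections, and the difference of \<open>Q v\<close> and a summand is the sum of the others,
  again a projection and therefore positive.
\<close>

lemma ck_familyI:
  fixes R :: "'e \<Rightarrow> 'a::cstar_algebra"
  assumes E: "fin_digraph E"
    and proj: "\<And>v. v \<in> verts E \<Longrightarrow> Q v * Q v = Q v \<and> star (Q v) = Q v"
    and orthQ: "\<And>v w. v \<in> verts E \<Longrightarrow> w \<in> verts E \<Longrightarrow> v \<noteq> w \<Longrightarrow> Q v * Q w = 0"
    and RR: "\<And>e. e \<in> arcs E \<Longrightarrow> star (R e) * R e = Q (head E e)"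
    and orthR: "\<And>e f. e \<in> arcs E \<Longrightarrow> f \<in> arcs E \<Longrightarrow> e \<noteq> f \<Longrightarrow> star (R e) * R f = 0"
    and sum: "\<And>v. v \<in> verts E \<Longrightarrow> Q v = (\<Sum>e\<in>out_arcs E v. R e * star (R e))"
  shows "ck_family E cstar_of Q R"
proof -
  interpret fin_digraph E by fact
  have fin: "finite (out_arcs E v)" for v
    by (simp add: out_arcs_def)
  have iso: "R e * star (R e) * R e = R e" if "e \<in> arcs E" for e
    using partial_isometryI[of "R e" "Q (head E e)"] RR[OF that] proj[of "head E e"] that
    by (simp add: mult.assoc)
  have "\<exists>z. Q (tail E e) - R e * star (R e) = star z * z" if e: "e \<in> arcs E" for e
  proof -
    define z where "z = (\<Sum>f\<in>out_arcs E (tail E e) - {e}. R f * star (R f))"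
    have "star z * z = z"
      unfolding z_def by (rule sum_partial_isometries) (auto simp: fin iso orthR)
    moreover have "Q (tail E e) = R e * star (R e) + z"
      using e unfolding z_def sum[OF tail_in_verts[OF e]] by (intro sum.remove) (auto simp: fin)
    ultimately show ?thesis
      by (metis add_diff_cancel_left')
  qed
  with proj orthQ RR orthR sum iso show ?thesis
    by (simp add: ck_family_def is_projection_def is_partial_isometry_def cstar_le_def
        finsum_cstar_of)
qed

text \<open>
  Take for the \<open>N v\<close> disjoint copies of \<open>\<nat>\<close>, embedded into \<open>\<nat>\<close> by \<open>b\<close>. A vertex \<open>v\<close> emits finitely many
  edges and at least one, so the copies of \<open>\<nat>\<close> indexed by these edges make up a countably infinite set,
  which \<open>\<beta> v\<close> identifies with \<open>\<nat>\<close> again.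
\<close>

lemma exists_branching_system:
  assumes E: "fin_digraph E" and no_sinks: "\<And>v. \<not> is_sink E v"
  obtains N :: "'v \<Rightarrow> nat set" and \<sigma> :: "'e \<Rightarrow> nat \<Rightarrow> nat"
  where "\<And>v. v \<in> verts E \<Longrightarrow> N v \<noteq> {}"
    and "\<And>v w. v \<in> verts E \<Longrightarrow> w \<in> verts E \<Longrightarrow> v \<noteq> w \<Longrightarrow> N v \<inter> N w = {}"
    and "\<And>e. e \<in> arcs E \<Longrightarrow> inj_on (\<sigma> e) (N (head E e))"
    and "\<And>e f. e \<in> arcs E \<Longrightarrow> f \<in> arcs E \<Longrightarrow> e \<noteq> f \<Longrightarrow>
      \<sigma> e ` N (head E e) \<inter> \<sigma> f ` N (head E f) = {}"
    and "\<And>v. v \<in> verts E \<Longrightarrow> N v = (\<Union>e\<in>out_arcs E v. \<sigma> e ` N (head E e))"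
proof -
  interpret fin_digraph E by fact
  define b where "b = to_nat_on (verts E \<times> (UNIV :: nat set))"
  define \<beta> where "\<beta> v = to_nat_on (out_arcs E v \<times> (UNIV :: nat set))" for v
  define N where "N v = range (\<lambda>k. b (v, k))" for v
  define \<sigma> where "\<sigma> e n = b (tail E e, \<beta> (tail E e) (e, snd (inv_into (verts E \<times> UNIV) b n)))" for e n
  have inj_b: "inj_on b (verts E \<times> UNIV)"
    unfolding b_def by (intro inj_on_to_nat_on countable_SIGMA) (auto intro: countable_finite)
  have bij_\<beta>: "bij_betw (\<beta> v) (out_arcs E v \<times> UNIV) UNIV" if "v \<in> verts E" for v
    unfolding \<beta>_def
  proof (rule to_nat_on_infinite)
    have "finite (out_arcs E v)"
      by (simp add: out_arcs_def)
    then show "countable (out_arcs E v \<times> (UNIV :: nat set))"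
      by (intro countable_SIGMA) (auto intro: countable_finite)
    have "out_arcs E v \<noteq> {}"
      using no_sinks[of v] that by (simp add: is_sink_def)
    then show "infinite (out_arcs E v \<times> (UNIV :: nat set))"
      by (auto simp: finite_cartesian_product_iff)
  qed
  have b_eq: "b (v, k) = b (w, l) \<longleftrightarrow> v = w \<and> k = l" if "v \<in> verts E" "w \<in> verts E" for v w k l
    using inj_on_eq_iff[OF inj_b] that by simp
  have \<beta>_eq: "\<beta> v (e, k) = \<beta> v (f, l) \<longleftrightarrow> e = f \<and> k = l"
    if "v \<in> verts E" "e \<in> out_arcs E v" "f \<in> out_arcs E v" for v e f k l
    using inj_on_eq_iff[OF bij_betw_imp_inj_on[OF bij_\<beta>[OF that(1)]]] that(2,3) by simp
  have \<sigma>: "\<sigma> e (b (head E e, k)) = b (tail E e, \<beta> (tail E e) (e, k))" if "e \<in> arcs E" for e k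
    using that by (simp add: \<sigma>_def inv_into_f_f[OF inj_b])
  have image: "\<sigma> e ` N (head E e) = range (\<lambda>k. b (tail E e, \<beta> (tail E e) (e, k)))"
    if "e \<in> arcs E" for e
    using \<sigma>[OF that] by (simp add: N_def image_image)
  show thesis
  proof
    show "N v \<noteq> {}" for v
      by (simp add: N_def)
    show "N v \<inter> N w = {}" if "v \<in> verts E" "w \<in> verts E" "v \<noteq> w" for v w
      using that b_eq by (auto simp: N_def)
    show "inj_on (\<sigma> e) (N (head E e))" if "e \<in> arcs E" for e
      using that by (auto intro!: inj_onI simp: N_def \<sigma> b_eq \<beta>_eq)
    show "\<sigma> e ` N (head E e) \<inter> \<sigma> f ` N (head E f) = {}"
      if e: "e \<in> arcs E" and f: "f \<in> arcs E" and ne: "e \<noteq> f" for e f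
    proof -
      have "b (tail E e, \<beta> (tail E e) (e, k)) \<noteq> b (tail E f, \<beta> (tail E f) (f, l))" for k l
      proof (cases "tail E e = tail E f")
        case True
        then show ?thesis
          using e f ne b_eq[of "tail E f" "tail E f"] \<beta>_eq[of "tail E f" e f] by simp
      next
        case False
        then show ?thesis
          using e f by (simp add: b_eq)
      qed
      then show ?thesis
        by (auto simp: image[OF e] image[OF f])
    qed
    show "N v = (\<Union>e\<in>out_arcs E v. \<sigma> e ` N (head E e))" if "v \<in> verts E" for v
    proof -
      have "(\<Union>e\<in>out_arcs E v. \<sigma> e ` N (head E e)) =
          (\<Union>e\<in>out_arcs E v. (\<lambda>k. b (v, \<beta> v (e, k))) ` UNIV)"
        by (rule SUP_cong) (auto simp: image)
      also have "\<dots> = (\<lambda>n. b (v, n)) ` \<beta> v ` (out_arcs E v \<times> UNIV)"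
        by (auto simp: image_iff)
      also have "\<dots> = N v"
        using bij_\<beta>[OF that] by (simp add: bij_betw_def N_def)
      finally show ?thesis ..
    qed
  qed
qed

text \<open>
  The edges act as the partial shifts along a branching system. This family serves to show that the
  vertex projections of the universal algebra do not vanish.
\<close>

lemma exists_faithful_ck_family:
  assumes E: "fin_digraph E" and no_sinks: "\<And>v. \<not> is_sink E v"
  obtains Q :: "'v \<Rightarrow> nat ell2_op" and R :: "'e \<Rightarrow> nat ell2_op"
  where "ck_family E cstar_of Q R" "\<And>v. v \<in> verts E \<Longrightarrow> Q v \<noteq> 0"
proof (rule exists_branching_system[OF E no_sinks])
  interpret fin_digraph E by fact
  fix N :: "'v \<Rightarrow> nat set" and \<sigma> :: "'e \<Rightarrow> nat \<Rightarrow> nat"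
  assume ne: "\<And>v. v \<in> verts E \<Longrightarrow> N v \<noteq> {}"
    and disj: "\<And>v w. v \<in> verts E \<Longrightarrow> w \<in> verts E \<Longrightarrow> v \<noteq> w \<Longrightarrow> N v \<inter> N w = {}"
    and inj: "\<And>e. e \<in> arcs E \<Longrightarrow> inj_on (\<sigma> e) (N (head E e))"
    and disj\<sigma>: "\<And>e f. e \<in> arcs E \<Longrightarrow> f \<in> arcs E \<Longrightarrow> e \<noteq> f \<Longrightarrow>
      \<sigma> e ` N (head E e) \<inter> \<sigma> f ` N (head E f) = {}"
    and cover: "\<And>v. v \<in> verts E \<Longrightarrow> N v = (\<Union>e\<in>out_arcs E v. \<sigma> e ` N (head E e))"
  define Q where "Q v = partial_shift (N v) id" for v
  define R where "R e = partial_shift (N (head E e)) (\<sigma> e)" for e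
  have Q: "coord (op_fun (Q v) x) i = (if i \<in> N v then coord x i else 0)"
    "coord (op_fun (star (Q v)) x) i = (if i \<in> N v then coord x i else 0)" for v x i
    using inv_into_f_f[of id "N v" i]
    by (simp_all only: Q_def coord_partial_shift[OF inj_on_id] image_id id_apply) auto
  have R: "coord (op_fun (R e) x) i =
      (if i \<in> \<sigma> e ` N (head E e) then coord x (inv_into (N (head E e)) (\<sigma> e) i) else 0)"
    "coord (op_fun (star (R e)) x) i = (if i \<in> N (head E e) then coord x (\<sigma> e i) else 0)"
    if "e \<in> arcs E" for e x i
    by (simp_all only: R_def coord_partial_shift[OF inj[OF that]])
  have sum: "op_fun (\<Sum>i\<in>I. f i) x = (\<Sum>i\<in>I. op_fun (f i) x)" for f :: "'e \<Rightarrow> nat ell2_op" and I x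
    by (induction I rule: infinite_finite_induct) (simp_all add: op_fun_simps blinfun.add_left)
  have coord_sum: "coord (\<Sum>i\<in>I. g i) k = (\<Sum>i\<in>I. coord (g i) k)" for g :: "'e \<Rightarrow> nat ell2" and I k
    by (induction I rule: infinite_finite_induct) simp_all
  have "ck_family E cstar_of Q R"
  proof (rule ck_familyI[OF E])
    show "Q v * Q v = Q v \<and> star (Q v) = Q v" for v
      by (intro conjI ell2_op_eqI) (simp_all add: op_fun_simps Q)
    show "Q v * Q w = 0" if "v \<in> verts E" "w \<in> verts E" "v \<noteq> w" for v w
      using disj[OF that] by (intro ell2_op_eqI) (auto simp: op_fun_simps Q)
    show "star (R e) * R e = Q (head E e)" if "e \<in> arcs E" for e
      using that by (intro ell2_op_eqI) (simp add: op_fun_simps Q R inv_into_f_f[OF inj])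
    show "star (R e) * R f = 0" if "e \<in> arcs E" "f \<in> arcs E" "e \<noteq> f" for e f
      using disj\<sigma>[OF that] that by (intro ell2_op_eqI) (auto simp: op_fun_simps R)
    show "Q v = (\<Sum>e\<in>out_arcs E v. R e * star (R e))" if v: "v \<in> verts E" for v
    proof (rule ell2_op_eqI)
      fix x i
      have fin: "finite (out_arcs E v)"
        by (simp add: out_arcs_def)
      have "coord (op_fun (R e * star (R e)) x) i = (if i \<in> \<sigma> e ` N (head E e) then coord x i else 0)"
        if "e \<in> out_arcs E v" for e
        using that by (auto simp: op_fun_simps R inv_into_into f_inv_into_f inv_into_f_f[OF inj])
      then have *: "coord (op_fun (\<Sum>e\<in>out_arcs E v. R e * star (R e)) x) i =
          (\<Sum>e\<in>out_arcs E v. if i \<in> \<sigma> e ` N (head E e) then coord x i else 0)"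
        by (simp add: sum coord_sum)
      show "coord (op_fun (Q v) x) i = coord (op_fun (\<Sum>e\<in>out_arcs E v. R e * star (R e)) x) i"
      proof (cases "i \<in> N v")
        case True
        then obtain e where e: "e \<in> out_arcs E v" "i \<in> \<sigma> e ` N (head E e)"
          using cover[OF v] by auto
        then have "(i \<in> \<sigma> f ` N (head E f)) \<longleftrightarrow> f = e" if "f \<in> out_arcs E v" for f
          using disj\<sigma>[of e f] that by auto
        then have "(\<Sum>f\<in>out_arcs E v. if i \<in> \<sigma> f ` N (head E f) then coord x i else 0) =
            (\<Sum>f\<in>out_arcs E v. if f = e then coord x i else 0)"
          by (intro sum.cong) auto
        then show ?thesis
          using True e fin by (simp add: * Q sum.delta)
      next
        case False
        then show ?thesis
          using cover[OF v] by (simp add: * Q)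
      qed
    qed
  qed
  moreover have "Q v \<noteq> 0" if v: "v \<in> verts E" for v
  proof
    assume "Q v = 0"
    from ne[OF v] obtain i where "i \<in> N v"
      by auto
    then have "coord (op_fun (Q v) (single i 1)) i = 1"
      by (simp add: Q single.rep_eq)
    then show False
      by (simp add: \<open>Q v = 0\<close> op_fun_simps)
  qed
  ultimately show thesis
    by (rule that)
qed

section \<open>Graph C*-algebras and their gauge action\<close>

lemma ck_familyD:
  fixes R :: "'e \<Rightarrow> 'a::cstar_algebra"
  assumes "ck_family E cstar_of Q R"
  shows "v \<in> verts E \<Longrightarrow> Q v * Q v = Q v \<and> star (Q v) = Q v"
    and "v \<in> verts E \<Longrightarrow> w \<in> verts E \<Longrightarrow> v \<noteq> w \<Longrightarrow> Q v * Q w = 0"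
    and "e \<in> arcs E \<Longrightarrow> star (R e) * R e = Q (head E e)"
    and "e \<in> arcs E \<Longrightarrow> f \<in> arcs E \<Longrightarrow> e \<noteq> f \<Longrightarrow> star (R e) * R f = 0"
    and "v \<in> verts E \<Longrightarrow> finite (out_arcs E v) \<Longrightarrow> out_arcs E v \<noteq> {} \<Longrightarrow>
      Q v = (\<Sum>e\<in>out_arcs E v. R e * star (R e))"
proof -
  note 1 = assms[unfolded ck_family_def is_projection_def cstar_of_simps]
  note 2 = 1[THEN conjunct2] note 3 = 2[THEN conjunct2] note 4 = 3[THEN conjunct2]
  note 5 = 4[THEN conjunct2] note 6 = 5[THEN conjunct2]
  show "v \<in> verts E \<Longrightarrow> Q v * Q v = Q v \<and> star (Q v) = Q v"
    using 1[THEN conjunct1] by blast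
  show "v \<in> verts E \<Longrightarrow> w \<in> verts E \<Longrightarrow> v \<noteq> w \<Longrightarrow> Q v * Q w = 0"
    using 2[THEN conjunct1] by blast
  show "e \<in> arcs E \<Longrightarrow> star (R e) * R e = Q (head E e)"
    using 4[THEN conjunct1] by blast
  show "e \<in> arcs E \<Longrightarrow> f \<in> arcs E \<Longrightarrow> e \<noteq> f \<Longrightarrow> star (R e) * R f = 0"
    using 5[THEN conjunct1] by blast
  show "Q v = (\<Sum>e\<in>out_arcs E v. R e * star (R e))"
    if "v \<in> verts E" "finite (out_arcs E v)" "out_arcs E v \<noteq> {}"
    using 6[THEN conjunct2] that finsum_cstar_of[OF that(2)] by metis
qed

locale graph_algebra = fin_digraph E for E :: "('v, 'e) pre_digraph" +
  fixes P :: "'v \<Rightarrow> 'a::cstar_algebra" and S :: "'e \<Rightarrow> 'a"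
  assumes no_sinks: "\<And>v. \<not> is_sink E v" and no_sources: "\<And>v. \<not> is_source E v"
    and graph: "is_graph_cstar E P S"
begin

subsection \<open>The Cuntz-Krieger relations\<close>

lemma ck: "ck_family E cstar_of P S"
  using graph by (simp add: is_graph_cstar_def)

lemma generate:
  assumes "closed_star_subalgebra D" "\<And>v. v \<in> verts E \<Longrightarrow> P v \<in> D" "\<And>e. e \<in> arcs E \<Longrightarrow> S e \<in> D"
  shows "x \<in> D"
proof -
  have "\<forall>D. closed_star_subalgebra D \<and> P ` verts E \<subseteq> D \<and> S ` arcs E \<subseteq> D \<longrightarrow> D = UNIV"
    using graph by (simp add: is_graph_cstar_def)
  with assms have "D = UNIV"
    by (meson image_subsetI)
  then show ?thesis
    by simp
qed

lemma finite_out_arcs: "finite (out_arcs E v)"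
  by (simp add: out_arcs_def)

lemma P_simps:
  assumes "v \<in> verts E"
  shows "P v * P v = P v" "star (P v) = P v"
  using ck_familyD(1)[OF ck assms] by simp_all

lemma P_orth:
  assumes "v \<in> verts E" "w \<in> verts E"
  shows "P v * P w = (if v = w then P v else 0)"
  using ck_familyD(2)[OF ck assms] P_simps(1)[OF assms(1)] by auto

lemma star_S_S:
  assumes "e \<in> arcs E" "f \<in> arcs E"
  shows "star (S e) * S f = (if e = f then P (head E e) else 0)"
  using ck_familyD(4)[OF ck assms] ck_familyD(3)[OF ck assms(1)] by auto

lemma P_sum:
  assumes "v \<in> verts E"
  shows "P v = (\<Sum>e\<in>out_arcs E v. S e * star (S e))"
  using ck_familyD(5)[OF ck assms finite_out_arcs] no_sinks[of v] assms by (simp add: is_sink_def)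

lemma S_P: "e \<in> arcs E \<Longrightarrow> S e * P (head E e) = S e"
  by (rule partial_isometryI) (simp_all add: star_S_S P_simps)

lemma S_P_eq: "v \<in> verts E \<Longrightarrow> e \<in> arcs E \<Longrightarrow> S e * P v = (if head E e = v then S e else 0)"
proof -
  assume v: "v \<in> verts E" and e: "e \<in> arcs E"
  have "S e * P v = S e * (P (head E e) * P v)"
    by (simp only: S_P[OF e] flip: mult.assoc)
  also have "P (head E e) * P v = (if head E e = v then P (head E e) else 0)"
    using v e by (intro P_orth) auto
  finally show ?thesis
    using S_P[OF e] by (cases "head E e = v") simp_all
qed

lemma P_S:
  assumes v: "v \<in> verts E" and e: "e \<in> arcs E"
  shows "P v * S e = (if tail E e = v then S e else 0)"
proof -
  have "P v * S e = (\<Sum>f\<in>out_arcs E v. S f * (star (S f) * S e))"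
    by (simp add: P_sum[OF v] sum_distrib_right mult.assoc)
  also have "\<dots> = (\<Sum>f\<in>out_arcs E v. if f = e then S e else 0)"
    using e by (intro sum.cong) (auto simp: star_S_S S_P)
  finally show ?thesis
    using e finite_out_arcs[of v] by (simp add: sum.delta)
qed

lemma exists_in_arc: "v \<in> verts E \<Longrightarrow> \<exists>e\<in>arcs E. head E e = v"
  using no_sources[of v] by (auto simp: is_source_def)

definition unit :: 'a where
  "unit = (\<Sum>v\<in>verts E. P v)"

sublocale cstar_unit unit
proof -
  let ?D = "{x. unit * x = x \<and> x * unit = x}"
  have star: "star unit = unit"
    by (simp add: unit_def star_sum P_simps)
  have "star x \<in> ?D" if "x \<in> ?D" for x
    using that star_mult[of unit x] star_mult[of x unit] by (simp add: star)
  moreover have "closed ?D"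
    by (intro closed_Collect_conj closed_Collect_eq continuous_intros)
  moreover have "x * y \<in> ?D" if "x \<in> ?D" "y \<in> ?D" for x y
  proof -
    have "unit * (x * y) = unit * x * y" "x * y * unit = x * (y * unit)"
      by (simp_all only: mult.assoc)
    with that show ?thesis
      by simp
  qed
  ultimately have "closed_star_subalgebra ?D"
    by (simp add: closed_star_subalgebra_def distrib_left distrib_right mult_scaleC_left
        mult_scaleC_right)
  then have "x \<in> ?D" for x
  proof (rule generate)
    fix v assume "v \<in> verts E"
    then show "P v \<in> ?D"
      by (simp add: unit_def sum_distrib_left sum_distrib_right P_orth sum.delta sum.delta')
  next
    fix e assume "e \<in> arcs E"
    then show "S e \<in> ?D"
      by (simp add: unit_def sum_distrib_left sum_distrib_right P_S S_P_eq sum.delta sum.delta')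
  qed
  then show "cstar_unit unit"
    by unfold_locales auto
qed

subsection \<open>Words in the generators\<close>

primrec word :: "'e list \<Rightarrow> 'a" where
  "word [] = unit"
| "word (e # \<mu>) = S e * word \<mu>"

lemma word_append: "word (\<mu> @ \<nu>) = word \<mu> * word \<nu>"
  by (induction \<mu>) (simp_all add: mult.assoc)

text \<open>
  With \<open>P v\<close> in the middle, products of monomials are monomials or 0, also in the case of empty words.
\<close>

definition monomial :: "'e list \<Rightarrow> 'v \<Rightarrow> 'e list \<Rightarrow> 'a" where
  "monomial \<mu> v \<nu> = word \<mu> * P v * star (word \<nu>)"

definition monomials :: "'a set" where
  "monomials = {monomial \<mu> v \<nu> |\<mu> v \<nu>. set \<mu> \<subseteq> arcs E \<and> v \<in> verts E \<and> set \<nu> \<subseteq> arcs E}"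

lemma monomialsI:
  "set \<mu> \<subseteq> arcs E \<Longrightarrow> v \<in> verts E \<Longrightarrow> set \<nu> \<subseteq> arcs E \<Longrightarrow> monomial \<mu> v \<nu> \<in> monomials"
  unfolding monomials_def by blast

lemma P_word_P:
  assumes "v \<in> verts E" "w \<in> verts E" "set \<mu> \<subseteq> arcs E"
  shows "P v * (word \<mu> * P w) = 0 \<or> P v * (word \<mu> * P w) = word \<mu> * P w"
  using assms by (cases \<mu>) (auto simp: P_orth P_S simp flip: mult.assoc)

lemma star_S_monomial:
  assumes e: "e \<in> arcs E" and \<mu>: "set \<mu> \<subseteq> arcs E" and v: "v \<in> verts E" and \<nu>: "set \<nu> \<subseteq> arcs E"
  shows "star (S e) * monomial \<mu> v \<nu> \<in> cspan monomials"
proof (cases \<mu>)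
  case Nil
  have "star (S e) * P v = (if tail E e = v then star (S e) else 0)"
    using arg_cong[OF P_S[OF v e], of star] v by (simp add: star_mult P_simps)
  then have "star (S e) * monomial \<mu> v \<nu> = (if tail E e = v then star (word \<nu> * S e) else 0)"
    by (simp add: Nil monomial_def star_mult flip: mult.assoc)
  also have "star (word \<nu> * S e) = monomial [] (head E e) (\<nu> @ [e])"
    using e arg_cong[OF S_P[OF e], of star]
    by (simp add: monomial_def word_append star_mult P_simps flip: mult.assoc)
  finally show ?thesis
    using monomialsI[of "[]" "head E e" "\<nu> @ [e]"] e \<nu> by (simp add: cvec.span_base cvec.span_zero)
next
  case (Cons f \<mu>')
  then have \<mu>': "f \<in> arcs E" "set \<mu>' \<subseteq> arcs E"
    using \<mu> by auto
  have "star (S e) * monomial \<mu> v \<nu> = star (S e) * S f * (word \<mu>' * P v) * star (word \<nu>)"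
    by (simp add: Cons monomial_def mult.assoc)
  also have "\<dots> \<in> insert 0 {monomial \<mu>' v \<nu>}"
    using P_word_P[of "head E e" v \<mu>'] e \<mu>' v by (auto simp: star_S_S monomial_def)
  also have "\<dots> \<subseteq> cspan monomials"
    using monomialsI[OF \<mu>'(2) v \<nu>] by (simp add: cvec.span_base cvec.span_zero)
  finally show ?thesis .
qed

lemma S_monomial: "S e * monomial \<mu> v \<nu> = monomial (e # \<mu>) v \<nu>"
  by (simp add: monomial_def mult.assoc)

end

lemma csubspace_closure:
  fixes V :: "'a::cstar_algebra set"
  assumes V: "cvec.subspace V"
  shows "cvec.subspace (closure V)"
proof (rule cvec.subspaceI)
  show "0 \<in> closure V"
    using cvec.subspace_0[OF V] closure_subset by blast
  show "x + y \<in> closure V" if x: "x \<in> closure V" and y: "y \<in> closure V" for x y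
  proof -
    from x y obtain f g where "\<And>n. f n \<in> V" "f \<longlonglongrightarrow> x" "\<And>n. g n \<in> V" "g \<longlonglongrightarrow> y"
      by (metis closure_sequential)
    then show ?thesis
      unfolding closure_sequential
      by (intro exI[of _ "\<lambda>n. f n + g n"]) (auto intro: tendsto_add cvec.subspace_add[OF V])
  qed
  show "c *\<^sub>C x \<in> closure V" if "x \<in> closure V" for c x
  proof -
    from that obtain f where "\<And>n. f n \<in> V" "f \<longlonglongrightarrow> x"
      by (metis closure_sequential)
    then show ?thesis
      unfolding closure_sequential
      by (intro exI[of _ "\<lambda>n. c *\<^sub>C f n"])
        (auto intro: bounded_linear.tendsto[OF bounded_linear_scaleC] cvec.subspace_scale[OF V])
  qed
qed

lemma mult_closure_cspan:
  fixes G :: "'a::cstar_algebra set"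
  assumes "\<And>g. g \<in> G \<Longrightarrow> a * g \<in> cspan G" and x: "x \<in> closure (cspan G)"
  shows "a * x \<in> closure (cspan G)"
proof -
  have "cvec.subspace {x. a * x \<in> cspan G}"
    by (rule cvec.subspaceI)
      (simp_all add: distrib_left mult_scaleC_right cvec.span_zero cvec.span_add cvec.span_scale)
  then have "cspan G \<subseteq> {x. a * x \<in> cspan G}"
    using assms by (intro cvec.span_minimal) auto
  then have "cspan G \<subseteq> {x. a * x \<in> closure (cspan G)}"
    using closure_subset by blast
  moreover have "closed ((\<lambda>x. a * x) -` closure (cspan G))"
    by (intro closed_vimage continuous_intros) simp
  ultimately have "closure (cspan G) \<subseteq> {x. a * x \<in> closure (cspan G)}"
    by (intro closure_minimal) (auto simp: vimage_def)
  with x show ?thesis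
    by auto
qed

context graph_algebra
begin

text \<open>
  The closed span of the monomials is a left ideal, because it is invariant under the generators
  and their adjoints, and it contains the unit.
\<close>

lemma closure_cspan_monomials: "closure (cspan monomials) = UNIV"
proof -
  let ?N = "closure (cspan monomials)"
  let ?W = "{a. \<forall>x\<in>?N. a * x \<in> ?N \<and> star a * x \<in> ?N}"
  have N: "cvec.subspace ?N"
    by (rule csubspace_closure) (rule cvec.subspace_span)
  have "?W = (\<Inter>x\<in>?N. ((\<lambda>a. a * x) -` ?N) \<inter> ((\<lambda>a. star a * x) -` ?N))"
    by auto
  also have "closed \<dots>"
    by (intro closed_INT ballI closed_Int closed_vimage continuous_intros) simp_all
  finally have W: "closed_star_subalgebra ?W"
    unfolding closed_star_subalgebra_def
    by (simp add: distrib_right star_add star_mult star_scaleC star_star mult.assoc mult_scaleC_left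
        cvec.subspace_add[OF N] cvec.subspace_scale[OF N] cvec.subspace_0[OF N])
  have S: "S e \<in> ?W" if "e \<in> arcs E" for e
  proof -
    have "S e * g \<in> cspan monomials" "star (S e) * g \<in> cspan monomials" if "g \<in> monomials" for g
    proof -
      from that obtain \<mu> v \<nu> where g: "g = monomial \<mu> v \<nu>"
        "set \<mu> \<subseteq> arcs E" "v \<in> verts E" "set \<nu> \<subseteq> arcs E"
        by (auto simp: monomials_def)
      then show "star (S e) * g \<in> cspan monomials"
        using \<open>e \<in> arcs E\<close> by (simp add: star_S_monomial)
      show "S e * g \<in> cspan monomials"
        using \<open>e \<in> arcs E\<close> g by (simp add: S_monomial cvec.span_base monomialsI)
    qed
    then show ?thesis
      by (auto intro: mult_closure_cspan)
  qed
  have "P v \<in> ?W" if "v \<in> verts E" for v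
  proof -
    from exists_in_arc[OF that] obtain e where "e \<in> arcs E" "P v = star (S e) * S e"
      by (auto simp: star_S_S)
    then show ?thesis
      using closed_star_subalgebraD(4)[OF W closed_star_subalgebraD(6)[OF W S] S] by (simp only:)
  qed
  then have "a \<in> ?W" for a
    by (rule generate[OF W _ S])
  moreover have "unit \<in> ?N"
  proof -
    have "P v = monomial [] v []" for v
      by (simp add: monomial_def)
    then have "unit \<in> cspan monomials"
      unfolding unit_def by (intro cvec.span_sum cvec.span_base) (simp add: monomialsI)
    then show ?thesis
      using closure_subset by blast
  qed
  ultimately have "a * unit \<in> ?N" for a
    by blast
  then show ?thesis
    by auto
qed

text \<open>
  The graph is finite, so there are only countably many monomials.
\<close>

lemma inj_matrices: "\<exists>j :: 'a \<Rightarrow> nat \<Rightarrow> nat \<Rightarrow> complex. inj j"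
proof -
  let ?I = "lists (arcs E) \<times> verts E \<times> lists (arcs E)"
  have "monomials \<subseteq> (\<lambda>(\<mu>, v, \<nu>). monomial \<mu> v \<nu>) ` ?I"
  proof
    fix x assume "x \<in> monomials"
    then obtain \<mu> v \<nu> where "x = monomial \<mu> v \<nu>" "(\<mu>, v, \<nu>) \<in> ?I"
      unfolding monomials_def lists_eq_set by blast
    then show "x \<in> (\<lambda>(\<mu>, v, \<nu>). monomial \<mu> v \<nu>) ` ?I"
      by (intro image_eqI[of _ _ "(\<mu>, v, \<nu>)"]) simp_all
  qed
  moreover have "countable ?I"
    by (intro countable_SIGMA countable_lists countable_finite) simp_all
  ultimately have "countable (insert 0 monomials)"
    by (meson countable_image countable_insert countable_subset)
  then have "range (from_nat_into (insert 0 monomials)) = insert 0 monomials"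
    by (simp add: range_from_nat_into)
  then show ?thesis
    by (intro inj_into_matrices[of "from_nat_into (insert 0 monomials)"])
      (simp add: closure_cspan_monomials)
qed

lemma star_hom_eqI:
  fixes \<phi> \<psi> :: "'a \<Rightarrow> 'b::cstar_algebra"
  assumes "star_hom cstar_of cstar_of \<phi>" "star_hom cstar_of cstar_of \<psi>"
    and "\<And>e. e \<in> arcs E \<Longrightarrow> \<phi> (S e) = \<psi> (S e)"
  shows "\<phi> = \<psi>"
proof
  fix x
  have "x \<in> {x. \<phi> x = \<psi> x}"
  proof (rule generate[OF closed_star_subalgebra_equalizer[OF assms(1,2)]])
    show "S e \<in> {x. \<phi> x = \<psi> x}" if "e \<in> arcs E" for e
      using assms(3)[OF that] by simp
    show "P v \<in> {x. \<phi> x = \<psi> x}" if "v \<in> verts E" for v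
    proof -
      from exists_in_arc[OF that] obtain e where e: "e \<in> arcs E" "P v = star (S e) * S e"
        by (auto simp: star_S_S)
      then show ?thesis
        using assms(3)[OF e(1)] by (simp add: star_hom_simps[OF assms(1)] star_hom_simps[OF assms(2)])
    qed
  qed
  then show "\<phi> x = \<psi> x"
    by simp
qed

subsection \<open>The gauge automorphisms\<close>

lemma exists_gauge_hom:
  assumes z: "cmod z = 1"
  shows "\<exists>\<phi>. star_hom cstar_of cstar_of \<phi> \<and> (\<forall>v\<in>verts E. \<phi> (P v) = P v) \<and>
    (\<forall>e\<in>arcs E. \<phi> (S e) = z *\<^sub>C S e)"
proof -
  obtain j :: "'a \<Rightarrow> nat \<Rightarrow> nat \<Rightarrow> complex" where j: "inj j"
    using inj_matrices by blast
  have zz: "cnj z * z = 1" "z * cnj z = 1"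
    using z by (simp_all add: mult.commute complex_norm_square[symmetric])
  have ck: "ck_family E cstar_of P (\<lambda>e. z *\<^sub>C S e)"
  proof (rule ck_familyI[OF fin_digraph])
    show "P v = (\<Sum>e\<in>out_arcs E v. (z *\<^sub>C S e) * star (z *\<^sub>C S e))" if "v \<in> verts E" for v
      unfolding P_sum[OF that]
      by (simp add: star_scaleC mult_scaleC_left mult_scaleC_right zz)
  qed (simp_all add: P_simps P_orth star_scaleC mult_scaleC_left mult_scaleC_right star_S_S zz)
  show ?thesis
    by (rule is_graph_cstar_universal[OF fin_digraph graph ck j]) blast
qed

text \<open>
  The homomorphisms for \<open>z\<close> and for its conjugate are inverse to each other, because their compositions
  fix the generators.
\<close>

lemma exists_unique_gauge:
  assumes z: "cmod z = 1"
  shows "\<exists>!\<gamma>. \<gamma> \<in> cstar_aut \<and> (\<forall>e\<in>arcs E. \<gamma> (S e) = z *\<^sub>C S e) \<and> (\<forall>v\<in>verts E. \<gamma> (P v) = P v)"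
proof -
  have id: "star_hom cstar_of cstar_of (\<lambda>x :: 'a. x)"
    by (simp add: star_hom_cstar_of_iff)
  obtain \<phi> where \<phi>: "star_hom cstar_of cstar_of \<phi>" "\<And>v. v \<in> verts E \<Longrightarrow> \<phi> (P v) = P v"
    "\<And>e. e \<in> arcs E \<Longrightarrow> \<phi> (S e) = z *\<^sub>C S e"
    using exists_gauge_hom[OF z] by blast
  have "cmod (cnj z) = 1"
    using z by simp
  then obtain \<psi> where \<psi>: "star_hom cstar_of cstar_of \<psi>"
    "\<And>e. e \<in> arcs E \<Longrightarrow> \<psi> (S e) = cnj z *\<^sub>C S e"
    using exists_gauge_hom by blast
  have zz: "cnj z * z = 1" "z * cnj z = 1"
    using z by (simp_all add: mult.commute complex_norm_square[symmetric])
  have "\<psi> \<circ> \<phi> = (\<lambda>x. x)"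
    by (rule star_hom_eqI[OF star_hom_comp[OF \<phi>(1) \<psi>(1)] id])
      (simp add: \<phi>(3) \<psi>(2) star_hom_simps(3)[OF \<psi>(1)] scaleC_scaleC zz)
  moreover have "\<phi> \<circ> \<psi> = (\<lambda>x. x)"
    by (rule star_hom_eqI[OF star_hom_comp[OF \<psi>(1) \<phi>(1)] id])
      (simp add: \<phi>(3) \<psi>(2) star_hom_simps(3)[OF \<phi>(1)] scaleC_scaleC zz)
  ultimately have "bij \<phi>"
    by (intro o_bij[of \<psi>]) (simp_all add: id_def)
  with \<phi> have "\<phi> \<in> cstar_aut"
    by (simp add: cstar_aut_def)
  show ?thesis
  proof (intro ex1I)
    show "\<phi> \<in> cstar_aut \<and> (\<forall>e\<in>arcs E. \<phi> (S e) = z *\<^sub>C S e) \<and> (\<forall>v\<in>verts E. \<phi> (P v) = P v)"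
      using \<open>\<phi> \<in> cstar_aut\<close> \<phi> by blast
    show "\<gamma> = \<phi>"
      if "\<gamma> \<in> cstar_aut \<and> (\<forall>e\<in>arcs E. \<gamma> (S e) = z *\<^sub>C S e) \<and> (\<forall>v\<in>verts E. \<gamma> (P v) = P v)" for \<gamma>
    proof (rule star_hom_eqI)
      show "star_hom cstar_of cstar_of \<gamma>"
        using that by (simp add: cstar_aut_def)
    qed (use that \<phi> in simp_all)
  qed
qed

abbreviation gauge :: "complex \<Rightarrow> 'a \<Rightarrow> 'a" where
  "gauge \<equiv> gauge_action E P S"

lemma gauge:
  assumes "cmod z = 1"
  shows "star_hom cstar_of cstar_of (gauge z)" "\<And>e. e \<in> arcs E \<Longrightarrow> gauge z (S e) = z *\<^sub>C S e"
    "\<And>v. v \<in> verts E \<Longrightarrow> gauge z (P v) = P v"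
  using theI'[OF exists_unique_gauge[OF assms]] by (auto simp: gauge_action_def cstar_aut_def)

lemmas gauge_simps = star_hom_simps[OF gauge(1)]

lemma norm_gauge: "cmod z = 1 \<Longrightarrow> norm (gauge z x) \<le> norm x"
  by (rule star_hom_contractive) (rule gauge)

subsection \<open>Homogeneous elements\<close>

definition homogeneous :: "int \<Rightarrow> 'a \<Rightarrow> bool" where
  "homogeneous n x \<longleftrightarrow> (\<forall>z. cmod z = 1 \<longrightarrow> gauge z x = (z powi n) *\<^sub>C x)"

abbreviation core :: "'a set" where
  "core \<equiv> core_subalgebra E P S"

lemma core_iff: "x \<in> core \<longleftrightarrow> homogeneous 0 x"
  by (simp add: core_subalgebra_def homogeneous_def)

lemma homogeneous_mult: "homogeneous m x \<Longrightarrow> homogeneous n y \<Longrightarrow> homogeneous (m + n) (x * y)"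
  unfolding homogeneous_def
proof (intro allI impI)
  fix z :: complex
  assume x: "\<forall>z. cmod z = 1 \<longrightarrow> gauge z x = (z powi m) *\<^sub>C x"
    and y: "\<forall>z. cmod z = 1 \<longrightarrow> gauge z y = (z powi n) *\<^sub>C y" and z: "cmod z = 1"
  have "z \<noteq> 0"
    using z by auto
  then have "z powi (m + n) = z powi m * z powi n"
    by (simp add: power_int_add)
  then show "gauge z (x * y) = (z powi (m + n)) *\<^sub>C (x * y)"
    using x y z by (simp add: gauge_simps mult_scaleC_left mult_scaleC_right scaleC_scaleC mult.commute)
qed

lemma homogeneous_star:
  assumes "homogeneous n x"
  shows "homogeneous (- n) (star x)"
  unfolding homogeneous_def
proof (intro allI impI)
  fix z :: complex assume z: "cmod z = 1"
  then have "cnj z = inverse z"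
    by (metis complex_norm_square inverse_unique mult_1 norm_one of_real_1 power_one)
  then have "cnj (z powi n) = z powi (- n)"
    by (simp add: power_int_minus power_int_inverse)
  then show "gauge z (star x) = (z powi (- n)) *\<^sub>C star x"
    using assms z by (simp add: homogeneous_def gauge_simps star_scaleC)
qed

lemma homogeneous_add: "homogeneous n x \<Longrightarrow> homogeneous n y \<Longrightarrow> homogeneous n (x + y)"
  by (simp add: homogeneous_def gauge_simps scaleC_add_right)

lemma homogeneous_scaleC: "homogeneous n x \<Longrightarrow> homogeneous n (c *\<^sub>C x)"
  by (simp add: homogeneous_def gauge_simps scaleC_scaleC mult.commute)

lemma homogeneous_0: "homogeneous n 0"
  by (simp add: homogeneous_def gauge_simps)

lemma homogeneous_P: "v \<in> verts E \<Longrightarrow> homogeneous 0 (P v)"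
  by (simp add: homogeneous_def gauge)

lemma homogeneous_S: "e \<in> arcs E \<Longrightarrow> homogeneous 1 (S e)"
  by (simp add: homogeneous_def gauge)

lemma homogeneous_sum: "(\<And>i. i \<in> I \<Longrightarrow> homogeneous n (f i)) \<Longrightarrow> homogeneous n (sum f I)"
  by (induction I rule: infinite_finite_induct) (simp_all add: homogeneous_0 homogeneous_add)

lemma homogeneous_unit: "homogeneous 0 unit"
  unfolding unit_def by (intro homogeneous_sum homogeneous_P)

lemma homogeneous_word: "set \<mu> \<subseteq> arcs E \<Longrightarrow> homogeneous (int (length \<mu>)) (word \<mu>)"
proof (induction \<mu>)
  case (Cons e \<mu>)
  then show ?case
    using homogeneous_mult[OF homogeneous_S[of e] Cons.IH] by auto
qed (simp add: homogeneous_unit)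

lemma homogeneous_monomial:
  assumes "set \<mu> \<subseteq> arcs E" "v \<in> verts E" "set \<nu> \<subseteq> arcs E"
  shows "homogeneous (int (length \<mu>) - int (length \<nu>)) (monomial \<mu> v \<nu>)"
  using homogeneous_mult[OF homogeneous_mult[OF homogeneous_word homogeneous_P]
      homogeneous_star[OF homogeneous_word]] assms
  by (fastforce simp: monomial_def)

text \<open>
  Monomials are homogeneous and span a dense subspace. This rule serves to check properties of
  continuous linear maps on homogeneous elements only.
\<close>

lemma homogeneous_induct [consumes 0, case_names closed add scaleC homogeneous]:
  assumes "closed {x. Q x}" "\<And>x y. Q x \<Longrightarrow> Q y \<Longrightarrow> Q (x + y)" "\<And>c x. Q x \<Longrightarrow> Q (c *\<^sub>C x)"
    and hom: "\<And>n x. homogeneous n x \<Longrightarrow> Q x"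
  shows "Q x"
proof -
  have "cvec.subspace {x. Q x}"
    using assms(2,3) hom[OF homogeneous_0] by (intro cvec.subspaceI) auto
  moreover have "monomials \<subseteq> {x. Q x}"
    using hom[OF homogeneous_monomial] by (auto simp: monomials_def)
  ultimately have "closure (cspan monomials) \<subseteq> {x. Q x}"
    by (intro closure_minimal cvec.span_minimal assms)
  then show ?thesis
    by (auto simp: closure_cspan_monomials)
qed

end

section \<open>Fourier coefficients\<close>

lemma integral_cis:
  fixes k :: int
  shows "((\<lambda>t. cis (of_int k * (2 * pi * t))) has_integral (if k = 0 then 1 else 0)) {0..1}"
proof (cases "k = 0")
  case True
  then show ?thesis
    using has_integral_const_real[of "1 :: complex" 0 1] by simp
next
  case False
  define c where "c = of_int k * (2 * pi)"
  have c: "c \<noteq> 0"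
    using False by (simp add: c_def)
  have "((\<lambda>t. cis (c * t) / (\<i> * c)) has_vector_derivative cis (c * t)) (at t within {0..1})" for t
    using c unfolding has_vector_derivative_def
    by (auto intro!: derivative_eq_intros simp: fun_eq_iff scaleR_conv_of_real field_simps)
  then have "((\<lambda>t. cis (c * t)) has_integral cis (c * 1) / (\<i> * c) - cis (c * 0) / (\<i> * c)) {0..1}"
    by (intro fundamental_theorem_of_calculus) auto
  moreover have "cis (c * 1) = 1"
    using cis_multiple_2pi[of "of_int k"] by (simp add: c_def mult.commute)
  ultimately show ?thesis
    using False by (simp add: c_def mult.assoc)
qed

context graph_algebra
begin

text \<open>
  The circle is parametrized by the unit interval, so that it has length 1 and the integrals below
  need not be normalized.
\<close>

definition orbit :: "'a \<Rightarrow> real \<Rightarrow> 'a" where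
  "orbit x t = gauge (cis (2 * pi * t)) x"

lemma norm_orbit: "norm (orbit x t) \<le> norm x"
  by (simp add: orbit_def norm_gauge)

lemma orbit_add: "orbit (x + y) t = orbit x t + orbit y t"
  and orbit_diff: "orbit (x - y) t = orbit x t - orbit y t"
  and orbit_scaleC: "orbit (c *\<^sub>C x) t = c *\<^sub>C orbit x t"
  by (simp_all add: orbit_def gauge_simps)

lemma orbit_homogeneous: "homogeneous n x \<Longrightarrow> orbit x t = cis (of_int n * (2 * pi * t)) *\<^sub>C x"
  by (simp add: orbit_def homogeneous_def cis_power_int)

text \<open>
  The gauge automorphisms are contractive, so norm limits of elements yield uniform limits of orbits.
\<close>

lemma continuous_on_orbit: "continuous_on UNIV (orbit x)"
proof (induction x rule: homogeneous_induct)
  case closed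
  show ?case
    unfolding closed_sequential_limits
  proof (intro allI impI, elim conjE)
    fix X x assume X: "\<forall>n. X n \<in> {x. continuous_on UNIV (orbit x)}" and lim: "X \<longlonglongrightarrow> x"
    have "uniform_limit UNIV (\<lambda>n. orbit (X n)) (orbit x) sequentially"
    proof (rule uniform_limitI)
      fix e :: real assume "0 < e"
      with lim have "\<forall>\<^sub>F n in sequentially. dist (X n) x < e"
        by (rule tendstoD)
      then show "\<forall>\<^sub>F n in sequentially. \<forall>t\<in>UNIV. dist (orbit (X n) t) (orbit x t) < e"
      proof (rule eventually_mono)
        fix n assume "dist (X n) x < e"
        then show "\<forall>t\<in>UNIV. dist (orbit (X n) t) (orbit x t) < e"
          using norm_orbit[of "X n - x"]
          by (auto simp: dist_norm orbit_diff intro: order_le_less_trans)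
      qed
    qed
    then have "continuous_on UNIV (orbit x)"
      using X by (intro uniform_limit_theorem[where F = sequentially]) auto
    then show "x \<in> {x. continuous_on UNIV (orbit x)}"
      by simp
  qed
next
  case (add x y)
  then show ?case
    by (simp add: orbit_add[abs_def] continuous_on_add)
next
  case (scaleC c x)
  then show ?case
    by (simp add: orbit_scaleC[abs_def] continuous_on_scaleC)
next
  case (homogeneous n x)
  then show ?case
    by (subst ext[OF orbit_homogeneous[OF homogeneous]]) (intro continuous_intros)
qed

definition fourier :: "int \<Rightarrow> 'a \<Rightarrow> 'a" where
  "fourier n x = integral {0..1} (\<lambda>t. cis (- (of_int n * (2 * pi * t))) *\<^sub>C orbit x t)"

lemma continuous_on_kernel_orbit [continuous_intros]:
  "continuous_on A K \<Longrightarrow> continuous_on A (\<lambda>t. K t *\<^sub>C orbit x t)"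
  by (intro continuous_on_scaleC continuous_on_subset[OF continuous_on_orbit]) auto

lemma fourier_integrable:
  "(\<lambda>t. cis (- (of_int n * (2 * pi * t))) *\<^sub>C orbit x t) integrable_on {0..1}"
  by (intro integrable_continuous_interval continuous_intros)

lemma fourier_add: "fourier n (x + y) = fourier n x + fourier n y"
  unfolding fourier_def orbit_add scaleC_add_right by (intro integral_add fourier_integrable)

lemma fourier_scaleC: "fourier n (c *\<^sub>C x) = c *\<^sub>C fourier n x"
  using integral_linear[OF fourier_integrable[of n x] bounded_linear_scaleC[of c]]
  by (simp add: fourier_def orbit_scaleC scaleC_scaleC o_def mult.commute[of c])

lemma norm_fourier: "norm (fourier n x) \<le> norm x"
proof -
  have "norm (fourier n x) \<le> norm x * (1 - 0)"
    unfolding fourier_def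
    by (intro integral_bound continuous_intros) (auto simp: norm_scaleC norm_orbit)
  then show ?thesis
    by simp
qed

lemma bounded_linear_fourier: "bounded_linear (fourier n)"
proof (rule bounded_linear_intro[where K = 1])
  show "fourier n (r *\<^sub>R x) = r *\<^sub>R fourier n x" for r x
    using fourier_scaleC[of n "complex_of_real r" x] by (simp add: scaleC_of_real)
qed (simp_all add: fourier_add norm_fourier)

lemmas continuous_on_fourier [continuous_intros] =
  bounded_linear.continuous_on[OF bounded_linear_fourier]

lemma fourier_homogeneous_element:
  assumes "homogeneous m x"
  shows "fourier n x = (if n = m then x else 0)"
proof -
  let ?c = "\<lambda>t. cis (of_int (m - n) * (2 * pi * t))"
  have "((\<lambda>c. c *\<^sub>C x) \<circ> ?c has_integral (if m - n = 0 then 1 else 0) *\<^sub>C x) {0..1}"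
    by (intro has_integral_linear[OF integral_cis]
        bounded_bilinear.bounded_linear_left[OF bounded_bilinear_scaleC])
  moreover have "cis (- (of_int n * (2 * pi * t))) *\<^sub>C orbit x t = ?c t *\<^sub>C x" for t
    by (simp add: orbit_homogeneous[OF assms] scaleC_scaleC cis_mult algebra_simps)
  ultimately have "fourier n x = (if m - n = 0 then 1 else 0) *\<^sub>C x"
    by (simp only: fourier_def o_def integral_unique)
  then show ?thesis
    by auto
qed

lemma homogeneous_fourier: "homogeneous n (fourier n x)"
proof (induction x rule: homogeneous_induct)
  case closed
  have "{x. homogeneous n (fourier n x)} =
      (\<Inter>z\<in>{z. cmod z = 1}. {x. gauge z (fourier n x) = (z powi n) *\<^sub>C fourier n x})"
    by (auto simp: homogeneous_def)
  also have "closed \<dots>"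
    by (intro closed_INT ballI closed_Collect_eq continuous_intros
        bounded_linear.continuous_on[OF star_hom_bounded_linear[OF gauge(1)]]) auto
  finally show ?case .
qed (simp_all add: fourier_add fourier_scaleC homogeneous_add homogeneous_scaleC homogeneous_0
    fourier_homogeneous_element)

lemma fourier_mult_left:
  assumes a: "homogeneous m a"
  shows "fourier n (a * x) = a * fourier (n - m) x"
proof (induction x rule: homogeneous_induct)
  case closed
  show ?case
    by (intro closed_Collect_eq continuous_intros)
next
  case (homogeneous k x)
  then show ?case
    using homogeneous_mult[OF a homogeneous] by (auto simp: fourier_homogeneous_element)
qed (simp_all add: fourier_add fourier_scaleC distrib_left mult_scaleC_right)

lemma fourier_mult_right:
  assumes a: "homogeneous m a"
  shows "fourier n (x * a) = fourier (n - m) x * a"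
proof (induction x rule: homogeneous_induct)
  case closed
  show ?case
    by (intro closed_Collect_eq continuous_intros)
next
  case (homogeneous k x)
  then show ?case
    using homogeneous_mult[OF homogeneous a] by (auto simp: fourier_homogeneous_element)
qed (simp_all add: fourier_add fourier_scaleC distrib_right mult_scaleC_left)

subsection \<open>Fejer means\<close>

text \<open>
  The double sum is \<open>N\<close> times the Cesaro mean of the symmetric partial sums of the Fourier series:
  a degree \<open>d\<close> with \<open>\<bar>d\<bar> < N\<close> occurs \<open>N - \<bar>d\<bar>\<close> times.
\<close>

definition fejer :: "nat \<Rightarrow> 'a \<Rightarrow> 'a" where
  "fejer N x = (1 / N) *\<^sub>R (\<Sum>j<N. \<Sum>k<N. fourier (int j - int k) x)"

text \<open>
  The Fejer means are convolutions with the kernel \<open>\<bar>D t\<bar>\<^sup>2 / N\<close>, which is nonnegative with integral 1.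
\<close>

lemma norm_fejer: "norm (fejer N x) \<le> norm x"
proof (cases "N = 0")
  case False
  define D where "D t = (\<Sum>j<N. cis (- (real j * (2 * pi * t))))" for t :: real
  define K where "K t = D t * cnj (D t)" for t
  have K_sum: "K t = (\<Sum>j<N. \<Sum>k<N. cis (- (of_int (int j - int k) * (2 * pi * t))))" for t
    by (simp add: K_def D_def sum_product cis_cnj cis_mult algebra_simps) (rule sum.swap)
  have K_real: "K t = complex_of_real ((cmod (D t))\<^sup>2)" for t
    by (simp only: K_def complex_norm_square)
  have "((\<lambda>t. cis (- (of_int (int j - int k) * (2 * pi * t)))) has_integral
      (if int k - int j = 0 then 1 else 0)) {0..1}" for j k
  proof -
    have "- (of_int (int j - int k) * (2 * pi * t)) = of_int (int k - int j) * (2 * pi * t)" for t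
      by (simp add: algebra_simps)
    then show ?thesis
      by (simp only: integral_cis)
  qed
  then have "(K has_integral (\<Sum>j<N. \<Sum>k<N. if int k - int j = 0 then 1 else 0)) {0..1}"
    unfolding K_sum[abs_def] by (intro has_integral_sum finite_lessThan)
  also have "(\<Sum>j<N. \<Sum>k<N. if int k - int j = 0 then 1 else 0 :: complex) = of_nat N"
    by (simp add: sum.delta)
  finally have K: "(K has_integral of_nat N) {0..1}" .
  have int_norm: "((\<lambda>t. (cmod (D t))\<^sup>2) has_integral real N) {0..1}"
    using has_integral_linear[OF K bounded_linear_Re] by (simp add: o_def K_real)
  have cont: "continuous_on {0..1} K"
    unfolding K_sum[abs_def] by (intro continuous_intros)
  have "(\<Sum>j<N. \<Sum>k<N. fourier (int j - int k) x) = integral {0..1} (\<lambda>t. K t *\<^sub>C orbit x t)"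
    unfolding fourier_def K_sum cvec.scale_sum_left
    by (simp only: integral_sum fourier_integrable integrable_sum finite_lessThan)
  also have "norm \<dots> \<le> integral {0..1} (\<lambda>t. (cmod (D t))\<^sup>2 * norm x)"
  proof (rule integral_norm_bound_integral)
    show "(\<lambda>t. K t *\<^sub>C orbit x t) integrable_on {0..1}"
      by (intro integrable_continuous_interval continuous_intros cont)
    show "(\<lambda>t. (cmod (D t))\<^sup>2 * norm x) integrable_on {0..1}"
      using has_integral_mult_left[OF int_norm] by blast
    show "norm (K t *\<^sub>C orbit x t) \<le> (cmod (D t))\<^sup>2 * norm x" for t
      by (simp add: norm_scaleC K_real norm_power mult_left_mono norm_orbit)
  qed
  also have "\<dots> = real N * norm x"
    using has_integral_mult_left[OF int_norm] by blast
  finally have "norm (\<Sum>j<N. \<Sum>k<N. fourier (int j - int k) x) \<le> real N * norm x" .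
  then show ?thesis
    using False by (simp add: fejer_def field_simps)
qed (simp add: fejer_def)

lemma fejer_add: "fejer N (x + y) = fejer N x + fejer N y"
  unfolding fejer_def fourier_add sum.distrib scaleR_add_right ..

lemma fejer_scaleC: "fejer N (c *\<^sub>C x) = c *\<^sub>C fejer N x"
  unfolding fejer_def fourier_scaleC scaleC_scaleR cvec.scale_sum_right ..

text \<open>
  The means are uniformly bounded operators, so it is enough to look at homogeneous elements. If the
  degree is \<open>d\<close>, the mean is the element times \<open>(N - \<bar>d\<bar>) / N\<close> as soon as \<open>N > \<bar>d\<bar>\<close>.
\<close>

lemma fejer_tendsto: "(\<lambda>N. fejer N x) \<longlonglongrightarrow> x"
proof (induction x rule: homogeneous_induct)
  case closed
  let ?A = "{x. (\<lambda>N. fejer N x) \<longlonglongrightarrow> x}"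
  have "x \<in> ?A" if "x \<in> closure ?A" for x
  proof -
    have "(\<lambda>N. fejer N x) \<longlonglongrightarrow> x"
    proof (rule LIMSEQ_I)
      fix e :: real assume e: "0 < e"
      then have "0 < e / 3"
        by simp
      with that obtain y where y: "(\<lambda>N. fejer N y) \<longlonglongrightarrow> y" "dist y x < e / 3"
        unfolding closure_approachable by blast
      from LIMSEQ_D[OF y(1), of "e / 3"] e
      obtain N0 where N0: "\<And>N. N \<ge> N0 \<Longrightarrow> norm (fejer N y - y) < e / 3"
        by auto
      have "norm (fejer N x - x) < e" if "N \<ge> N0" for N
      proof -
        have "fejer N x = fejer N (x - y) + fejer N y"
          by (simp flip: fejer_add)
        then have "fejer N x - x = fejer N (x - y) + (fejer N y - y) + (y - x)"
          by simp
        then have "norm (fejer N x - x) \<le> norm (fejer N (x - y)) + norm (fejer N y - y) + norm (y - x)"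
          using norm_triangle_ineq[of "fejer N (x - y) + (fejer N y - y)" "y - x"]
            norm_triangle_ineq[of "fejer N (x - y)" "fejer N y - y"] by simp
        also have "\<dots> < e / 3 + e / 3 + e / 3"
          using norm_fejer[of N "x - y"] N0[OF that] y(2)
          by (intro add_strict_mono) (simp_all add: dist_norm norm_minus_commute)
        finally show ?thesis
          by simp
      qed
      then show "\<exists>N0. \<forall>N\<ge>N0. norm (fejer N x - x) < e"
        by blast
    qed
    then show ?thesis
      by simp
  qed
  then show ?case
    using closure_subset_eq by blast
next
  case (add x y)
  then show ?case
    by (simp add: fejer_add tendsto_add)
next
  case (scaleC c x)
  then show ?case
    by (simp add: fejer_scaleC bounded_linear.tendsto[OF bounded_linear_scaleC])
next
  case (homogeneous d x)
  define J where "J N = {j. j < N \<and> (\<exists>k<N. int j - int k = d)}" for N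
  have fin: "finite (J N)" for N
    by (simp add: J_def)
  have J_subset: "J N \<subseteq> {..<N}" for N
    by (auto simp: J_def)
  have fejer: "fejer N x = (real (card (J N)) / N) *\<^sub>R x" for N
  proof -
    have "(\<Sum>k<N. fourier (int j - int k) x) = (if j \<in> J N then x else 0)" if "j < N" for j
    proof -
      have "(\<Sum>k<N. fourier (int j - int k) x) = (\<Sum>k<N. if k = nat (int j - d) \<and> int j \<ge> d then x else 0)"
        by (intro sum.cong) (auto simp: fourier_homogeneous_element[OF homogeneous])
      also have "\<dots> = (if j \<in> J N then x else 0)"
      proof (cases "int j \<ge> d")
        case True
        then have "j \<in> J N \<longleftrightarrow> nat (int j - d) < N"
          using that by (auto simp: J_def intro!: exI[of _ "nat (int j - d)"])
        then show ?thesis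
          using True by (simp add: sum.delta)
      qed (auto simp: J_def)
      finally show ?thesis .
    qed
    then have "(\<Sum>j<N. \<Sum>k<N. fourier (int j - int k) x) = (\<Sum>j<N. if j \<in> J N then x else 0)"
      by simp
    also have "\<dots> = (\<Sum>j\<in>J N. x)"
      by (rule sum.mono_neutral_cong_right) (auto simp: J_def)
    finally show ?thesis
      by (simp add: fejer_def sum_constant_scaleR)
  qed
  have lower: "real N - real (nat \<bar>d\<bar>) \<le> card (J N)" for N
  proof -
    have "{..<N} - J N \<subseteq> (if d \<ge> 0 then {..<nat d} else {N - nat (- d)..<N})"
    proof
      fix j assume "j \<in> {..<N} - J N"
      then have "j < N" and none: "\<not> (\<exists>k<N. int j - int k = d)"
        by (auto simp: J_def)
      have "int j < d \<or> N \<le> nat (int j - d)"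
      proof (rule ccontr)
        assume "\<not> ?thesis"
        then have "nat (int j - d) < N \<and> int j - int (nat (int j - d)) = d"
          by auto
        with none show False
          by blast
      qed
      with \<open>j < N\<close> show "j \<in> (if d \<ge> 0 then {..<nat d} else {N - nat (- d)..<N})"
        by auto
    qed
    then have "card ({..<N} - J N) \<le> card (if d \<ge> 0 then {..<nat d} else {N - nat (- d)..<N})"
      by (intro card_mono) auto
    also have "\<dots> \<le> nat \<bar>d\<bar>"
      by auto
    finally have "N - card (J N) \<le> nat \<bar>d\<bar>"
      using card_Diff_subset[OF fin, of N "{..<N}"] by (simp add: J_subset)
    then show ?thesis
      by linarith
  qed
  have upper: "card (J N) \<le> N" for N
    using card_mono[OF _ J_subset[of N]] by simp
  have "(\<lambda>N. real (card (J N)) / real N) \<longlonglongrightarrow> 1"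
  proof (rule tendsto_sandwich)
    show "(\<lambda>N. 1 - real (nat \<bar>d\<bar>) * inverse (real N)) \<longlonglongrightarrow> 1"
      using tendsto_diff[OF tendsto_const tendsto_mult_right_zero[OF lim_inverse_n], of 1 "real (nat \<bar>d\<bar>)"]
      by simp
    show "\<forall>\<^sub>F N in sequentially. 1 - real (nat \<bar>d\<bar>) * inverse (real N) \<le> real (card (J N)) / real N"
      using eventually_gt_at_top[of 0]
    proof eventually_elim
      case (elim N)
      then show ?case
        using divide_right_mono[OF lower[of N], of "real N"] by (simp add: field_simps)
    qed
    show "\<forall>\<^sub>F N in sequentially. real (card (J N)) / real N \<le> 1"
      using upper by (intro always_eventually allI) (auto simp: divide_le_eq_1)
  qed simp
  from tendsto_scaleR[OF this tendsto_const[of x]] show ?case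
    by (simp add: fejer)
qed

lemma eq_fourier_0:
  assumes "\<And>k. k \<noteq> 0 \<Longrightarrow> fourier k x = 0"
  shows "x = fourier 0 x"
proof (rule LIMSEQ_unique[OF fejer_tendsto])
  have "fejer N x = fourier 0 x" if "N > 0" for N
  proof -
    have "(\<Sum>k<N. fourier (int j - int k) x) = (\<Sum>k<N. if k = j then fourier 0 x else 0)" for j
      using assms by (intro sum.cong) auto
    then show ?thesis
      using that by (simp add: fejer_def sum.delta sum_constant_scaleR)
  qed
  then show "(\<lambda>N. fejer N x) \<longlonglongrightarrow> fourier 0 x"
    by (intro tendsto_eventually eventually_mono[OF eventually_gt_at_top[of 0]])
qed

end

section \<open>The core is finite\<close>

text \<open>
  The image of a basis is independent and as large as the basis, hence spans the whole space.
\<close>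

lemma surj_of_inj_on_finite_cspan:
  fixes B :: "'a::cstar_algebra set"
  assumes B: "finite B" and lin: "Vector_Spaces.linear scaleC scaleC f"
    and into: "f ` cspan B \<subseteq> cspan B" and inj: "\<And>x. x \<in> cspan B \<Longrightarrow> f x = 0 \<Longrightarrow> x = 0"
  shows "cspan B \<subseteq> f ` cspan B"
proof -
  interpret pair: vector_space_pair "scaleC :: complex \<Rightarrow> 'a \<Rightarrow> 'a" "scaleC :: complex \<Rightarrow> 'a \<Rightarrow> 'a"
    by unfold_locales
  interpret f: Vector_Spaces.linear scaleC scaleC f
    by (rule lin)
  obtain C where C: "C \<subseteq> B" "cvec.independent C" "B \<subseteq> cspan C"
    using cvec.maximal_independent_subset by blast
  have span_C: "cspan C = cspan B"
    using C by (meson cvec.span_mono cvec.span_minimal cvec.subspace_span subset_antisym)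
  have "inj_on f (cspan C)"
  proof (rule inj_onI)
    fix x y assume "x \<in> cspan C" "y \<in> cspan C" "f x = f y"
    then have "x - y \<in> cspan B" "f (x - y) = 0"
      by (simp_all add: span_C cvec.span_diff f.diff)
    then have "x - y = 0"
      by (rule inj)
    then show "x = y"
      by simp
  qed
  then have ind: "cvec.independent (f ` C)" and card: "card (f ` C) = card C"
    using pair.linear_independent_injective_image[OF lin C(2)] inj_on_subset[OF _ cvec.span_superset]
    by (auto intro: card_image)
  have fin: "finite C"
    using C(1) B finite_subset by blast
  have sub: "f ` C \<subseteq> cspan C"
    using into cvec.span_superset[of C] by (auto simp: span_C)
  have "b \<in> cspan (f ` C)" if b: "b \<in> cspan C" for b
  proof (rule ccontr)
    assume not: "b \<notin> cspan (f ` C)"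
    then have "cvec.independent (insert b (f ` C))"
      by (intro cvec.independent_insertI ind)
    then have "card (insert b (f ` C)) \<le> card C"
      using cvec.independent_span_bound[OF fin, of "insert b (f ` C)"] b sub by auto
    moreover have "b \<notin> f ` C"
      using not cvec.span_base[of b "f ` C"] by auto
    ultimately show False
      using fin card by simp
  qed
  then show ?thesis
    using pair.linear_span_image[OF lin, of C] by (auto simp: span_C)
qed

context graph_algebra
begin

text \<open>
  The monomials \<open>monomial \<mu> v \<nu>\<close> with \<open>\<mu>\<close> and \<open>\<nu>\<close> of length \<open>k\<close> span a finite-dimensional algebra. These
  algebras increase with \<open>k\<close>, since there are no sinks, and their union is dense in the core.
\<close>

definition level :: "nat \<Rightarrow> 'a set" where
  "level k = {monomial \<mu> v \<nu> |\<mu> v \<nu>. set \<mu> \<subseteq> arcs E \<and> v \<in> verts E \<and> set \<nu> \<subseteq> arcs E \<and>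
     length \<mu> = k \<and> length \<nu> = k}"

lemma finite_level: "finite (level k)"
proof -
  let ?L = "{\<mu>. set \<mu> \<subseteq> arcs E \<and> length \<mu> = k}"
  have "level k \<subseteq> (\<lambda>(\<mu>, v, \<nu>). monomial \<mu> v \<nu>) ` (?L \<times> verts E \<times> ?L)"
  proof
    fix x assume "x \<in> level k"
    then obtain \<mu> v \<nu> where "x = monomial \<mu> v \<nu>" "(\<mu>, v, \<nu>) \<in> ?L \<times> verts E \<times> ?L"
      unfolding level_def by blast
    then show "x \<in> (\<lambda>(\<mu>, v, \<nu>). monomial \<mu> v \<nu>) ` (?L \<times> verts E \<times> ?L)"
      by (intro image_eqI[of _ _ "(\<mu>, v, \<nu>)"]) simp_all
  qed
  then show ?thesis
    by (rule finite_subset) (simp add: finite_lists_length_eq)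
qed

lemma level_subset_Suc: "level k \<subseteq> cspan (level (Suc k))"
proof
  fix x assume "x \<in> level k"
  then obtain \<mu> v \<nu> where x: "x = monomial \<mu> v \<nu>" and *: "set \<mu> \<subseteq> arcs E" "v \<in> verts E"
    "set \<nu> \<subseteq> arcs E" "length \<mu> = k" "length \<nu> = k"
    unfolding level_def by blast
  have "word \<mu> * (S e * star (S e)) * star (word \<nu>) = monomial (\<mu> @ [e]) (head E e) (\<nu> @ [e])"
    if "e \<in> arcs E" for e
  proof -
    have "monomial (\<mu> @ [e]) (head E e) (\<nu> @ [e]) =
        word \<mu> * (S e * P (head E e)) * star (S e) * star (word \<nu>)"
      by (simp add: monomial_def word_append star_mult mult.assoc)
    then show ?thesis
      by (simp only: S_P[OF that] mult.assoc)
  qed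
  then have "x = (\<Sum>e\<in>out_arcs E v. monomial (\<mu> @ [e]) (head E e) (\<nu> @ [e]))"
    unfolding x monomial_def[of \<mu>] P_sum[OF *(2)] by (simp add: sum_distrib_left sum_distrib_right)
  also have "\<dots> \<in> cspan (level (Suc k))"
  proof (intro cvec.span_sum cvec.span_base)
    fix e assume "e \<in> out_arcs E v"
    with * show "monomial (\<mu> @ [e]) (head E e) (\<nu> @ [e]) \<in> level (Suc k)"
      unfolding level_def by fastforce
  qed
  finally show "x \<in> cspan (level (Suc k))" .
qed

lemma cspan_level_mono: "k \<le> l \<Longrightarrow> cspan (level k) \<subseteq> cspan (level l)"
  using lift_Suc_mono_le[of "\<lambda>k. cspan (level k)"] level_subset_Suc
  by (simp add: cvec.span_minimal)

text \<open>
  Here the orthogonality relation of the \<open>S e\<close> shortens both words from their first letters; equal length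
  guarantees that neither word is left over.
\<close>

lemma word_star_word:
  assumes "length \<nu> = length \<mu>" "set \<nu> \<subseteq> arcs E" "set \<mu> \<subseteq> arcs E" "v \<in> verts E" "w \<in> verts E"
  shows "P v * (star (word \<nu>) * (word \<mu> * P w)) \<in> {0, P v}"
  using assms(1-3)
proof (induction \<nu> \<mu> rule: list_induct2)
  case Nil
  then show ?case
    using assms(4,5) by (auto simp: P_orth)
next
  case (Cons e \<nu> f \<mu>)
  then have ef: "e \<in> arcs E" "f \<in> arcs E" and IH: "P v * (star (word \<nu>) * (word \<mu> * P w)) \<in> {0, P v}"
    by auto
  have "P v * (star (word (e # \<nu>)) * (word (f # \<mu>) * P w)) =
      P v * (star (word \<nu>) * ((star (S e) * S f) * (word \<mu> * P w)))"
    by (simp add: star_mult mult.assoc)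
  also have "\<dots> \<in> {0, P v}"
  proof (cases "e = f")
    case True
    have "P (head E e) * (word \<mu> * P w) \<in> {0, word \<mu> * P w}"
      using P_word_P[of "head E e" w \<mu>] ef assms(5) Cons.prems by auto
    then show ?thesis
      using IH ef True by (auto simp: star_S_S)
  qed (use ef in \<open>simp add: star_S_S\<close>)
  finally show ?case .
qed

lemma level_mult: "x \<in> level k \<Longrightarrow> y \<in> level k \<Longrightarrow> x * y \<in> cspan (level k)"
proof -
  assume "x \<in> level k" "y \<in> level k"
  then obtain \<mu> v \<nu> \<mu>' w \<nu>' where x: "x = monomial \<mu> v \<nu>" and y: "y = monomial \<mu>' w \<nu>'"
    and *: "set \<mu> \<subseteq> arcs E" "v \<in> verts E" "set \<nu> \<subseteq> arcs E" "length \<mu> = k" "length \<nu> = k"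
      "set \<mu>' \<subseteq> arcs E" "w \<in> verts E" "set \<nu>' \<subseteq> arcs E" "length \<mu>' = k" "length \<nu>' = k"
    unfolding level_def by blast
  have "x * y = word \<mu> * (P v * (star (word \<nu>) * (word \<mu>' * P w))) * star (word \<nu>')"
    by (simp add: x y monomial_def mult.assoc)
  then have "x * y = 0 \<or> x * y = monomial \<mu> v \<nu>'"
    using word_star_word[of \<nu> \<mu>' v w] * by (auto simp: monomial_def)
  moreover have "monomial \<mu> v \<nu>' \<in> level k"
    unfolding level_def using * by blast
  ultimately show ?thesis
    using cvec.span_base cvec.span_zero by auto
qed

lemma cspan_level_mult:
  assumes x: "x \<in> cspan (level k)" and y: "y \<in> cspan (level k)"
  shows "x * y \<in> cspan (level k)"
proof -
  have left: "a * b \<in> cspan (level k)" if "a \<in> level k" "b \<in> cspan (level k)" for a b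
    using that(2)
  proof (induction b rule: cvec.span_induct_alt)
    case (step c g b)
    then show ?case
      using level_mult[OF that(1)]
      by (simp add: distrib_left mult_scaleC_right cvec.span_add cvec.span_scale)
  qed (simp add: cvec.span_zero)
  from x show ?thesis
  proof (induction x rule: cvec.span_induct_alt)
    case (step c a x)
    then show ?case
      using left[OF _ y] by (simp add: distrib_right mult_scaleC_left cvec.span_add cvec.span_scale)
  qed (simp add: cvec.span_zero)
qed

lemma unit_in_cspan_level: "unit \<in> cspan (level k)"
proof -
  have "P v \<in> level 0" if "v \<in> verts E" for v
    unfolding level_def using that by (auto simp: monomial_def intro!: exI[of _ "[]"] exI[of _ v])
  then have "unit \<in> cspan (level 0)"
    unfolding unit_def by (intro cvec.span_sum cvec.span_base)
  then show ?thesis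
    using cspan_level_mono[of 0 k] by auto
qed

lemma fourier_0_in_level:
  assumes "y \<in> cspan monomials"
  shows "\<exists>k. fourier 0 y \<in> cspan (level k)"
  using assms
proof (induction y rule: cvec.span_induct_alt)
  case base
  have "fourier 0 0 = 0"
    using fourier_homogeneous_element[OF homogeneous_0, of 0 0] by simp
  then show ?case
    by (simp add: cvec.span_zero)
next
  case (step c g y)
  from step.hyps(1) obtain \<mu> v \<nu> where g: "g = monomial \<mu> v \<nu>" and *: "set \<mu> \<subseteq> arcs E" "v \<in> verts E"
    "set \<nu> \<subseteq> arcs E"
    by (auto simp: monomials_def)
  from step obtain k where k: "fourier 0 y \<in> cspan (level k)"
    by auto
  have "fourier 0 g \<in> cspan (level (length \<mu>))"
  proof (cases "length \<mu> = length \<nu>")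
    case True
    then have "g \<in> level (length \<mu>)"
      unfolding level_def g using * by (intro CollectI exI[of _ \<mu>] exI[of _ v] exI[of _ \<nu>]) auto
    moreover have "fourier 0 g = g"
      using fourier_homogeneous_element[OF homogeneous_monomial[OF *], of 0] True by (simp add: g)
    ultimately show ?thesis
      by (simp add: cvec.span_base)
  next
    case False
    then have "fourier 0 g = 0"
      using fourier_homogeneous_element[OF homogeneous_monomial[OF *], of 0] by (simp add: g)
    then show ?thesis
      by (simp add: cvec.span_zero)
  qed
  then have "fourier 0 g \<in> cspan (level (max (length \<mu>) k))" "fourier 0 y \<in> cspan (level (max (length \<mu>) k))"
    using k cspan_level_mono[of "length \<mu>" "max (length \<mu>) k"] cspan_level_mono[of k "max (length \<mu>) k"]
    by auto
  then show ?case
    by (auto simp: fourier_add fourier_scaleC intro: cvec.span_add cvec.span_scale)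
qed

text \<open>
  Applying the contraction \<open>fourier 0\<close>, which fixes the core, to an approximation by monomials removes
  all terms of nonzero degree.
\<close>

lemma core_approximation:
  assumes x: "x \<in> core" and e: "0 < e"
  obtains k a where "a \<in> cspan (level k)" "norm (x - a) < e"
proof -
  have "x \<in> closure (cspan monomials)"
    by (simp add: closure_cspan_monomials)
  then obtain y where y: "y \<in> cspan monomials" "dist y x < e"
    using e unfolding closure_approachable by blast
  have "fourier 0 (x - y) = fourier 0 x - fourier 0 y"
    using linear_diff[OF bounded_linear.linear[OF bounded_linear_fourier]] by blast
  also have "fourier 0 x = x"
    using x fourier_homogeneous_element[of 0 x 0] by (simp add: core_iff)
  finally have "norm (x - fourier 0 y) \<le> norm (x - y)"
    by (metis norm_fourier)
  with y fourier_0_in_level[OF y(1)] show thesis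
    using that by (auto simp: dist_norm norm_minus_commute intro: order_le_less_trans)
qed

lemma norm_unit: "norm unit \<le> 1"
proof -
  have "(norm unit)\<^sup>2 = norm unit"
    using cstar_identity[of unit] by simp
  then have "norm unit = 0 \<or> norm unit = 1"
    by (simp add: power2_eq_square)
  then show ?thesis
    by auto
qed

text \<open>
  An element \<open>a\<close> of a finite-dimensional subalgebra that is close to \<open>v\<close> multiplies injectively from
  the left, hence has a right inverse \<open>b\<close> in this subalgebra. As \<open>d = c 1 - v v\<^sup>*\<close> annihilates \<open>v\<close>, we get
  \<open>d = d (a - v) b\<close>, where \<open>(a - v) b\<close> is small.
\<close>

lemma core_finite:
  assumes v: "v \<in> core" and vv: "star v * v = c *\<^sub>C unit" and c: "c \<noteq> 0"
  shows "v * star v = c *\<^sub>C unit"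
proof -
  define \<kappa> where "\<kappa> = sqrt (cmod c)"
  have \<kappa>: "0 < \<kappa>"
    using c by (simp add: \<kappa>_def)
  have norm_v: "norm (v * x) = \<kappa> * norm x" for x
  proof -
    have "(norm (v * x))\<^sup>2 = norm (star x * (star v * v) * x)"
      by (simp add: star_mult mult.assoc flip: cstar_identity)
    also have "\<dots> = cmod c * (norm x)\<^sup>2"
      by (simp add: vv mult_scaleC_left mult_scaleC_right norm_scaleC cstar_identity)
    also have "\<dots> = (\<kappa> * norm x)\<^sup>2"
      by (simp add: \<kappa>_def power_mult_distrib)
    finally show ?thesis
      using \<kappa> by (simp add: power2_eq_iff_nonneg)
  qed
  obtain k a where a: "a \<in> cspan (level k)" "norm (v - a) < \<kappa> / 4"
    by (rule core_approximation[OF v, of "\<kappa> / 4"]) (use \<kappa> in auto)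
  have close: "norm (v * x - a * x) \<le> \<kappa> / 4 * norm x" for x
    using norm_mult_ineq[of "v - a" x] mult_right_mono[OF less_imp_le[OF a(2)] norm_ge_zero[of x]]
    by (simp add: left_diff_distrib)
  have "cspan (level k) \<subseteq> (\<lambda>x. a * x) ` cspan (level k)"
  proof (rule surj_of_inj_on_finite_cspan)
    show "Vector_Spaces.linear scaleC scaleC (\<lambda>x. a * x)"
      by unfold_locales (simp_all add: distrib_left mult_scaleC_right)
    show "x = 0" if "a * x = 0" for x
    proof -
      have "\<kappa> * norm x \<le> \<kappa> / 4 * norm x"
        using close[of x] that by (simp add: norm_v)
      then have "norm x \<le> 0"
        using \<kappa> by (simp add: mult_le_cancel_left_pos field_simps)
      then show ?thesis
        by simp
    qed
  qed (auto simp: finite_level intro: cspan_level_mult[OF a(1)])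
  then obtain b where b: "a * b = unit"
    using unit_in_cspan_level[of k] by auto
  have "\<kappa> * norm b \<le> norm unit + \<kappa> / 4 * norm b"
    using close[of b] norm_triangle_ineq[of unit "v * b - a * b"] by (simp add: b flip: norm_v)
  then have norm_b: "\<kappa> / 4 * norm b \<le> 1 / 3"
    using norm_unit by linarith
  define d where "d = c *\<^sub>C unit - v * star v"
  have "d * v = 0"
    by (simp add: d_def left_diff_distrib mult_scaleC_left mult_scaleC_right mult.assoc vv)
  then have "d = d * (a * b - v * b)"
    by (simp add: b right_diff_distrib flip: mult.assoc)
  then have "norm d \<le> norm d * norm (a * b - v * b)"
    by (metis norm_mult_ineq)
  also have "\<dots> \<le> norm d * (1 / 3)"
    using close[of b] norm_b by (intro mult_left_mono) (auto simp: norm_minus_commute)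
  finally have "d = 0"
    by simp
  then show ?thesis
    by (simp add: d_def)
qed

end

section \<open>A proper isometry of degree 1\<close>

text \<open>
  Following an edge out of each vertex, one visits some vertex twice.
\<close>

lemma exists_closed_walk:
  assumes E: "fin_digraph E" and no_sinks: "\<And>v. \<not> is_sink E v" and v: "v \<in> verts E"
  shows "\<exists>p. wf_digraph.closed_w E p"
proof -
  interpret fin_digraph E by fact
  define out where "out w = (SOME e. e \<in> out_arcs E w)" for w
  define step where "step w = head E (out w)" for w
  have out: "out w \<in> arcs E \<and> tail E (out w) = w" if "w \<in> verts E" for w
  proof -
    have "out_arcs E w \<noteq> {}"
      using no_sinks[of w] that by (simp add: is_sink_def)
    then have "out w \<in> out_arcs E w"
      unfolding out_def some_in_eq .
    then show ?thesis
      by simp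
  qed
  have step: "step w \<in> verts E" if "w \<in> verts E" for w
    using out[OF that] by (simp add: step_def)
  have walk: "\<exists>p. length p = n \<and> awalk w p ((step ^^ n) w)" if "w \<in> verts E" for n w
    using that
  proof (induction n arbitrary: w)
    case 0
    then show ?case
      by (simp add: awalk_Nil_iff)
  next
    case (Suc n)
    from Suc.IH[OF step[OF Suc.prems]] obtain p
      where "length p = n" "awalk (step w) p ((step ^^ n) (step w))"
      by blast
    moreover have "(step ^^ Suc n) w = (step ^^ n) (step w)"
      by (simp only: funpow_Suc_right comp_apply)
    ultimately show ?case
      using out[OF Suc.prems]
      by (intro exI[of _ "out w # p"]) (simp only: awalk_Cons_iff list.size, simp flip: step_def)
  qed
  have verts: "(step ^^ n) v \<in> verts E" for n
    by (induction n) (simp_all add: v step)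
  then have "range (\<lambda>n. (step ^^ n) v) \<subseteq> verts E"
    by auto
  then have "finite (range (\<lambda>n. (step ^^ n) v))"
    by (rule finite_subset) simp
  then have "\<not> inj (\<lambda>n. (step ^^ n) v)"
    using finite_imageD infinite_UNIV_nat by blast
  then obtain i j where ij: "i < j" "(step ^^ i) v = (step ^^ j) v"
    unfolding inj_def by (metis linorder_neqE_nat)
  let ?w = "(step ^^ i) v"
  have "(step ^^ (j - i)) ?w = (step ^^ (j - i + i)) v"
    by (simp only: funpow_add comp_apply)
  also have "\<dots> = ?w"
    using ij by simp
  finally have "(step ^^ (j - i)) ?w = ?w" .
  with walk[OF verts[of i], of "j - i"] obtain p where "length p = j - i" "awalk ?w p ?w"
    by auto
  then show ?thesis
    using ij by (auto simp: closed_w_def)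
qed

locale graph_isometry = graph_algebra E P S
  for E :: "('v, 'e) pre_digraph" and P :: "'v \<Rightarrow> 'a::cstar_algebra" and S :: "'e \<Rightarrow> 'a" +
  fixes ev :: "'v \<Rightarrow> 'e"
  assumes exits: "\<And>p. closed_w p \<Longrightarrow> has_exit E p"
    and ev: "\<And>v. v \<in> verts E \<Longrightarrow> ev v \<in> arcs E \<and> head E (ev v) = v"
begin

definition T :: 'a where
  "T = (\<Sum>v\<in>verts E. S (ev v))"

lemma star_T_T: "star T * T = unit"
proof -
  have "star (S (ev v)) * S (ev w) = (if v = w then P v else 0)" if "v \<in> verts E" "w \<in> verts E" for v w
    using ev[OF that(1)] ev[OF that(2)] by (auto simp: star_S_S)
  then show ?thesis
    by (simp add: T_def star_sum sum_product unit_def sum.delta)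
qed

lemma homogeneous_T: "homogeneous 1 T"
  unfolding T_def using ev by (intro homogeneous_sum homogeneous_S) auto

text \<open>
  A homomorphism takes the \<open>P v\<close> to the nonzero projections of the family of partial shifts.
\<close>

lemma P_neq_0:
  assumes "v \<in> verts E"
  shows "P v \<noteq> 0"
proof (rule exists_faithful_ck_family[OF fin_digraph no_sinks])
  fix Q :: "'v \<Rightarrow> nat ell2_op" and R :: "'e \<Rightarrow> nat ell2_op"
  assume QR: "ck_family E cstar_of Q R" and Q: "\<And>v. v \<in> verts E \<Longrightarrow> Q v \<noteq> 0"
  show "P v \<noteq> 0"
  proof (rule is_graph_cstar_universal[OF fin_digraph graph QR inj_matrix])
    fix \<phi> :: "'a \<Rightarrow> nat ell2_op"
    assume \<phi>: "star_hom cstar_of cstar_of \<phi>" "\<And>v. v \<in> verts E \<Longrightarrow> \<phi> (P v) = Q v"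
    then show "P v \<noteq> 0"
      using Q assms star_hom_simps(6)[OF \<phi>(1)] by metis
  qed
qed

text \<open>
  If \<open>T\<close> were unitary, the edges \<open>ev v\<close> would be all edges. There would be as many edges as vertices,
  so every vertex would emit just one edge, and a loop could not have an exit.
\<close>

lemma T_not_right_invertible:
  assumes v: "v \<in> verts E"
  shows "T * b \<noteq> unit"
proof
  assume Tb: "T * b = unit"
  have "b = star T * (T * b)"
    by (simp add: star_T_T flip: mult.assoc)
  then have TT: "T * star T = unit"
    using Tb by simp
  have arcs: "arcs E = ev ` verts E"
  proof (rule ccontr)
    assume "arcs E \<noteq> ev ` verts E"
    then obtain e where e: "e \<in> arcs E" "e \<notin> ev ` verts E"
      using ev by auto
    have "star T * S e = 0"
      unfolding T_def star_sum sum_distrib_right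
      using e ev by (intro sum.neutral ballI) (auto simp: star_S_S)
    then have "T * star T * S e = 0"
      by (simp add: mult.assoc)
    then have "S e = 0"
      by (simp add: TT)
    then have "P (head E e) = 0"
      using star_S_S[OF e(1) e(1)] by simp
    then show False
      using P_neq_0 e by simp
  qed
  have "tail E ` arcs E = verts E"
  proof (intro equalityI subsetI)
    fix w assume "w \<in> verts E"
    then have "out_arcs E w \<noteq> {}"
      using no_sinks[of w] by (simp add: is_sink_def)
    then show "w \<in> tail E ` arcs E"
      by auto
  qed auto
  moreover have "card (arcs E) \<le> card (verts E)"
    by (simp add: arcs card_image_le)
  ultimately have "card (tail E ` arcs E) = card (arcs E)"
    using card_image_le[of "arcs E" "tail E"] by simp
  then have inj: "inj_on (tail E) (arcs E)"
    by (rule eq_card_imp_inj_on[rotated]) simp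
  obtain p where "closed_w p"
    using exists_closed_walk[OF fin_digraph no_sinks v] by blast
  then have "has_exit E p"
    by (rule exits)
  then obtain e f g where "f \<in> out_arcs E (tail E e)" "g \<in> out_arcs E (tail E e)" "f \<noteq> g"
    by (auto simp: has_exit_def)
  with inj_onD[OF inj, of f g] show False
    by simp
qed

primrec T_power :: "nat \<Rightarrow> 'a" where
  "T_power 0 = unit"
| "T_power (Suc n) = T * T_power n"

lemma star_T_power_T_power: "star (T_power n) * T_power n = unit"
proof (induction n)
  case (Suc n)
  have "star (T_power (Suc n)) * T_power (Suc n) = star (T_power n) * (star T * T) * T_power n"
    by (simp add: star_mult mult.assoc)
  with Suc show ?case
    by (simp add: star_T_T)
qed simp

lemma homogeneous_T_power: "homogeneous (int n) (T_power n)"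
proof (induction n)
  case (Suc n)
  then show ?case
    using homogeneous_mult[OF homogeneous_T Suc] by simp
qed (simp add: homogeneous_unit)

end

section \<open>Automorphisms that preserve the core\<close>

locale graph_isometry_factor_core = graph_isometry E P S ev
  for E :: "('v, 'e) pre_digraph" and P :: "'v \<Rightarrow> 'a::cstar_algebra" and S :: "'e \<Rightarrow> 'a"
    and ev :: "'v \<Rightarrow> 'e" +
  assumes nonempty: "verts E \<noteq> {}"
    and center: "\<And>r. r \<in> core \<Longrightarrow> (\<And>f. f \<in> core \<Longrightarrow> r * f = f * r) \<Longrightarrow> \<exists>c. r = c *\<^sub>C unit"
begin

lemma core_star: "x \<in> core \<Longrightarrow> star x \<in> core"
  using homogeneous_star[of 0 x] by (simp add: core_iff)

lemma T_mult_neq_unit: "T * b \<noteq> unit"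
  using nonempty T_not_right_invertible by blast

lemma unit_neq_0: "unit \<noteq> 0"
  using T_mult_neq_unit[of 0] by auto

definition commutes_with_core :: "'a \<Rightarrow> bool" where
  "commutes_with_core r \<longleftrightarrow> (\<forall>f\<in>core. r * f = f * r)"

lemma commutes_with_core_star:
  assumes "commutes_with_core r"
  shows "commutes_with_core (star r)"
  unfolding commutes_with_core_def
proof
  fix f assume "f \<in> core"
  then have "r * star f = star f * r"
    using assms core_star by (simp add: commutes_with_core_def)
  from arg_cong[OF this, of star] show "star r * f = f * star r"
    by (simp add: star_mult star_star)
qed

lemma commutes_with_core_mult:
  assumes "commutes_with_core r" "commutes_with_core s"
  shows "commutes_with_core (r * s)"
  unfolding commutes_with_core_def
proof
  fix f assume "f \<in> core"
  then have "r * f = f * r" "s * f = f * s"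
    using assms by (simp_all add: commutes_with_core_def)
  then show "r * s * f = f * (r * s)"
    by (metis mult.assoc)
qed

text \<open>
  If \<open>r \<noteq> 0\<close> has degree \<open>k > 0\<close>, then \<open>r r\<^sup>*\<close> is a scalar, and \<open>T\<^sup>k r\<^sup>*\<close> lies in the core and is a multiple
  of an isometry. By finiteness of the core it is a multiple of a unitary, which makes \<open>T\<close> unitary.
\<close>

lemma commutes_homogeneous_pos:
  assumes r: "commutes_with_core r" and hom: "homogeneous (int k) r" and k: "k > 0"
  shows "r = 0"
proof -
  have "r * star r \<in> core"
    using homogeneous_mult[OF hom homogeneous_star[OF hom]] by (simp add: core_iff)
  moreover have "commutes_with_core (r * star r)"
    by (intro commutes_with_core_mult commutes_with_core_star r)
  ultimately obtain c where c: "r * star r = c *\<^sub>C unit"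
    using center[of "r * star r"] unfolding commutes_with_core_def by blast
  have "c = 0"
  proof (rule ccontr)
    assume "c \<noteq> 0"
    define w where "w = T_power k * star r"
    have "w \<in> core"
      using homogeneous_mult[OF homogeneous_T_power[of k] homogeneous_star[OF hom]]
      by (simp add: w_def core_iff)
    moreover have "star w * w = r * (star (T_power k) * T_power k) * star r"
      by (simp add: w_def star_mult star_star mult.assoc)
    then have "star w * w = c *\<^sub>C unit"
      by (simp add: star_T_power_T_power c)
    ultimately have "w * star w = c *\<^sub>C unit"
      using \<open>c \<noteq> 0\<close> by (rule core_finite)
    moreover obtain l where "k = Suc l"
      using k by (cases k) auto
    ultimately have "T * (T_power l * star r * star w) = c *\<^sub>C unit"
      by (simp add: w_def mult.assoc)
    then have "T * (inverse c *\<^sub>C (T_power l * star r * star w)) = unit"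
      using \<open>c \<noteq> 0\<close> by (simp add: mult_scaleC_right scaleC_scaleC)
    then show False
      using T_mult_neq_unit by blast
  qed
  then have "star (star r) * star r = 0"
    using c by (simp add: star_star)
  then have "star r = 0"
    by (simp only: star_mult_self_eq_0_iff)
  then show ?thesis
    by (metis star_star star_zero)
qed

lemma commutes_homogeneous:
  assumes r: "commutes_with_core r" and hom: "homogeneous n r" and n: "n \<noteq> 0"
  shows "r = 0"
proof (cases "n > 0")
  case True
  then show ?thesis
    using commutes_homogeneous_pos[of r "nat n"] r hom by simp
next
  case False
  then have "star r = 0"
    using commutes_homogeneous_pos[of "star r" "nat (- n)"] commutes_with_core_star[OF r]
      homogeneous_star[OF hom] n by simp
  then show ?thesis
    by (metis star_star star_zero)
qed

text \<open>
  The Fourier coefficients commute with the core, so those of nonzero degree vanish. Thus \<open>r\<close> lies in the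
  core and therefore in its center.
\<close>

lemma commutes_with_core_scalar:
  assumes r: "commutes_with_core r"
  obtains c where "r = c *\<^sub>C unit"
proof -
  have "commutes_with_core (fourier n r)" for n
    unfolding commutes_with_core_def
  proof
    fix f assume f: "f \<in> core"
    then have "fourier n (r * f) = fourier n (f * r)"
      using r by (simp add: commutes_with_core_def)
    then show "fourier n r * f = f * fourier n r"
      using fourier_mult_left[of 0 f n r] fourier_mult_right[of 0 f n r] f by (simp add: core_iff)
  qed
  then have "fourier n r = 0" if "n \<noteq> 0" for n
    using commutes_homogeneous[OF _ homogeneous_fourier that] by blast
  then have "r = fourier 0 r"
    by (rule eq_fourier_0)
  then have "r \<in> core"
    using homogeneous_fourier[of 0 r] by (simp add: core_iff)
  then show thesis
    using center r that by (auto simp: commutes_with_core_def)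
qed

lemma automorphism_unit:
  assumes "\<alpha> \<in> cstar_aut"
  shows "\<alpha> unit = unit"
proof -
  have \<alpha>: "star_hom cstar_of cstar_of \<alpha>" and "bij \<alpha>"
    using assms by (auto simp: cstar_aut_def)
  then obtain x where "\<alpha> x = unit"
    by (metis bij_pointE)
  then show ?thesis
    using star_hom_simps(2)[OF \<alpha>, of unit x] by simp
qed

text \<open>
  Conjugation by \<open>y = \<alpha> T\<close> maps the core into itself, so a Fourier coefficient \<open>q\<close> of \<open>y\<close> satisfies
  \<open>q f = (y f y\<^sup>*) q\<close> for every \<open>f\<close> in the core, just as \<open>y\<close> does. Hence \<open>q\<^sup>* y\<close> commutes with the core and
  is a scalar, and \<open>y\<close> is a multiple of \<open>q\<close>.
\<close>

lemma automorphism_T_homogeneous: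
  assumes aut: "\<alpha> \<in> cstar_aut" and core: "\<alpha> ` core = core"
  obtains n where "homogeneous n (\<alpha> T)"
proof -
  have hom: "star_hom cstar_of cstar_of \<alpha>"
    using aut by (simp add: cstar_aut_def)
  define y where "y = \<alpha> T"
  have yy: "star y * y = unit"
    using automorphism_unit[OF aut] by (simp add: y_def star_T_T flip: star_hom_simps(2,4)[OF hom])
  have y_core: "y * f * star y \<in> core" if f: "f \<in> core" for f
  proof -
    obtain g where g: "g \<in> core" "f = \<alpha> g"
      using f core by auto
    have "homogeneous (1 + 0 + - 1) (T * g * star T)"
      using g(1) by (intro homogeneous_mult homogeneous_star homogeneous_T) (simp add: core_iff)
    then have "\<alpha> (T * g * star T) \<in> core"
      using core by (auto simp: core_iff[symmetric])
    then show ?thesis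
      by (simp add: y_def g star_hom_simps(2,4)[OF hom])
  qed
  have y_f: "y * f = y * f * star y * y" for f
    by (simp add: mult.assoc yy)
  obtain n where n: "fourier n y \<noteq> 0"
  proof (rule ccontr)
    assume "\<not> thesis"
    then have "fourier n y = 0" for n
      using that by blast
    then have "y = 0"
      using eq_fourier_0[of y] by simp
    then show False
      using yy unit_neq_0 by simp
  qed
  define q where "q = fourier n y"
  have q: "homogeneous n q"
    by (simp add: q_def homogeneous_fourier)
  have q_f: "q * f = y * f * star y * q" if f: "f \<in> core" for f
  proof -
    have "q * f = fourier n (y * f)"
      using fourier_mult_right[of 0 f n y] f by (simp add: q_def core_iff)
    also have "\<dots> = fourier n (y * f * star y * y)"
      using y_f[of f] by simp
    also have "\<dots> = y * f * star y * q"
      using fourier_mult_left[of 0 "y * f * star y" n y] y_core[OF f] by (simp add: q_def core_iff)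
    finally show ?thesis .
  qed
  have "commutes_with_core (star q * y)"
    unfolding commutes_with_core_def
  proof
    fix f assume f: "f \<in> core"
    have "f * star q = star q * (y * f * star y)"
      using arg_cong[OF q_f[OF core_star[OF f]], of star] by (simp add: star_mult star_star mult.assoc)
    then have "f * (star q * y) = star q * (y * f * star y) * y"
      by (simp flip: mult.assoc)
    also have "\<dots> = star q * y * f"
      using y_f[of f] by (simp add: mult.assoc yy)
    finally show "star q * y * f = f * (star q * y)" ..
  qed
  then obtain d where d: "star q * y = d *\<^sub>C unit"
    by (rule commutes_with_core_scalar)
  have "star q * q = fourier 0 (star q * y)"
    using fourier_mult_left[OF homogeneous_star[OF q], of 0 y] by (simp add: q_def)
  also have "\<dots> = d *\<^sub>C unit"
    using fourier_homogeneous_element[OF homogeneous_unit, of 0] by (simp add: d fourier_scaleC)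
  finally have "d \<noteq> 0"
    using n by (auto simp: q_def star_mult_self_eq_0_iff)
  have "star y * q = cnj d *\<^sub>C unit"
    using arg_cong[OF d, of star] by (simp add: star_mult star_star star_scaleC)
  moreover have "q = y * (star y * q)"
    using q_f[of unit] by (simp add: core_iff homogeneous_unit mult.assoc)
  ultimately have "q = cnj d *\<^sub>C y"
    by (simp add: mult_scaleC_right)
  then have "y = inverse (cnj d) *\<^sub>C q"
    using \<open>d \<noteq> 0\<close> by (simp add: scaleC_scaleC)
  then have "homogeneous n y"
    using homogeneous_scaleC[OF q] by simp
  then show thesis
    using that by (simp add: y_def)
qed

text \<open>
  If \<open>n \<le> 0\<close>, then \<open>y T\<^sup>-\<^sup>n\<close>, where \<open>y = \<alpha> T\<close>, is an isometry of the core and hence unitary. So the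
  isometry \<open>y\<close> has a right inverse, and \<open>y\<close> and \<open>T\<close> are unitary.
\<close>

lemma automorphism_T_degree_pos:
  assumes aut: "\<alpha> \<in> cstar_aut" and core: "\<alpha> ` core = core" and hom: "homogeneous n (\<alpha> T)"
  shows "n > 0"
proof (rule ccontr)
  assume "\<not> n > 0"
  have \<alpha>: "star_hom cstar_of cstar_of \<alpha>" and inj: "inj \<alpha>"
    using aut by (auto simp: cstar_aut_def bij_is_inj)
  define y where "y = \<alpha> T"
  have yy: "star y * y = unit"
    using automorphism_unit[OF aut] by (simp add: y_def star_T_T flip: star_hom_simps(2,4)[OF \<alpha>])
  define w where "w = y * T_power (nat (- n))"
  have "w \<in> core"
    using homogeneous_mult[OF hom homogeneous_T_power[of "nat (- n)"]] \<open>\<not> n > 0\<close>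
    by (simp add: w_def y_def core_iff)
  moreover have "star w * w = star (T_power (nat (- n))) * (star y * y) * T_power (nat (- n))"
    by (simp add: w_def star_mult mult.assoc)
  then have "star w * w = 1 *\<^sub>C unit"
    by (simp add: yy star_T_power_T_power)
  ultimately have "w * star w = 1 *\<^sub>C unit"
    by (rule core_finite) simp
  then have yb: "y * (T_power (nat (- n)) * star w) = unit"
    by (simp add: w_def mult.assoc)
  then have "T_power (nat (- n)) * star w = star y"
    using yy by (metis mult.assoc unit_left unit_right)
  then have "\<alpha> (T * star T) = \<alpha> unit"
    using yb automorphism_unit[OF aut] by (simp add: y_def star_hom_simps(2,4)[OF \<alpha>])
  then have "T * star T = unit"
    using inj by (simp add: inj_eq)
  then show False
    using T_mult_neq_unit by blast
qed

text \<open>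
  Write \<open>S e = (S e T\<^sup>*) T\<close>, where the first factor lies in the core.
\<close>

lemma automorphism_S_homogeneous:
  assumes aut: "\<alpha> \<in> cstar_aut" and core: "\<alpha> ` core = core" and hom: "homogeneous n (\<alpha> T)"
    and e: "e \<in> arcs E"
  shows "homogeneous n (\<alpha> (S e))"
proof -
  have \<alpha>: "star_hom cstar_of cstar_of \<alpha>"
    using aut by (simp add: cstar_aut_def)
  have "S e * star T \<in> core"
    using homogeneous_mult[OF homogeneous_S[OF e] homogeneous_star[OF homogeneous_T]]
    by (simp add: core_iff)
  then have "homogeneous 0 (\<alpha> (S e * star T))"
    using core by (auto simp: core_iff[symmetric])
  from homogeneous_mult[OF this hom] have "homogeneous n (\<alpha> (S e * star T * T))"
    by (simp add: star_hom_simps(2)[OF \<alpha>])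
  then show ?thesis
    by (simp add: mult.assoc star_T_T)
qed

lemma automorphism_gauge:
  assumes aut: "\<alpha> \<in> cstar_aut" and hom: "\<And>e. e \<in> arcs E \<Longrightarrow> homogeneous n (\<alpha> (S e))"
    and z: "cmod z = 1"
  shows "gauge z \<circ> \<alpha> = \<alpha> \<circ> gauge (z powi n)"
proof (rule star_hom_eqI)
  have \<alpha>: "star_hom cstar_of cstar_of \<alpha>"
    using aut by (simp add: cstar_aut_def)
  have zn: "cmod (z powi n) = 1"
    using z by (simp add: norm_power_int)
  show "star_hom cstar_of cstar_of (gauge z \<circ> \<alpha>)"
    "star_hom cstar_of cstar_of (\<alpha> \<circ> gauge (z powi n))"
    by (intro star_hom_comp \<alpha> gauge(1) z zn)+
  show "(gauge z \<circ> \<alpha>) (S e) = (\<alpha> \<circ> gauge (z powi n)) (S e)" if "e \<in> arcs E" for e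
    using hom[OF that] z that by (simp add: homogeneous_def gauge(2)[OF zn] star_hom_simps(3)[OF \<alpha>])
qed

text \<open>
  The degree of \<open>\<alpha> T\<close> times the degree of \<open>\<alpha>\<^sup>-\<^sup>1 T\<close> is the degree of \<open>T\<close>, that is, 1, and both are positive.
\<close>

lemma automorphism_degree_1:
  assumes aut: "\<alpha> \<in> cstar_aut" and core: "\<alpha> ` core = core"
  shows "homogeneous 1 (\<alpha> T)"
proof -
  let ?\<beta> = "inv_into UNIV \<alpha>"
  have bij: "bij \<alpha>" and \<alpha>: "star_hom cstar_of cstar_of \<alpha>"
    using aut by (auto simp: cstar_aut_def)
  have \<beta>: "?\<beta> \<in> cstar_aut"
    by (rule cstar_aut_inverse[OF aut])
  have \<beta>_core: "?\<beta> ` core = core"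
    using core bij by (metis bij_is_inj image_inv_f_f)
  obtain n where n: "homogeneous n (\<alpha> T)"
    by (rule automorphism_T_homogeneous[OF aut core])
  obtain m where m: "homogeneous m (?\<beta> T)"
    by (rule automorphism_T_homogeneous[OF \<beta> \<beta>_core])
  have pos: "n > 0" "m > 0"
    using automorphism_T_degree_pos[OF aut core n] automorphism_T_degree_pos[OF \<beta> \<beta>_core m] by auto
  have "z powi (n * m) = z" if z: "cmod z = 1" for z
  proof -
    have zn: "cmod (z powi n) = 1"
      using z by (simp add: norm_power_int)
    have \<alpha>\<beta>: "\<alpha> (?\<beta> T) = T"
      using bij by (simp add: bij_is_surj surj_f_inv_f)
    have "z *\<^sub>C T = gauge z (\<alpha> (?\<beta> T))"
      using homogeneous_T z by (simp add: \<alpha>\<beta> homogeneous_def)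
    also have "\<dots> = \<alpha> (gauge (z powi n) (?\<beta> T))"
      using fun_cong[OF automorphism_gauge[OF aut automorphism_S_homogeneous[OF aut core n] z]] by simp
    also have "\<dots> = (z powi (n * m)) *\<^sub>C T"
      using m zn by (simp add: homogeneous_def star_hom_simps(3)[OF \<alpha>] \<alpha>\<beta> power_int_mult)
    finally have "(z - z powi (n * m)) *\<^sub>C T = 0"
      by (simp add: cvec.scale_left_diff_distrib)
    moreover have "T \<noteq> 0"
      using star_T_T unit_neq_0 by auto
    ultimately show ?thesis
      by simp
  qed
  note powi = this
  have "n * m = 1"
  proof (rule ccontr)
    assume "n * m \<noteq> 1"
    moreover define q where "q = n * m - 1"
    ultimately have q: "q > 0"
      using mult_pos_pos[OF pos] by linarith
    \<comment> \<open>a number on the unit circle whose \<open>q\<close>-th power is \<open>-1\<close> instead of 1\<close>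
    define z where "z = cis (pi / of_int q)"
    have "z powi (1 + q) = z"
      using powi[of z] by (simp add: z_def q_def)
    then have "z * z powi q = z * 1"
      by (simp add: power_int_add z_def)
    then have "z powi q = 1"
      by (simp add: z_def)
    moreover have "z powi q = cis pi"
      using q unfolding z_def cis_power_int by simp
    ultimately show False
      by simp
  qed
  then have "n = 1"
    using pos by (simp add: zmult_eq_1_iff)
  with n show ?thesis
    by simp
qed

end

context graph_isometry
begin

lemma commutes_with_gauge_iff:
  assumes aut: "\<alpha> \<in> cstar_aut"
  shows "(\<forall>z. cmod z = 1 \<longrightarrow> \<alpha> \<circ> gauge z = gauge z \<circ> \<alpha>) \<longleftrightarrow> (\<forall>e\<in>arcs E. homogeneous 1 (\<alpha> (S e)))"
proof -
  have \<alpha>: "star_hom cstar_of cstar_of \<alpha>"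
    using aut by (simp add: cstar_aut_def)
  show ?thesis
  proof (intro iffI ballI allI impI)
    fix e assume comm: "\<forall>z. cmod z = 1 \<longrightarrow> \<alpha> \<circ> gauge z = gauge z \<circ> \<alpha>" and e: "e \<in> arcs E"
    have "gauge z (\<alpha> (S e)) = z *\<^sub>C \<alpha> (S e)" if "cmod z = 1" for z
      using fun_cong[OF comm[rule_format, OF that], of "S e"] that e
      by (simp add: gauge(2) star_hom_simps(3)[OF \<alpha>])
    then show "homogeneous 1 (\<alpha> (S e))"
      by (simp add: homogeneous_def)
  next
    fix z :: complex
    assume hom: "\<forall>e\<in>arcs E. homogeneous 1 (\<alpha> (S e))" and z: "cmod z = 1"
    show "\<alpha> \<circ> gauge z = gauge z \<circ> \<alpha>"
    proof (rule star_hom_eqI)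
      show "star_hom cstar_of cstar_of (\<alpha> \<circ> gauge z)" "star_hom cstar_of cstar_of (gauge z \<circ> \<alpha>)"
        by (intro star_hom_comp \<alpha> gauge(1) z)+
      show "(\<alpha> \<circ> gauge z) (S e) = (gauge z \<circ> \<alpha>) (S e)" if "e \<in> arcs E" for e
        using hom that z by (simp add: homogeneous_def gauge(2) star_hom_simps(3)[OF \<alpha>])
    qed
  qed
qed

lemma factors_through_T_iff: "(\<exists>w\<in>core. x = w * T) \<longleftrightarrow> homogeneous 1 x"
proof
  assume "\<exists>w\<in>core. x = w * T"
  then show "homogeneous 1 x"
    using homogeneous_mult[OF _ homogeneous_T, of 0] by (auto simp: core_iff)
next
  assume "homogeneous 1 x"
  then have "x * star T \<in> core"
    using homogeneous_mult[OF _ homogeneous_star[OF homogeneous_T], of 1 x] by (simp add: core_iff)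
  then show "\<exists>w\<in>core. x = w * T"
    by (intro bexI[of _ "x * star T"]) (simp_all add: mult.assoc star_T_T)
qed

lemma core_invariant:
  assumes aut: "\<alpha> \<in> cstar_aut" and comm: "\<And>z. cmod z = 1 \<Longrightarrow> \<alpha> \<circ> gauge z = gauge z \<circ> \<alpha>"
  shows "\<alpha> ` core = core"
proof -
  have "gauge z (\<alpha> x) = \<alpha> (gauge z x)" if "cmod z = 1" for z x
    using fun_cong[OF comm[OF that], of x] by simp
  then have "\<alpha> x \<in> core \<longleftrightarrow> x \<in> core" for x
    using aut by (auto simp: core_subalgebra_def cstar_aut_def dest!: bij_is_inj simp: inj_eq)
  then show ?thesis
    using aut by (auto simp: cstar_aut_def image_iff) (metis bij_pointE)
qed

end

theorem lemma4p5:
  fixes E :: "('v, 'e) pre_digraph"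
    and P :: "'v \<Rightarrow> 'a::cstar_algebra"
    and S :: "'e \<Rightarrow> 'a"
    and ev :: "'v \<Rightarrow> 'e"
    and T :: 'a
    and \<alpha> :: "'a \<Rightarrow> 'a"
  assumes "fin_digraph E"
    and "\<And>v. \<not> is_sink E v"
    and "\<And>v. \<not> is_source E v"
    and "\<And>p. wf_digraph.closed_w E p \<Longrightarrow> has_exit E p"
    and "is_graph_cstar E P S"
    and "has_trivial_center (core_subalgebra E P S)"
    and "\<And>v. v \<in> verts E \<Longrightarrow> ev v \<in> arcs E \<and> head E (ev v) = v"
    and "T = (\<Sum>v\<in>verts E. S (ev v))"
    and "\<alpha> \<in> cstar_aut"
  shows "((\<forall>z. cmod z = 1 \<longrightarrow> \<alpha> \<circ> gauge_action E P S z = gauge_action E P S z \<circ> \<alpha>) \<longleftrightarrow>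
           (\<forall>e\<in>arcs E. \<exists>w\<in>core_subalgebra E P S. \<alpha> (S e) = w * T)) \<and>
         ((\<forall>e\<in>arcs E. \<exists>w\<in>core_subalgebra E P S. \<alpha> (S e) = w * T) \<longleftrightarrow>
           \<alpha> ` core_subalgebra E P S = core_subalgebra E P S)"
proof -
  interpret fin_digraph E by fact
  interpret G: graph_isometry E P S ev
    by unfold_locales (fact assms)+
  have T: "T = G.T"
    by (simp add: assms(8) G.T_def)
  have "G.homogeneous 1 (\<alpha> (S e))" if core: "\<alpha> ` G.core = G.core" and e: "e \<in> arcs E" for e
  proof -
    obtain u where u: "\<And>x :: 'a. u * x = x \<and> x * u = x" "center_of G.core = range (\<lambda>c. c *\<^sub>C u)"
      using assms(6) by (auto simp: has_trivial_center_def)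
    have "u = G.unit"
      using u(1)[of G.unit] by simp
    with u(2) have center: "\<exists>c. r = c *\<^sub>C G.unit"
      if "r \<in> G.core" "\<And>f. f \<in> G.core \<Longrightarrow> r * f = f * r" for r
      using that by (auto simp: center_of_def)
    interpret graph_isometry_factor_core E P S ev
    proof
      show "verts E \<noteq> {}"
        using tail_in_verts[OF e] by blast
    qed (fact center)
    show ?thesis
      using automorphism_S_homogeneous automorphism_degree_1 assms(9) core e by blast
  qed
  moreover note G.commutes_with_gauge_iff[OF assms(9)] G.core_invariant[OF assms(9)]
  ultimately show ?thesis
    unfolding T G.factors_through_T_iff by blast
qed

end
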